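(* Let $\pi\colon P\to M$ be a principal $\mathbb{X}$-bundle for a Lie groupoid $\mathbb{X}=[X_1\rightrightarrows X_0]$ with anchor $a\colon P\to X_0$. Let $\mathcal{A}\mathfrak{ct}(\pi^*TM)$ be the groupoid with objects $\pi^*TM=\{(p,\pi(p),u)\mid p\in P,\ u\in T_{\pi(p)}M\}$ and morphisms $\pi^*TM\times_{X_0}X_1=\{(p,\pi(p),u,g)\mid a(p)=t(g)\}$, where $(p,\pi(p),u,g)$ goes from $(p,\pi(p),u)$ to $(pg,\pi(pg),u)$. Then $\mathcal{A}\mathfrak{ct}(\pi^*TM)$ is a Lie (and thus diffeological) groupoid, and $\bar\pi\colon\mathcal{A}\mathfrak{ct}(\pi^*TM)\to M$, $(p,\pi(p),u)\mapsto\pi(p)$, $(p,\pi(p),u,g)\mapsto\pi(p)$, is a smooth surjective functor to the discrete category $M$ such that for each $m\in M$ the set of connected components of the fibre $\bar\pi^{-1}(m)$ is a vector space (being identified with $T_mM$).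
   Context: Lie groupoid $\mathbb{X}=[X_1\rightrightarrows X_0]$: source $s$, target $t$ are submersions, $gh$ is defined when $s(g)=t(h)$. Right action on $P$ with anchor $a\colon P\to X_0$: $pg$ is defined when $a(p)=t(g)$, $a(pg)=s(g)$, $(pg)h=p(gh)$, $p1_{a(p)}=p$. Principal $\mathbb{X}$-bundle: a surjective submersion $\pi\colon P\to M$ with a right action, $\pi(pg)=\pi(p)$, and $(p,g)\mapsto(p,pg)$ a diffeomorphism $P\times_{X_0}X_1\to P\times_MP$. Composition in $\mathcal{A}\mathfrak{ct}(\pi^*TM)$ multiplies the $X_1$-components: the arrow with component $g$ followed by the arrow with component $h$ is the arrow with component $gh$. Connected components of a groupoid are its isomorphism classes of objects. *)

theory Defs
  imports "HOL-Analysis.Analysis" "HOL-Algebra.Module"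
begin

section \<open>Smooth maps between open subsets of Euclidean spaces\<close>

text \<open>
  The space of real \<open>n\<close>-tuples is the library space \<^const>\<open>Euclidean_space\<close> \<open>n\<close>: the functions
  of type \<open>nat \<Rightarrow> real\<close> vanishing at all \<open>i \<ge> n\<close>, with the subspace topology. In particular the
  \<open>k\<close>-tuples are literally the subset of the \<open>n\<close>-tuples whose last \<open>n - k\<close> coordinates vanish.
\<close>

type_synonym rvec = "nat \<Rightarrow> real"

abbreviation euclid :: "nat \<Rightarrow> rvec set" where
  "euclid n \<equiv> topspace (Euclidean_space n)"

definition partial :: "nat \<Rightarrow> (rvec \<Rightarrow> real) \<Rightarrow> rvec \<Rightarrow> real" where
  "partial i f x = deriv (\<lambda>t. f (x(i := t))) (x i)"

primrec Ck_on :: "nat \<Rightarrow> nat \<Rightarrow> rvec set \<Rightarrow> (rvec \<Rightarrow> real) \<Rightarrow> bool" where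
  "Ck_on n 0 U f \<longleftrightarrow> continuous_map (subtopology (Euclidean_space n) U) euclideanreal f"
| "Ck_on n (Suc k) U f \<longleftrightarrow>
     continuous_map (subtopology (Euclidean_space n) U) euclideanreal f \<and>
     (\<forall>i<n. (\<forall>x\<in>U. (\<lambda>t. f (x(i := t))) differentiable (at (x i))) \<and> Ck_on n k U (partial i f))"

text \<open>The values of the map outside \<open>U\<close> are irrelevant.\<close>

definition smooth_between :: "nat \<Rightarrow> nat \<Rightarrow> rvec set \<Rightarrow> (rvec \<Rightarrow> rvec) \<Rightarrow> bool" where
  "smooth_between m n U f \<longleftrightarrow>
     openin (Euclidean_space m) U \<and> f ` U \<subseteq> euclid n \<and>
     (\<forall>j<n. \<forall>k. Ck_on m k U (\<lambda>x. f x j))"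

text \<open>The total derivative at \<open>x\<close>, applied to \<open>v\<close> (the Jacobian matrix times \<open>v\<close>).\<close>

definition total_deriv :: "nat \<Rightarrow> (rvec \<Rightarrow> rvec) \<Rightarrow> rvec \<Rightarrow> rvec \<Rightarrow> rvec" where
  "total_deriv m f x v = (\<lambda>j. \<Sum>i<m. partial i (\<lambda>y. f y j) x * v i)"

definition append_vec :: "nat \<Rightarrow> rvec \<Rightarrow> rvec \<Rightarrow> rvec" where
  "append_vec n x y = (\<lambda>i. if i < n then x i else y (i - n))"


section \<open>Smooth manifolds\<close>

text \<open>A chart is a domain together with a coordinate map, whose values off the domain are irrelevant.\<close>

type_synonym 'a chart = "'a set \<times> ('a \<Rightarrow> rvec)"

record 'a manifold =
  mspace :: "'a topology"
  mdim :: nat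
  matlas :: "'a chart set"

abbreviation mpoints :: "'a manifold \<Rightarrow> 'a set" where
  "mpoints M \<equiv> topspace (mspace M)"

definition coord_chart :: "'a topology \<Rightarrow> nat \<Rightarrow> 'a chart \<Rightarrow> bool" where
  "coord_chart T n c \<longleftrightarrow>
     openin T (fst c) \<and> openin (Euclidean_space n) (snd c ` fst c) \<and>
     homeomorphic_map (subtopology T (fst c))
       (subtopology (Euclidean_space n) (snd c ` fst c)) (snd c)"

definition chart_inv :: "'a chart \<Rightarrow> rvec \<Rightarrow> 'a" where
  "chart_inv c = inv_into (fst c) (snd c)"

definition transition :: "'a chart \<Rightarrow> 'a chart \<Rightarrow> rvec \<Rightarrow> rvec" where
  "transition c d = snd d \<circ> chart_inv c"

definition compatible :: "nat \<Rightarrow> 'a chart \<Rightarrow> 'a chart \<Rightarrow> bool" where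
  "compatible n c d \<longleftrightarrow>
     smooth_between n n (snd c ` (fst c \<inter> fst d)) (transition c d) \<and>
     smooth_between n n (snd d ` (fst c \<inter> fst d)) (transition d c)"

definition second_countable :: "'a topology \<Rightarrow> bool" where
  "second_countable T \<longleftrightarrow>
     (\<exists>B. countable B \<and> (\<forall>V\<in>B. openin T V) \<and>
          (\<forall>U x. openin T U \<and> x \<in> U \<longrightarrow> (\<exists>V\<in>B. x \<in> V \<and> V \<subseteq> U)))"

text \<open>
  The atlas need not be maximal; \<open>charts M\<close> is the maximal atlas it generates.
\<close>

definition smooth_manifold :: "'a manifold \<Rightarrow> bool" where
  "smooth_manifold M \<longleftrightarrow>
     Hausdorff_space (mspace M) \<and> second_countable (mspace M) \<and>
     (\<forall>c\<in>matlas M. coord_chart (mspace M) (mdim M) c) \<and>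
     \<Union>(fst ` matlas M) = mpoints M \<and>
     (\<forall>c\<in>matlas M. \<forall>d\<in>matlas M. compatible (mdim M) c d)"

definition charts :: "'a manifold \<Rightarrow> 'a chart set" where
  "charts M = {c. coord_chart (mspace M) (mdim M) c \<and> (\<forall>d\<in>matlas M. compatible (mdim M) c d)}"

definition smooth_map :: "'a manifold \<Rightarrow> 'b manifold \<Rightarrow> ('a \<Rightarrow> 'b) \<Rightarrow> bool" where
  "smooth_map M N f \<longleftrightarrow>
     continuous_map (mspace M) (mspace N) f \<and>
     (\<forall>c\<in>matlas M. \<forall>d\<in>matlas N.
        smooth_between (mdim M) (mdim N) (snd c ` {x \<in> fst c. f x \<in> fst d})
          (snd d \<circ> f \<circ> chart_inv c))"

definition diffeomorphism :: "'a manifold \<Rightarrow> 'b manifold \<Rightarrow> ('a \<Rightarrow> 'b) \<Rightarrow> bool" where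
  "diffeomorphism M N f \<longleftrightarrow>
     bij_betw f (mpoints M) (mpoints N) \<and> smooth_map M N f \<and>
     smooth_map N M (inv_into (mpoints M) f)"

definition open_euclid_manifold :: "nat \<Rightarrow> rvec set \<Rightarrow> rvec manifold" where
  "open_euclid_manifold n U =
     \<lparr> mspace = subtopology (Euclidean_space n) U, mdim = n, matlas = {(U, id)} \<rparr>"

definition product_manifold :: "'a manifold \<Rightarrow> 'b manifold \<Rightarrow> ('a \<times> 'b) manifold" where
  "product_manifold M N =
     \<lparr> mspace = prod_topology (mspace M) (mspace N),
       mdim = mdim M + mdim N,
       matlas = {(fst c \<times> fst d, \<lambda>(x, y). append_vec (mdim M) (snd c x) (snd d y)) | c d.
                 c \<in> matlas M \<and> d \<in> matlas N} \<rparr>"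

text \<open>
  Embedded submanifolds of dimension \<open>k\<close>: a slice chart maps the part of \<open>S\<close> in its domain onto
  the part of its image where the coordinates with index \<open>\<ge> k\<close> vanish, hence restricts to a
  \<open>k\<close>-dimensional chart of \<open>S\<close>. If \<open>S\<close> is covered by slice charts, their restrictions form a smooth
  atlas of \<open>S\<close>; if it is not, \<open>embedded M S k\<close> fails to be a smooth manifold.
\<close>

definition slice_chart :: "'a manifold \<Rightarrow> 'a set \<Rightarrow> nat \<Rightarrow> 'a chart \<Rightarrow> bool" where
  "slice_chart M S k c \<longleftrightarrow>
     c \<in> charts M \<and> snd c ` (fst c \<inter> S) = snd c ` fst c \<inter> euclid k"

definition embedded :: "'a manifold \<Rightarrow> 'a set \<Rightarrow> nat \<Rightarrow> 'a manifold" where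
  "embedded M S k =
     \<lparr> mspace = subtopology (mspace M) S, mdim = k,
       matlas = {(fst c \<inter> S, snd c) | c. slice_chart M S k c} \<rparr>"

text \<open>
  Fibre product of \<open>f : M \<rightarrow> B\<close> and \<open>g : N \<rightarrow> B\<close> as an embedded submanifold of the product. The
  dimension is the one it has if one of the two maps is a submersion, which is the only case used.
\<close>

definition fibre_product ::
    "'a manifold \<Rightarrow> 'b manifold \<Rightarrow> 'c manifold \<Rightarrow> ('a \<Rightarrow> 'c) \<Rightarrow> ('b \<Rightarrow> 'c) \<Rightarrow> ('a \<times> 'b) manifold" where
  "fibre_product M N B f g =
     embedded (product_manifold M N) {(x, y). x \<in> mpoints M \<and> y \<in> mpoints N \<and> f x = g y}
       (mdim M + mdim N - mdim B)"


section \<open>Tangent spaces, tangent bundle, submersions\<close>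

text \<open>
  A tangent vector at \<open>x\<close> assigns to each chart of the atlas around \<open>x\<close> a coordinate vector, such
  that the coordinate vectors in any two charts are related by the derivative of the transition map.
\<close>

type_synonym 'a tvec = "'a chart \<Rightarrow> rvec"

definition charts_at :: "'a manifold \<Rightarrow> 'a \<Rightarrow> 'a chart set" where
  "charts_at M x = {c \<in> matlas M. x \<in> fst c}"

definition tangent_vectors :: "'a manifold \<Rightarrow> 'a \<Rightarrow> 'a tvec set" where
  "tangent_vectors M x =
     {u \<in> charts_at M x \<rightarrow>\<^sub>E euclid (mdim M).
        \<forall>c\<in>charts_at M x. \<forall>d\<in>charts_at M x.
          u d = total_deriv (mdim M) (transition c d) (snd c x) (u c)}"

text \<open>
  Real vector spaces are library modules over the field of real numbers; the ring multiplication
  and unit contained in the library's module record are irrelevant.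
\<close>

definition real_field :: "real ring" where
  "real_field = \<lparr> carrier = UNIV, mult = (*), one = 1, zero = 0, add = (+) \<rparr>"

abbreviation real_vector_space :: "(real, 'v) module \<Rightarrow> bool" where
  "real_vector_space V \<equiv> Module.module real_field V"

definition tangent_space :: "'a manifold \<Rightarrow> 'a \<Rightarrow> (real, 'a tvec) module" where
  "tangent_space M x =
     \<lparr> carrier = tangent_vectors M x, mult = undefined, one = undefined,
       zero = (\<lambda>c\<in>charts_at M x. \<lambda>i. 0),
       add = (\<lambda>u v. \<lambda>c\<in>charts_at M x. \<lambda>i. u c i + v c i),
       smult = (\<lambda>r u. \<lambda>c\<in>charts_at M x. \<lambda>i. r * u c i) \<rparr>"

definition linear_iso ::
    "(real, 'v) module \<Rightarrow> (real, 'w) module \<Rightarrow> ('v \<Rightarrow> 'w) \<Rightarrow> bool" where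
  "linear_iso V W f \<longleftrightarrow>
     bij_betw f (carrier V) (carrier W) \<and>
     (\<forall>x\<in>carrier V. \<forall>y\<in>carrier V. f (x \<oplus>\<^bsub>V\<^esub> y) = f x \<oplus>\<^bsub>W\<^esub> f y) \<and>
     (\<forall>r. \<forall>x\<in>carrier V. f (r \<odot>\<^bsub>V\<^esub> x) = r \<odot>\<^bsub>W\<^esub> f x)"

text \<open>The differential does not depend on the chart \<open>c\<close> used to compute it.\<close>

definition differential :: "'a manifold \<Rightarrow> 'b manifold \<Rightarrow> ('a \<Rightarrow> 'b) \<Rightarrow> 'a \<Rightarrow> 'a tvec \<Rightarrow> 'b tvec" where
  "differential M N f x u =
     (let c = (SOME c. c \<in> charts_at M x) in
      (\<lambda>d\<in>charts_at N (f x). total_deriv (mdim M) (snd d \<circ> f \<circ> chart_inv c) (snd c x) (u c)))"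

definition submersion :: "'a manifold \<Rightarrow> 'b manifold \<Rightarrow> ('a \<Rightarrow> 'b) \<Rightarrow> bool" where
  "submersion M N f \<longleftrightarrow>
     smooth_map M N f \<and>
     (\<forall>x\<in>mpoints M. differential M N f x ` tangent_vectors M x = tangent_vectors N (f x))"

definition tangent_chart :: "'a manifold \<Rightarrow> 'a chart \<Rightarrow> ('a \<times> 'a tvec) chart" where
  "tangent_chart M c =
     ((SIGMA x : fst c. tangent_vectors M x), \<lambda>(x, u). append_vec (mdim M) (snd c x) (u c))"

definition tangent_bundle :: "'a manifold \<Rightarrow> ('a \<times> 'a tvec) manifold" where
  "tangent_bundle M =
     \<lparr> mspace = topology_generated_by
         {{v \<in> fst (tangent_chart M c). snd (tangent_chart M c) v \<in> W} | c W.
            c \<in> matlas M \<and> openin (Euclidean_space (2 * mdim M)) W},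
       mdim = 2 * mdim M,
       matlas = tangent_chart M ` matlas M \<rparr>"


section \<open>Groupoids\<close>

text \<open>\<open>gcomp G g h\<close> is the product \<open>gh\<close>, defined when \<open>src G g = tgt G h\<close>: first \<open>h\<close>, then \<open>g\<close>.\<close>

record ('o, 'm) groupoid =
  Obj :: "'o set"
  Arr :: "'m set"
  src :: "'m \<Rightarrow> 'o"
  tgt :: "'m \<Rightarrow> 'o"
  gcomp :: "'m \<Rightarrow> 'm \<Rightarrow> 'm"
  unit_arr :: "'o \<Rightarrow> 'm"
  inv_arr :: "'m \<Rightarrow> 'm"

definition is_groupoid :: "('o, 'm) groupoid \<Rightarrow> bool" where
  "is_groupoid G \<longleftrightarrow>
     (\<forall>g\<in>Arr G. src G g \<in> Obj G \<and> tgt G g \<in> Obj G) \<and>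
     (\<forall>g\<in>Arr G. \<forall>h\<in>Arr G. src G g = tgt G h \<longrightarrow>
        gcomp G g h \<in> Arr G \<and> src G (gcomp G g h) = src G h \<and> tgt G (gcomp G g h) = tgt G g) \<and>
     (\<forall>g\<in>Arr G. \<forall>h\<in>Arr G. \<forall>k\<in>Arr G. src G g = tgt G h \<and> src G h = tgt G k \<longrightarrow>
        gcomp G (gcomp G g h) k = gcomp G g (gcomp G h k)) \<and>
     (\<forall>x\<in>Obj G. unit_arr G x \<in> Arr G \<and> src G (unit_arr G x) = x \<and> tgt G (unit_arr G x) = x) \<and>
     (\<forall>g\<in>Arr G. gcomp G g (unit_arr G (src G g)) = g \<and> gcomp G (unit_arr G (tgt G g)) g = g) \<and>
     (\<forall>g\<in>Arr G. inv_arr G g \<in> Arr G \<and> src G (inv_arr G g) = tgt G g \<and> tgt G (inv_arr G g) = src G g \<and>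
        gcomp G g (inv_arr G g) = unit_arr G (tgt G g) \<and>
        gcomp G (inv_arr G g) g = unit_arr G (src G g))"

definition groupoid_functor ::
    "('o, 'm) groupoid \<Rightarrow> ('p, 'n) groupoid \<Rightarrow> ('o \<Rightarrow> 'p) \<Rightarrow> ('m \<Rightarrow> 'n) \<Rightarrow> bool" where
  "groupoid_functor G H F0 F1 \<longleftrightarrow>
     F0 ` Obj G \<subseteq> Obj H \<and> F1 ` Arr G \<subseteq> Arr H \<and>
     (\<forall>g\<in>Arr G. src H (F1 g) = F0 (src G g) \<and> tgt H (F1 g) = F0 (tgt G g)) \<and>
     (\<forall>g\<in>Arr G. \<forall>h\<in>Arr G. src G g = tgt G h \<longrightarrow> F1 (gcomp G g h) = gcomp H (F1 g) (F1 h)) \<and>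
     (\<forall>x\<in>Obj G. F1 (unit_arr G x) = unit_arr H (F0 x))"

definition discrete_groupoid :: "'a set \<Rightarrow> ('a, 'a) groupoid" where
  "discrete_groupoid A =
     \<lparr> Obj = A, Arr = A, src = id, tgt = id, gcomp = (\<lambda>g h. g), unit_arr = id, inv_arr = id \<rparr>"

definition fibre_groupoid ::
    "('o, 'm) groupoid \<Rightarrow> ('p, 'n) groupoid \<Rightarrow> ('o \<Rightarrow> 'p) \<Rightarrow> ('m \<Rightarrow> 'n) \<Rightarrow> 'p \<Rightarrow> ('o, 'm) groupoid" where
  "fibre_groupoid G H F0 F1 y =
     G \<lparr> Obj := {x \<in> Obj G. F0 x = y}, Arr := {g \<in> Arr G. F1 g = unit_arr H y} \<rparr>"

definition iso_rel :: "('o, 'm) groupoid \<Rightarrow> ('o \<times> 'o) set" where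
  "iso_rel G = {(x, y). x \<in> Obj G \<and> y \<in> Obj G \<and> (\<exists>g\<in>Arr G. src G g = x \<and> tgt G g = y)}"

definition connected_comps :: "('o, 'm) groupoid \<Rightarrow> 'o set set" where
  "connected_comps G = Obj G // iso_rel G"

text \<open>\<open>G\<close> is a Lie groupoid with manifold of objects \<open>X0\<close> and manifold of arrows \<open>X1\<close>.\<close>

definition lie_groupoid :: "('o, 'm) groupoid \<Rightarrow> 'o manifold \<Rightarrow> 'm manifold \<Rightarrow> bool" where
  "lie_groupoid G X0 X1 \<longleftrightarrow>
     is_groupoid G \<and> Obj G = mpoints X0 \<and> Arr G = mpoints X1 \<and>
     smooth_manifold X0 \<and> smooth_manifold X1 \<and>
     submersion X1 X0 (src G) \<and> submersion X1 X0 (tgt G) \<and>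
     smooth_map (fibre_product X1 X1 X0 (src G) (tgt G)) X1 (\<lambda>(g, h). gcomp G g h) \<and>
     smooth_map X0 X1 (unit_arr G) \<and> smooth_map X1 X1 (inv_arr G)"


section \<open>Diffeological groupoids\<close>

text \<open>
  \<open>D n U p\<close> means that the parametrization \<open>p\<close>, defined on the open subset \<open>U\<close> of the \<open>n\<close>-dimensional
  Euclidean space, is a plot. The function \<open>q\<close> in the third axiom makes being a plot independent of
  the values outside the domain.
\<close>

type_synonym 'a plots = "nat \<Rightarrow> rvec set \<Rightarrow> (rvec \<Rightarrow> 'a) \<Rightarrow> bool"

definition diffeology :: "'a set \<Rightarrow> 'a plots \<Rightarrow> bool" where
  "diffeology X D \<longleftrightarrow>
     (\<forall>n U p. D n U p \<longrightarrow> openin (Euclidean_space n) U \<and> p ` U \<subseteq> X) \<and>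
     (\<forall>n U x. openin (Euclidean_space n) U \<and> x \<in> X \<longrightarrow> D n U (\<lambda>_. x)) \<and>
     (\<forall>m n U V p q h. D n U p \<and> smooth_between m n V h \<and> h ` V \<subseteq> U \<and> (\<forall>x\<in>V. q x = p (h x))
        \<longrightarrow> D m V q) \<and>
     (\<forall>n U p. openin (Euclidean_space n) U \<and> (\<forall>x\<in>U. \<exists>V. x \<in> V \<and> V \<subseteq> U \<and> D n V p) \<longrightarrow> D n U p)"

definition diffeo_smooth :: "'a plots \<Rightarrow> 'b plots \<Rightarrow> ('a \<Rightarrow> 'b) \<Rightarrow> bool" where
  "diffeo_smooth D E f \<longleftrightarrow> (\<forall>n U p. D n U p \<longrightarrow> E n U (f \<circ> p))"

definition product_plots :: "'a plots \<Rightarrow> 'b plots \<Rightarrow> ('a \<times> 'b) plots" where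
  "product_plots D E = (\<lambda>n U p. D n U (fst \<circ> p) \<and> E n U (snd \<circ> p))"

definition subset_plots :: "'a plots \<Rightarrow> 'a set \<Rightarrow> 'a plots" where
  "subset_plots D S = (\<lambda>n U p. D n U p \<and> p ` U \<subseteq> S)"

definition manifold_plots :: "'a manifold \<Rightarrow> 'a plots" where
  "manifold_plots M = (\<lambda>n U p. openin (Euclidean_space n) U \<and> smooth_map (open_euclid_manifold n U) M p)"

definition diffeological_groupoid :: "('o, 'm) groupoid \<Rightarrow> 'o plots \<Rightarrow> 'm plots \<Rightarrow> bool" where
  "diffeological_groupoid G D0 D1 \<longleftrightarrow>
     is_groupoid G \<and> diffeology (Obj G) D0 \<and> diffeology (Arr G) D1 \<and>
     diffeo_smooth D1 D0 (src G) \<and> diffeo_smooth D1 D0 (tgt G) \<and>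
     diffeo_smooth
       (subset_plots (product_plots D1 D1) {(g, h). g \<in> Arr G \<and> h \<in> Arr G \<and> src G g = tgt G h})
       D1 (\<lambda>(g, h). gcomp G g h) \<and>
     diffeo_smooth D0 D1 (unit_arr G) \<and> diffeo_smooth D1 D1 (inv_arr G)"


section \<open>Principal bundles\<close>

text \<open>\<open>act p g\<close> is the product \<open>pg\<close>, defined when \<open>a p = tgt G g\<close>.\<close>

definition right_action ::
    "('o, 'm) groupoid \<Rightarrow> 'o manifold \<Rightarrow> 'm manifold \<Rightarrow> 'p manifold \<Rightarrow> ('p \<Rightarrow> 'o) \<Rightarrow>
     ('p \<Rightarrow> 'm \<Rightarrow> 'p) \<Rightarrow> bool" where
  "right_action G X0 X1 P a act \<longleftrightarrow>
     smooth_map P X0 a \<and>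
     smooth_map (fibre_product P X1 X0 a (tgt G)) P (\<lambda>(p, g). act p g) \<and>
     (\<forall>p\<in>mpoints P. \<forall>g\<in>Arr G. a p = tgt G g \<longrightarrow> act p g \<in> mpoints P \<and> a (act p g) = src G g) \<and>
     (\<forall>p\<in>mpoints P. \<forall>g\<in>Arr G. \<forall>h\<in>Arr G. a p = tgt G g \<and> src G g = tgt G h \<longrightarrow>
        act (act p g) h = act p (gcomp G g h)) \<and>
     (\<forall>p\<in>mpoints P. act p (unit_arr G (a p)) = p)"

definition principal_bundle ::
    "('o, 'm) groupoid \<Rightarrow> 'o manifold \<Rightarrow> 'm manifold \<Rightarrow> 'p manifold \<Rightarrow> 'b manifold \<Rightarrow> ('p \<Rightarrow> 'b) \<Rightarrow>
     ('p \<Rightarrow> 'o) \<Rightarrow> ('p \<Rightarrow> 'm \<Rightarrow> 'p) \<Rightarrow> bool" where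
  "principal_bundle G X0 X1 P M \<pi> a act \<longleftrightarrow>
     smooth_manifold P \<and> smooth_manifold M \<and>
     submersion P M \<pi> \<and> \<pi> ` mpoints P = mpoints M \<and>
     right_action G X0 X1 P a act \<and>
     (\<forall>p\<in>mpoints P. \<forall>g\<in>Arr G. a p = tgt G g \<longrightarrow> \<pi> (act p g) = \<pi> p) \<and>
     diffeomorphism (fibre_product P X1 X0 a (tgt G)) (fibre_product P P M \<pi> \<pi>)
       (\<lambda>(p, g). (p, act p g))"


section \<open>The action groupoid of the pulled back tangent bundle\<close>

text \<open>
  The points of the pullback have the form \<open>(p, m, u)\<close> with \<open>m = \<pi> p\<close> and \<open>u\<close> a tangent vector at \<open>m\<close>.
  The arrows have the form \<open>((p, m, u), g)\<close>.
\<close>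

definition pullback_tangent ::
    "'p manifold \<Rightarrow> 'b manifold \<Rightarrow> ('p \<Rightarrow> 'b) \<Rightarrow> ('p \<times> 'b \<times> 'b tvec) manifold" where
  "pullback_tangent P M \<pi> = fibre_product P (tangent_bundle M) M \<pi> fst"

definition act_arrows ::
    "('o, 'm) groupoid \<Rightarrow> 'o manifold \<Rightarrow> 'm manifold \<Rightarrow> 'p manifold \<Rightarrow> 'b manifold \<Rightarrow> ('p \<Rightarrow> 'b) \<Rightarrow>
     ('p \<Rightarrow> 'o) \<Rightarrow> (('p \<times> 'b \<times> 'b tvec) \<times> 'm) manifold" where
  "act_arrows G X0 X1 P M \<pi> a =
     fibre_product (pullback_tangent P M \<pi>) X1 X0 (\<lambda>(p, m, u). a p) (tgt G)"

definition act_groupoid ::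
    "('o, 'm) groupoid \<Rightarrow> 'o manifold \<Rightarrow> 'm manifold \<Rightarrow> 'p manifold \<Rightarrow> 'b manifold \<Rightarrow> ('p \<Rightarrow> 'b) \<Rightarrow>
     ('p \<Rightarrow> 'o) \<Rightarrow> ('p \<Rightarrow> 'm \<Rightarrow> 'p) \<Rightarrow>
     ('p \<times> 'b \<times> 'b tvec, ('p \<times> 'b \<times> 'b tvec) \<times> 'm) groupoid" where
  "act_groupoid G X0 X1 P M \<pi> a act =
     \<lparr> Obj = mpoints (pullback_tangent P M \<pi>),
       Arr = mpoints (act_arrows G X0 X1 P M \<pi> a),
       src = (\<lambda>((p, m, u), g). (p, m, u)),
       tgt = (\<lambda>((p, m, u), g). (act p g, \<pi> (act p g), u)),
       gcomp = (\<lambda>((p', m', u'), h) ((p, m, u), g). ((p, m, u), gcomp G g h)),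
       unit_arr = (\<lambda>(p, m, u). ((p, m, u), unit_arr G (a p))),
       inv_arr = (\<lambda>((p, m, u), g). ((act p g, \<pi> (act p g), u), inv_arr G g)) \<rparr>"

definition act_proj_obj :: "('p \<Rightarrow> 'b) \<Rightarrow> 'p \<times> 'b \<times> 'b tvec \<Rightarrow> 'b" where
  "act_proj_obj \<pi> = (\<lambda>(p, m, u). \<pi> p)"

definition act_proj_arr :: "('p \<Rightarrow> 'b) \<Rightarrow> ('p \<times> 'b \<times> 'b tvec) \<times> 'm \<Rightarrow> 'b" where
  "act_proj_arr \<pi> = (\<lambda>((p, m, u), g). \<pi> p)"

end

theory Submission
  imports Defs
begin

text \<open>
  Everything except the manifold structure is formal. The arrows of the action groupoid are pairs of
  an object \<open>(p, \<pi> p, u)\<close> and an arrow \<open>g\<close> of \<open>X\<close> acting on \<open>p\<close>; the groupoid laws are the laws of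
  the action and of \<open>X\<close>. An arrow moves \<open>p\<close> inside its \<open>\<pi>\<close>-fibre and leaves \<open>u\<close> alone, and the
  action is transitive on each \<open>\<pi>\<close>-fibre because \<open>(p, g) \<mapsto> (p, pg)\<close> is onto \<open>P \<times>\<^sub>M P\<close>. Hence the
  isomorphism classes over \<open>m\<close> are the sets of all \<open>(p, m, u)\<close> with \<open>u\<close> fixed: there is one for every
  tangent vector \<open>u\<close> at \<open>m\<close>, and they inherit the vector space structure of the tangent space
  (\<open>connected_comps_fibre\<close>, \<open>fibre_components_vector_space\<close>).

  The analytic content is that fibre products along a submersion are manifolds. Objects and arrows
  are such fibre products, \<open>P \<times>\<^sub>M TM\<close> along \<open>\<pi>\<close> and \<open>\<pi>\<^sup>*TM \<times>\<^sub>X\<^sub>0 X1\<close> along the target map of \<open>X\<close>.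
  Locally a fibre product is the zero set of a difference of coordinate functions with surjective
  derivative, so it is enough to straighten such a map by a change of coordinates
  (\<open>submersion_normal_form\<close>). This is done one component at a time. Replacing a single coordinate \<open>y l\<close>
  by a function \<open>G y\<close> with nonzero \<open>l\<close>-th partial derivative is a diffeomorphism near the point
  (\<open>coordinate_replacement_straightens\<close>), by the intermediate value theorem on lines and the formula
  that expresses an increment through partial derivatives (\<open>increment_formula\<close>). Surjectivity of the
  derivative guarantees that at each step a coordinate is left that can be replaced.

  Normal forms also show that a smooth map is a submersion if and only if it has a smooth local section
  through every point (\<open>submersion_local_section\<close>, \<open>submersionI\<close>). In this form submersions are stable
  under base change, so the source map of the action groupoid is one; the target map is the source
  map composed with inversion. The remaining structure maps are smooth because maps into a fibre
  product are smooth as soon as their components are (\<open>smooth_at_into_fibre_product\<close>).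
\<close>

section \<open>Calculus with partial derivatives\<close>

lemma in_euclid: "x \<in> euclid n \<longleftrightarrow> (\<forall>i\<ge>n. x i = 0)"
  by (simp add: topspace_Euclidean_space)

lemma openin_Euclidean_open:
  "openin (Euclidean_space n) U \<longleftrightarrow> (\<exists>T. open T \<and> U = T \<inter> euclid n)"
  by (simp add: Euclidean_space_def euclidean_product_topology openin_subtopology)

lemma tendsto_coordinates:
  fixes g :: "'a \<Rightarrow> rvec"
  assumes "\<And>i. ((\<lambda>t. g t i) \<longlongrightarrow> x i) F"
  shows "(g \<longlongrightarrow> x) F"
proof -
  have "limitin (powertop_real UNIV) g x F"
    using assms by (simp add: limitin_componentwise)
  then show ?thesis
    by (simp add: euclidean_product_topology)
qed

lemma open_Collect_coordinates:
  fixes x :: rvec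
  shows "open {y. \<forall>i<n. \<bar>y i - x i\<bar> < e}"
proof -
  have "open {y::rvec. \<bar>y i - x i\<bar> < e}" for i
    by (intro open_Collect_less continuous_intros continuous_on_product_then_coordinatewise)
  moreover have "{y. \<forall>i<n. \<bar>y i - x i\<bar> < e} = (\<Inter>i\<in>{..<n}. {y. \<bar>y i - x i\<bar> < e})"
    by auto
  ultimately show ?thesis
    by (simp add: open_INT)
qed

text \<open>
  Open sets are described by boxes, so that an open set around \<open>x\<close> can be probed by changing one
  coordinate of \<open>x\<close> after the other.
\<close>

lemma openin_Euclidean_box:
  "openin (Euclidean_space n) U \<longleftrightarrow>
     U \<subseteq> euclid n \<and> (\<forall>x\<in>U. \<exists>e>0. \<forall>y\<in>euclid n. (\<forall>i<n. \<bar>y i - x i\<bar> < e) \<longrightarrow> y \<in> U)"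
    (is "?L \<longleftrightarrow> ?R")
proof
  assume ?L
  then obtain T where T: "open T" "U = T \<inter> euclid n"
    by (auto simp: openin_Euclidean_open)
  have "\<exists>e>0. \<forall>y\<in>euclid n. (\<forall>i<n. \<bar>y i - x i\<bar> < e) \<longrightarrow> y \<in> U" if "x \<in> U" for x
  proof (rule ccontr)
    assume "\<not> ?thesis"
    then have "\<forall>k. \<exists>y. y \<in> euclid n \<and> (\<forall>i<n. \<bar>y i - x i\<bar> < inverse (real (Suc k))) \<and> y \<notin> U"
      by (metis inverse_positive_iff_positive of_nat_0_less_iff zero_less_Suc)
    then obtain y where y: "\<And>k. y k \<in> euclid n"
        "\<And>k i. i < n \<Longrightarrow> \<bar>y k i - x i\<bar> < inverse (real (Suc k))" "\<And>k. y k \<notin> U"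
      by metis
    have "(\<lambda>k. y k i) \<longlonglongrightarrow> x i" for i
    proof (cases "i < n")
      case True
      have "(\<lambda>k. y k i - x i) \<longlonglongrightarrow> 0"
      proof (rule Lim_null_comparison [OF _ LIMSEQ_inverse_real_of_nat])
        show "\<forall>\<^sub>F k in sequentially. norm (y k i - x i) \<le> inverse (real (Suc k))"
          using y(2)[OF True] by (auto intro!: always_eventually less_imp_le)
      qed
      then show ?thesis
        by (simp add: LIM_zero_iff)
    next
      case False
      moreover have "x \<in> euclid n"
        using T that by blast
      ultimately show ?thesis
        using y(1) by (simp add: in_euclid)
    qed
    then have "y \<longlonglongrightarrow> x"
      by (rule tendsto_coordinates)
    then have "\<forall>\<^sub>F k in sequentially. y k \<in> T"
      using T that by (auto elim: topological_tendstoD)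
    then show False
      using y T by (metis IntI eventually_sequentially le_refl)
  qed
  then show ?R
    using T by blast
next
  assume R: ?R
  then obtain e where e: "\<And>x. x \<in> U \<Longrightarrow> e x > 0"
      "\<And>x y. x \<in> U \<Longrightarrow> y \<in> euclid n \<Longrightarrow> (\<forall>i<n. \<bar>y i - x i\<bar> < e x) \<Longrightarrow> y \<in> U"
    by metis
  have "U = (\<Union>x\<in>U. {y. \<forall>i<n. \<bar>y i - x i\<bar> < e x}) \<inter> euclid n"
  proof (intro equalityI subsetI)
    show "z \<in> (\<Union>x\<in>U. {y. \<forall>i<n. \<bar>y i - x i\<bar> < e x}) \<inter> euclid n" if "z \<in> U" for z
      using R e(1)[OF that] that by (auto intro!: bexI [of _ z])
    show "z \<in> U" if "z \<in> (\<Union>x\<in>U. {y. \<forall>i<n. \<bar>y i - x i\<bar> < e x}) \<inter> euclid n" for z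
      using that e(2) by auto
  qed
  moreover have "open (\<Union>x\<in>U. {y. \<forall>i<n. \<bar>y i - x i\<bar> < e x})"
    by (intro open_UN ballI open_Collect_coordinates)
  ultimately show ?L
    unfolding openin_Euclidean_open by blast
qed

lemma openin_Euclidean_tendsto:
  assumes "openin (Euclidean_space n) U" "x \<in> U" "(g \<longlongrightarrow> x) F" "\<forall>\<^sub>F t in F. g t \<in> euclid n"
  shows "\<forall>\<^sub>F t in F. g t \<in> U"
proof -
  obtain T where T: "open T" "U = T \<inter> euclid n"
    using assms(1) by (auto simp: openin_Euclidean_open)
  then have "\<forall>\<^sub>F t in F. g t \<in> T"
    using assms(2,3) by (auto elim: topological_tendstoD)
  with assms(4) show ?thesis
    by eventually_elim (simp add: T)
qed

lemma fun_upd_in_euclid: "x \<in> euclid n \<Longrightarrow> i < n \<Longrightarrow> x(i := t) \<in> euclid n"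
  by (auto simp: in_euclid)

lemma openin_subset_euclid: "openin (Euclidean_space n) U \<Longrightarrow> x \<in> U \<Longrightarrow> x \<in> euclid n"
  using openin_subset by blast

lemma eventually_fun_upd_in:
  assumes "openin (Euclidean_space n) U" "x \<in> U" "i < n"
  shows "\<forall>\<^sub>F t in nhds (x i). x(i := t) \<in> U"
proof -
  have "((\<lambda>t. x(i := t)) \<longlongrightarrow> x) (nhds (x i))"
  proof (rule tendsto_coordinates)
    show "((\<lambda>t. (x(i := t)) j) \<longlongrightarrow> x j) (nhds (x i))" for j
      by (cases "j = i") (simp_all add: filterlim_ident)
  qed
  moreover have "\<forall>\<^sub>F t in nhds (x i). x(i := t) \<in> euclid n"
    using assms by (intro always_eventually allI fun_upd_in_euclid openin_subset_euclid)
  ultimately show ?thesis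
    by (rule openin_Euclidean_tendsto [OF assms(1,2)])
qed

lemma Ck_on_0:
  assumes "openin (Euclidean_space n) U"
  shows "Ck_on n 0 U f \<longleftrightarrow> continuous_on U f"
proof -
  have "subtopology (Euclidean_space n) U = top_of_set U"
    using openin_subset [OF assms]
    by (simp add: Euclidean_space_def euclidean_product_topology subtopology_subtopology
        topspace_Euclidean_space Int_absorb1)
  then show ?thesis by simp
qed

lemma Ck_on_Suc:
  assumes "openin (Euclidean_space n) U"
  shows "Ck_on n (Suc k) U f \<longleftrightarrow> continuous_on U f \<and>
     (\<forall>i<n. (\<forall>x\<in>U. (\<lambda>t. f (x(i := t))) differentiable (at (x i))) \<and> Ck_on n k U (partial i f))"
  using Ck_on_0 [OF assms] by (simp only: Ck_on.simps)

declare Ck_on.simps [simp del]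

lemma Ck_on_SucI':
  assumes "openin (Euclidean_space n) U" "continuous_on U f"
    and "\<And>i x. i < n \<Longrightarrow> x \<in> U \<Longrightarrow> (\<lambda>t. f (x(i := t))) differentiable (at (x i))"
    and "\<And>i. i < n \<Longrightarrow> Ck_on n k U (partial i f)"
  shows "Ck_on n (Suc k) U f"
  using assms by (simp add: Ck_on_Suc)

lemma Ck_on_differentiable:
  assumes "Ck_on n (Suc k) U f" "x \<in> U" "i < n"
  shows "(\<lambda>t. f (x(i := t))) differentiable (at (x i))"
  using assms by (simp add: Ck_on.simps)

lemma Ck_on_partial:
  "Ck_on n (Suc k) U f \<Longrightarrow> i < n \<Longrightarrow> Ck_on n k U (partial i f)"
  by (simp add: Ck_on.simps)

lemma Ck_on_imp_continuous_on:
  assumes "openin (Euclidean_space n) U" "Ck_on n k U f"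
  shows "continuous_on U f"
proof -
  show ?thesis
    using assms by (cases k) (simp_all add: Ck_on_0 Ck_on_Suc)
qed

lemma Ck_on_has_partial:
  assumes "Ck_on n (Suc k) U f" "x \<in> U" "i < n"
  shows "((\<lambda>t. f (x(i := t))) has_real_derivative partial i f x) (at (x i))"
  using Ck_on_differentiable [OF assms] by (simp add: partial_def DERIV_deriv_iff_real_differentiable)

lemma partial_eqI:
  assumes "((\<lambda>t. f (x(i := t))) has_real_derivative D) (at (x i))"
  shows "partial i f x = D"
  unfolding partial_def using assms by (rule DERIV_imp_deriv)

lemma partial_cong:
  assumes "openin (Euclidean_space n) U" "x \<in> U" "i < n" "\<And>y. y \<in> U \<Longrightarrow> f y = g y"
  shows "partial i f x = partial i g x"
  unfolding partial_def
proof (rule deriv_cong_ev)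
  show "\<forall>\<^sub>F t in nhds (x i). f (x(i := t)) = g (x(i := t))"
    using eventually_fun_upd_in [OF assms(1-3)] by eventually_elim (rule assms(4))
qed simp

text \<open>
  Since \<open>U\<close> is open, the difference quotients that define a partial derivative at a point of \<open>U\<close>
  eventually involve values on \<open>U\<close> alone.
\<close>

lemma Ck_on_cong:
  assumes "openin (Euclidean_space n) U" "\<And>y. y \<in> U \<Longrightarrow> f y = g y" "Ck_on n k U f"
  shows "Ck_on n k U g"
  using assms(2,3)
proof (induction k arbitrary: f g)
  case 0
  then show ?case
    using Ck_on_0 [OF assms(1)] continuous_on_cong [of U U f g] by simp
next
  case (Suc k)
  have "continuous_on U g"
    using Ck_on_imp_continuous_on [OF assms(1) Suc.prems(2)] continuous_on_cong [of U U f g]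
      Suc.prems(1) by simp
  moreover have "(\<lambda>t. g (x(i := t))) differentiable (at (x i))" if "i < n" "x \<in> U" for i x
  proof -
    have "\<forall>\<^sub>F t in nhds (x i). f (x(i := t)) = g (x(i := t))"
      using eventually_fun_upd_in [OF assms(1) that(2,1)] by eventually_elim (rule Suc.prems(1))
    then have "((\<lambda>t. g (x(i := t))) has_real_derivative partial i f x) (at (x i))"
      by (rule DERIV_cong_ev [OF refl _ refl, THEN iffD1])
        (rule Ck_on_has_partial [OF Suc.prems(2) that(2,1)])
    then show ?thesis
      unfolding real_differentiable_def by blast
  qed
  moreover have "Ck_on n k U (partial i g)" if "i < n" for i
  proof (rule Suc.IH)
    show "Ck_on n k U (partial i f)"
      using Suc.prems(2) that by (simp add: Ck_on.simps)
    show "partial i f y = partial i g y" if "y \<in> U" for y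
      using partial_cong [OF assms(1) that \<open>i < n\<close>] Suc.prems(1) by blast
  qed
  ultimately show ?case
    by (simp add: Ck_on_Suc [OF assms(1)])
qed

text \<open>
  Candidates \<open>D i\<close> for the partial derivatives are recognised by the uniqueness of derivatives; this is
  how all derivatives are computed below.
\<close>

lemma Ck_on_SucI:
  assumes "openin (Euclidean_space n) U" "continuous_on U f"
    and D: "\<And>i x. i < n \<Longrightarrow> x \<in> U \<Longrightarrow>
          ((\<lambda>t. f (x(i := t))) has_real_derivative D i x) (at (x i))"
    and CD: "\<And>i. i < n \<Longrightarrow> Ck_on n k U (D i)"
  shows "Ck_on n (Suc k) U f"
proof -
  have "(\<lambda>t. f (x(i := t))) differentiable (at (x i))" if "i < n" "x \<in> U" for i x
    unfolding real_differentiable_def using D [OF that] by (rule exI)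
  moreover have "Ck_on n k U (partial i f)" if "i < n" for i
  proof (rule Ck_on_cong [OF assms(1) _ CD [OF that]])
    show "D i y = partial i f y" if "y \<in> U" for y
      using partial_eqI [of f y i "D i y"] D [OF \<open>i < n\<close> that] by simp
  qed
  ultimately show ?thesis
    using assms(2) by (simp add: Ck_on_Suc [OF assms(1)])
qed

lemma Ck_on_Suc_imp:
  assumes "openin (Euclidean_space n) U" "Ck_on n (Suc k) U f"
  shows "Ck_on n k U f"
  using assms(2)
proof (induction k arbitrary: f)
  case 0
  then show ?case
    using Ck_on_imp_continuous_on [OF assms(1)] Ck_on_0 [OF assms(1)] by blast
next
  case (Suc k)
  show ?case
  proof (rule Ck_on_SucI' [OF assms(1)])
    show "continuous_on U f"
      using Ck_on_imp_continuous_on [OF assms(1) Suc.prems] .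
    show "(\<lambda>t. f (x(i := t))) differentiable (at (x i))" if "i < n" "x \<in> U" for i x
      using Ck_on_differentiable [OF Suc.prems that(2,1)] .
    show "Ck_on n k U (partial i f)" if "i < n" for i
      using Ck_on_partial [OF Suc.prems that] by (rule Suc.IH)
  qed
qed

lemma Ck_on_subset:
  assumes "openin (Euclidean_space n) U" "openin (Euclidean_space n) V" "V \<subseteq> U" "Ck_on n k U f"
  shows "Ck_on n k V f"
  using assms(4)
proof (induction k arbitrary: f)
  case 0
  then show ?case
    using Ck_on_0 [OF assms(1)] Ck_on_0 [OF assms(2)] continuous_on_subset [OF _ assms(3)] by simp
next
  case (Suc k)
  have "continuous_on V f"
    using Ck_on_imp_continuous_on [OF assms(1) Suc.prems] continuous_on_subset assms(3) by blast
  then show ?case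
  proof (rule Ck_on_SucI' [OF assms(2)])
    show "(\<lambda>t. f (x(i := t))) differentiable (at (x i))" if "i < n" "x \<in> V" for i x
      using that assms(3) by (intro Ck_on_differentiable [OF Suc.prems]) auto
    show "Ck_on n k V (partial i f)" if "i < n" for i
      by (rule Suc.IH [OF Ck_on_partial [OF Suc.prems that]])
  qed
qed

lemma continuous_on_locally:
  assumes "\<And>x. x \<in> U \<Longrightarrow>
    \<exists>V. openin (Euclidean_space n) V \<and> x \<in> V \<and> V \<subseteq> U \<and> continuous_on V f"
    and "openin (Euclidean_space n) U"
  shows "continuous_on U f"
  unfolding continuous_on_eq_continuous_within
proof
  fix x assume "x \<in> U"
  then obtain V where V: "openin (Euclidean_space n) V" "x \<in> V" "V \<subseteq> U" "continuous_on V f"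
    using assms by blast
  then obtain T where T: "open T" "V = T \<inter> euclid n"
    by (auto simp: openin_Euclidean_open)
  have "V \<inter> T - {x} = U \<inter> T - {x}"
    using T V(3) openin_subset [OF assms(2)] by blast
  then have "at x within V = at x within U"
    using T V by (intro at_within_nhd [of x T]) auto
  then show "continuous (at x within U) f"
    using V(2,4) unfolding continuous_on_eq_continuous_within by metis
qed

lemma Ck_on_locally:
  assumes "openin (Euclidean_space n) U"
    and "\<And>x. x \<in> U \<Longrightarrow>
      \<exists>V. openin (Euclidean_space n) V \<and> x \<in> V \<and> V \<subseteq> U \<and> Ck_on n k V f"
  shows "Ck_on n k U f"
  using assms(2)
proof (induction k arbitrary: f)
  case 0
  have "continuous_on U f"
  proof (rule continuous_on_locally [OF _ assms(1)])
    fix x assume "x \<in> U"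
    then obtain V where V: "openin (Euclidean_space n) V" "x \<in> V" "V \<subseteq> U" "Ck_on n 0 V f"
      using 0 by blast
    show "\<exists>V. openin (Euclidean_space n) V \<and> x \<in> V \<and> V \<subseteq> U \<and> continuous_on V f"
      using V(1-3) Ck_on_imp_continuous_on [OF V(1,4)] by blast
  qed
  then show ?case
    by (simp add: Ck_on_0 [OF assms(1)])
next
  case (Suc k)
  have c: "continuous_on U f"
  proof (rule continuous_on_locally [OF _ assms(1)])
    fix x assume "x \<in> U"
    then obtain V where V: "openin (Euclidean_space n) V" "x \<in> V" "V \<subseteq> U" "Ck_on n (Suc k) V f"
      using Suc.prems by blast
    show "\<exists>V. openin (Euclidean_space n) V \<and> x \<in> V \<and> V \<subseteq> U \<and> continuous_on V f"
      using V(1-3) Ck_on_imp_continuous_on [OF V(1,4)] by blast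
  qed
  show ?case
  proof (rule Ck_on_SucI' [OF assms(1) c])
    fix i assume i: "i < n"
    show "(\<lambda>t. f (x(i := t))) differentiable (at (x i))" if "x \<in> U" for x
    proof -
      obtain V where V: "x \<in> V" "Ck_on n (Suc k) V f"
        using Suc.prems \<open>x \<in> U\<close> by blast
      show ?thesis
        by (rule Ck_on_differentiable [OF V(2,1) i])
    qed
    show "Ck_on n k U (partial i f)"
    proof (rule Suc.IH)
      fix x assume "x \<in> U"
      then obtain V where V: "openin (Euclidean_space n) V" "x \<in> V" "V \<subseteq> U" "Ck_on n (Suc k) V f"
        using Suc.prems by blast
      show "\<exists>V. openin (Euclidean_space n) V \<and> x \<in> V \<and> V \<subseteq> U \<and> Ck_on n k V (partial i f)"
        using V(1-3) Ck_on_partial [OF V(4) i] by blast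
    qed
  qed
qed

lemma Ck_on_const [simp]:
  assumes "openin (Euclidean_space n) U"
  shows "Ck_on n k U (\<lambda>x. c)"
proof (induction k arbitrary: c)
  case 0
  then show ?case using Ck_on_0 [OF assms] by simp
next
  case (Suc k)
  show ?case
    by (rule Ck_on_SucI [OF assms, where D = "\<lambda>i x. 0"]) (simp_all add: Suc)
qed

lemma Ck_on_coordinate:
  assumes "openin (Euclidean_space n) U"
  shows "Ck_on n k U (\<lambda>x. x j)"
proof (cases k)
  case 0
  then show ?thesis
    by (simp add: Ck_on_0 [OF assms] continuous_on_product_then_coordinatewise [OF continuous_on_id])
next
  case (Suc k')
  have "Ck_on n (Suc k') U (\<lambda>x. x j)"
  proof (rule Ck_on_SucI [OF assms, where D = "\<lambda>i x. if j = i then 1 else 0"])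
    show "continuous_on U (\<lambda>x::rvec. x j)"
      by (rule continuous_on_product_then_coordinatewise [OF continuous_on_id])
  qed (auto simp: assms)
  then show ?thesis using Suc by simp
qed

lemma Ck_on_add:
  assumes "openin (Euclidean_space n) U" "Ck_on n k U f" "Ck_on n k U g"
  shows "Ck_on n k U (\<lambda>x. f x + g x)"
  using assms(2,3)
proof (induction k arbitrary: f g)
  case 0
  then show ?case by (simp add: Ck_on_0 [OF assms(1)] continuous_on_add)
next
  case (Suc k)
  show ?case
  proof (rule Ck_on_SucI [OF assms(1), where D = "\<lambda>i x. partial i f x + partial i g x"])
    show "continuous_on U (\<lambda>x. f x + g x)"
      using Suc.prems by (intro continuous_on_add Ck_on_imp_continuous_on [OF assms(1)])
    show "((\<lambda>t. f (x(i := t)) + g (x(i := t))) has_real_derivative partial i f x + partial i g x)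
        (at (x i))" if "i < n" "x \<in> U" for i x
      by (intro DERIV_add Ck_on_has_partial [OF Suc.prems(1) that(2,1)]
          Ck_on_has_partial [OF Suc.prems(2) that(2,1)])
    show "Ck_on n k U (\<lambda>x. partial i f x + partial i g x)" if "i < n" for i
      by (intro Suc.IH Ck_on_partial [OF Suc.prems(1) that] Ck_on_partial [OF Suc.prems(2) that])
  qed
qed

lemma Ck_on_mult:
  assumes "openin (Euclidean_space n) U" "Ck_on n k U f" "Ck_on n k U g"
  shows "Ck_on n k U (\<lambda>x. f x * g x)"
  using assms(2,3)
proof (induction k arbitrary: f g)
  case 0
  then show ?case by (simp add: Ck_on_0 [OF assms(1)] continuous_on_mult)
next
  case (Suc k)
  note fg = Suc.prems [THEN Ck_on_Suc_imp [OF assms(1)]]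
  show ?case
  proof (rule Ck_on_SucI [OF assms(1), where D = "\<lambda>i x. partial i f x * g x + partial i g x * f x"])
    show "continuous_on U (\<lambda>x. f x * g x)"
      using Suc.prems by (intro continuous_on_mult Ck_on_imp_continuous_on [OF assms(1)])
    show "((\<lambda>t. f (x(i := t)) * g (x(i := t))) has_real_derivative
        partial i f x * g x + partial i g x * f x) (at (x i))" if "i < n" "x \<in> U" for i x
      by (rule DERIV_cong [OF DERIV_mult [OF Ck_on_has_partial [OF Suc.prems(1) that(2,1)]
            Ck_on_has_partial [OF Suc.prems(2) that(2,1)]]]) simp
    show "Ck_on n k U (\<lambda>x. partial i f x * g x + partial i g x * f x)" if "i < n" for i
      by (intro Ck_on_add [OF assms(1)] Suc.IH fg Ck_on_partial [OF Suc.prems(1) that]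
          Ck_on_partial [OF Suc.prems(2) that])
  qed
qed

lemma Ck_on_inverse:
  assumes "openin (Euclidean_space n) U" "Ck_on n k U f" "\<And>x. x \<in> U \<Longrightarrow> f x \<noteq> 0"
  shows "Ck_on n k U (\<lambda>x. inverse (f x))"
  using assms(2)
proof (induction k)
  case 0
  then show ?case by (simp add: Ck_on_0 [OF assms(1)] continuous_on_inverse assms(3))
next
  case (Suc k)
  note IH = Suc.IH [OF Ck_on_Suc_imp [OF assms(1) Suc.prems]]
  show ?case
  proof (rule Ck_on_SucI [OF assms(1),
        where D = "\<lambda>i x. ((-1) * partial i f x) * (inverse (f x) * inverse (f x))"])
    show "continuous_on U (\<lambda>x. inverse (f x))"
      using Suc.prems assms(3) by (auto intro: continuous_on_inverse Ck_on_imp_continuous_on [OF assms(1)])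
    show "((\<lambda>t. inverse (f (x(i := t)))) has_real_derivative
        ((-1) * partial i f x) * (inverse (f x) * inverse (f x))) (at (x i))"
      if "i < n" "x \<in> U" for i x
      by (rule DERIV_cong [OF DERIV_inverse_fun [OF Ck_on_has_partial [OF Suc.prems(1) that(2,1)]]])
        (simp_all add: assms(3)[OF that(2)] mult.assoc)
    show "Ck_on n k U (\<lambda>x. ((-1) * partial i f x) * (inverse (f x) * inverse (f x)))"
      if "i < n" for i
      by (intro Ck_on_mult [OF assms(1)] IH Ck_on_const [OF assms(1)] Ck_on_partial [OF Suc.prems that])
  qed
qed

lemma Ck_on_sum:
  assumes "openin (Euclidean_space n) U" "\<And>j. j < m \<Longrightarrow> Ck_on n k U (f j)"
  shows "Ck_on n k U (\<lambda>x. \<Sum>j<(m::nat). f j x)"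
  using assms(2)
proof (induction m)
  case 0
  then show ?case by (simp add: assms(1))
next
  case (Suc m)
  then show ?case by (simp add: Ck_on_add [OF assms(1)])
qed


lemma openin_Euclidean_preimage:
  assumes "openin (Euclidean_space n) U" "continuous_on U f" "open B"
  shows "openin (Euclidean_space n) {x \<in> U. f x \<in> B}"
proof -
  obtain A where A: "open A" "A \<inter> U = f -` B \<inter> U"
    using assms(2,3) unfolding continuous_on_open_invariant by metis
  obtain T where T: "open T" "U = T \<inter> euclid n"
    using assms(1) by (auto simp: openin_Euclidean_open)
  have "{x \<in> U. f x \<in> B} = (A \<inter> T) \<inter> euclid n"
    using A(2) T(2) by auto
  then show ?thesis
    unfolding openin_Euclidean_open using A(1) T(1) by (intro exI [of _ "A \<inter> T"]) auto
qed

lemma mvt_between: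
  fixes \<phi> \<phi>' :: "real \<Rightarrow> real"
  assumes "a \<noteq> b" "\<And>t. \<bar>t - a\<bar> \<le> \<bar>b - a\<bar> \<Longrightarrow> (\<phi> has_real_derivative \<phi>' t) (at t)"
  shows "\<exists>z. \<bar>z - a\<bar> \<le> \<bar>b - a\<bar> \<and> \<phi> b - \<phi> a = \<phi>' z * (b - a)"
proof (cases "a < b")
  case True
  then obtain z where "z > a" "z < b" "\<phi> b - \<phi> a = (b - a) * \<phi>' z"
    using MVT2 [of a b \<phi> \<phi>'] assms(2) by auto
  then show ?thesis
    by (intro exI [of _ z]) auto
next
  case False
  then obtain z where "z > b" "z < a" "\<phi> a - \<phi> b = (a - b) * \<phi>' z"
    using MVT2 [of b a \<phi> \<phi>'] assms by auto
  then show ?thesis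
    by (intro exI [of _ z]) (auto simp: algebra_simps)
qed

text \<open>
  Walking from \<open>x\<close> to \<open>y\<close> parallel to the axes, the mean value theorem turns every leg into a
  coordinate increment times the value of a partial derivative at a nearby point. This replaces
  total differentiability in all that follows.
\<close>

lemma increment_formula:
  assumes U: "openin (Euclidean_space n) U" and C: "Ck_on n (Suc 0) U f" and x: "x \<in> U"
  obtains A V where "openin (Euclidean_space n) V" "x \<in> V"
    "\<And>y. y \<in> V \<Longrightarrow> f y - f x = (\<Sum>j<n. A j y * (y j - x j))"
    "\<And>j. j < n \<Longrightarrow> (A j \<longlongrightarrow> partial j f x) (at x within V)"
    "\<And>j. A j x = partial j f x"
proof -
  obtain e where e: "e > 0" "\<And>y. y \<in> euclid n \<Longrightarrow> (\<forall>i<n. \<bar>y i - x i\<bar> < e) \<Longrightarrow> y \<in> U"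
    using U x unfolding openin_Euclidean_box by blast
  define V where "V = {y. \<forall>i<n. \<bar>y i - x i\<bar> < e} \<inter> euclid n"
  have xe: "x \<in> euclid n"
    using openin_subset_euclid U x by blast
  have V: "openin (Euclidean_space n) V" "x \<in> V" "V \<subseteq> U"
    using open_Collect_coordinates [of n x e] e xe by (auto simp: V_def openin_Euclidean_open)
  \<comment> \<open>\<open>h k y\<close> is the corner of the walk reached after \<open>k\<close> coordinates have been changed.\<close>
  define h where "h k y = (\<lambda>i. if i < k then y i else x i)" for k y
  define A where "A k y = (if y k = x k then partial k f x
      else (f (h (Suc k) y) - f (h k y)) / (y k - x k))" for k y
  have h_Suc: "h (Suc k) y = (h k y)(k := y k)" and h_same: "(h k y)(k := x k) = h k y" for k y
    by (auto simp: h_def less_Suc_eq)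
  have A_mult: "A k y * (y k - x k) = f (h (Suc k) y) - f (h k y)" for k y
  proof (cases "y k = x k")
    case True
    then have "h (Suc k) y = h k y"
      using h_Suc h_same by metis
    then show ?thesis using True by simp
  qed (simp add: A_def)
  have inc: "f y - f x = (\<Sum>j<n. A j y * (y j - x j))" if "y \<in> V" for y
  proof -
    have "h n y = y"
      using that xe by (auto simp: h_def V_def in_euclid)
    moreover have "h 0 y = x"
      by (auto simp: h_def)
    ultimately show ?thesis
      using sum_lessThan_telescope [of "\<lambda>k. f (h k y)" n] by (simp add: A_mult)
  qed
  \<comment> \<open>By the mean value theorem, the difference quotient is a partial derivative at a nearby point.\<close>
  have near: "\<exists>w\<in>euclid n. (\<forall>i. \<bar>w i - x i\<bar> \<le> \<bar>y i - x i\<bar>) \<and> A k y = partial k f w"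
    if y: "y \<in> V" and k: "k < n" for y k
  proof (cases "y k = x k")
    case True
    then show ?thesis
      using xe by (intro bexI [of _ x]) (auto simp: A_def)
  next
    case False
    define w where "w t = (h k y)(k := t)" for t
    have we: "w t \<in> euclid n" for t
      unfolding w_def using y xe k by (intro fun_upd_in_euclid) (auto simp: h_def V_def in_euclid)
    have wb: "\<bar>w t i - x i\<bar> \<le> \<bar>y i - x i\<bar>" if "\<bar>t - x k\<bar> \<le> \<bar>y k - x k\<bar>" for t i
      using that by (auto simp: w_def h_def)
    have "((\<lambda>t. f (w t)) has_real_derivative partial k f (w t)) (at t)"
      if "\<bar>t - x k\<bar> \<le> \<bar>y k - x k\<bar>" for t
    proof -
      have "w t \<in> U"
      proof (rule e(2) [OF we], intro allI impI)
        show "\<bar>w t i - x i\<bar> < e" if "i < n" for i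
          using wb [OF \<open>\<bar>t - x k\<bar> \<le> \<bar>y k - x k\<bar>\<close>, of i] y that unfolding V_def by auto
      qed
      moreover have "(\<lambda>s. f ((w t)(k := s))) = (\<lambda>s. f (w s))" "w t k = t"
        by (simp_all add: w_def)
      ultimately show ?thesis
        using Ck_on_has_partial [OF C _ k, of "w t"] by metis
    qed
    then obtain z where z: "\<bar>z - x k\<bar> \<le> \<bar>y k - x k\<bar>"
        "f (w (y k)) - f (w (x k)) = partial k f (w z) * (y k - x k)"
      using mvt_between [of "x k" "y k" "\<lambda>t. f (w t)" "\<lambda>t. partial k f (w t)"] False by auto
    then have "A k y = partial k f (w z)"
      using False by (simp add: A_def w_def h_Suc h_same)
    then show ?thesis
      using we [of z] wb [OF z(1)] by blast
  qed
  have lim: "(A k \<longlongrightarrow> partial k f x) (at x within V)" if k: "k < n" for k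
  proof (rule tendstoI)
    fix \<epsilon> :: real assume "\<epsilon> > 0"
    have cont: "continuous_on U (partial k f)"
      using Ck_on_partial [OF C k] Ck_on_0 [OF U] by simp
    have "openin (Euclidean_space n) {w \<in> U. partial k f w \<in> ball (partial k f x) \<epsilon>}" (is "openin _ ?N")
      by (rule openin_Euclidean_preimage [OF U cont]) simp
    moreover have "x \<in> ?N"
      using x \<open>\<epsilon> > 0\<close> by simp
    ultimately obtain d where d: "d > 0"
        "\<And>y. y \<in> euclid n \<Longrightarrow> (\<forall>i<n. \<bar>y i - x i\<bar> < d) \<Longrightarrow> y \<in> ?N"
      unfolding openin_Euclidean_box by meson
    have "dist (A k y) (partial k f x) < \<epsilon>" if y: "y \<in> V" "\<forall>i<n. \<bar>y i - x i\<bar> < d" for y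
    proof -
      obtain w where w: "w \<in> euclid n" "\<And>i. \<bar>w i - x i\<bar> \<le> \<bar>y i - x i\<bar>" "A k y = partial k f w"
        using near [OF y(1) k] by blast
      have "w \<in> ?N"
        using w(2) y(2) by (intro d(2) w(1)) (meson le_less_trans)
      then show ?thesis
        using w(3) by (simp add: dist_commute)
    qed
    then show "\<forall>\<^sub>F y in at x within V. dist (A k y) (partial k f x) < \<epsilon>"
      using open_Collect_coordinates [of n x d] d(1) unfolding eventually_at_topological
      by (intro exI [of _ "{y. \<forall>i<n. \<bar>y i - x i\<bar> < d}"]) auto
  qed
  show thesis
    by (rule that [OF V(1,2) inc lim]) (simp_all add: A_def)
qed

text \<open>
  The curve \<open>g\<close> only has to converge. Besides the chain rule this covers the curves traced by an inverse
  map, whose differentiability is what has to be shown there.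
\<close>

lemma increment_along:
  fixes g :: "'a \<Rightarrow> rvec"
  assumes U: "openin (Euclidean_space n) U" and C: "Ck_on n (Suc 0) U f" and x: "x \<in> U"
    and g: "(g \<longlongrightarrow> x) F" "\<forall>\<^sub>F t in F. g t \<in> euclid n"
  obtains B where "\<And>j. j < n \<Longrightarrow> (B j \<longlongrightarrow> partial j f x) F"
    "\<forall>\<^sub>F t in F. f (g t) - f x = (\<Sum>j<n. B j t * (g t j - x j))"
proof -
  obtain A V where V: "openin (Euclidean_space n) V" "x \<in> V"
    and inc: "\<And>y. y \<in> V \<Longrightarrow> f y - f x = (\<Sum>j<n. A j y * (y j - x j))"
    and lim: "\<And>j. j < n \<Longrightarrow> (A j \<longlongrightarrow> partial j f x) (at x within V)"
    and eq: "\<And>j. A j x = partial j f x"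
    by (rule increment_formula [OF U C x], rule that)
  have gV: "\<forall>\<^sub>F t in F. g t \<in> V"
    by (rule openin_Euclidean_tendsto [OF V g])
  show thesis
  proof (rule that [of "\<lambda>j t. A j (g t)"])
    show "((\<lambda>t. A j (g t)) \<longlongrightarrow> partial j f x) F" if "j < n" for j
    proof -
      have "continuous (at x within V) (A j)"
        using lim [OF that] eq by (simp add: continuous_within)
      then have "((\<lambda>t. A j (g t)) \<longlongrightarrow> A j x) F"
        using gV g(1) by (rule continuous_within_tendsto_compose)
      then show ?thesis by (simp add: eq)
    qed
    show "\<forall>\<^sub>F t in F. f (g t) - f x = (\<Sum>j<n. A j (g t) * (g t j - x j))"
      using gV by eventually_elim (rule inc)
  qed
qed

lemma has_derivative_along_curve:
  fixes \<gamma> :: "real \<Rightarrow> rvec"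
  assumes U: "openin (Euclidean_space n) U" and C: "Ck_on n (Suc 0) U f" and x: "\<gamma> t0 \<in> U"
    and d: "\<And>j. j < n \<Longrightarrow> ((\<lambda>t. \<gamma> t j) has_real_derivative d j) (at t0)"
    and e: "\<forall>\<^sub>F t in nhds t0. \<gamma> t \<in> euclid n"
  shows "((\<lambda>t. f (\<gamma> t)) has_real_derivative (\<Sum>j<n. partial j f (\<gamma> t0) * d j)) (at t0)"
proof -
  have e': "\<forall>\<^sub>F t in at t0. \<gamma> t \<in> euclid n"
    using e by (auto simp: eventually_at_filter elim: eventually_mono)
  have lim: "(\<gamma> \<longlongrightarrow> \<gamma> t0) (at t0)"
  proof (rule tendsto_coordinates)
    fix i
    show "((\<lambda>t. \<gamma> t i) \<longlongrightarrow> \<gamma> t0 i) (at t0)"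
    proof (cases "i < n")
      case True
      then show ?thesis
        using DERIV_isCont [OF d] by (simp add: isCont_def)
    next
      case False
      have "\<forall>\<^sub>F t in at t0. \<gamma> t i = \<gamma> t0 i"
        using e' by eventually_elim (use False openin_subset_euclid [OF U x] in \<open>auto simp: in_euclid\<close>)
      then show ?thesis
        by (rule tendsto_eventually)
    qed
  qed
  obtain B where B: "\<And>j. j < n \<Longrightarrow> (B j \<longlongrightarrow> partial j f (\<gamma> t0)) (at t0)"
    and inc: "\<forall>\<^sub>F t in at t0. f (\<gamma> t) - f (\<gamma> t0) = (\<Sum>j<n. B j t * (\<gamma> t j - \<gamma> t0 j))"
    by (rule increment_along [OF U C x lim e'], rule that)
  have "((\<lambda>t. \<Sum>j<n. B j t * ((\<gamma> t j - \<gamma> t0 j) / (t - t0))) \<longlongrightarrow>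
      (\<Sum>j<n. partial j f (\<gamma> t0) * d j)) (at t0)"
    using B d by (intro tendsto_sum tendsto_mult) (auto simp: has_field_derivative_iff)
  moreover have "\<forall>\<^sub>F t in at t0. (\<Sum>j<n. B j t * ((\<gamma> t j - \<gamma> t0 j) / (t - t0))) =
      (f (\<gamma> t) - f (\<gamma> t0)) / (t - t0)"
    using inc by eventually_elim (simp add: sum_divide_distrib)
  ultimately show ?thesis
    unfolding has_field_derivative_iff by (rule Lim_transform_eventually)
qed

lemma Ck_on_continuous_on_components:
  assumes "openin (Euclidean_space m) V" "\<And>j. j < n \<Longrightarrow> Ck_on m k V (\<lambda>x. g x j)" "g ` V \<subseteq> euclid n"
  shows "continuous_on V g"
proof (rule continuous_on_coordinatewise_then_product)
  fix j
  show "continuous_on V (\<lambda>x. g x j)"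
  proof (cases "j < n")
    case True
    then show ?thesis
      using Ck_on_imp_continuous_on [OF assms(1)] assms(2) by blast
  next
    case False
    then have "\<And>x. x \<in> V \<Longrightarrow> g x j = 0"
      using assms(3) by (auto simp: in_euclid image_subset_iff)
    then show ?thesis
      by (simp cong: continuous_on_cong)
  qed
qed

text \<open>
  Only the one derivative of \<open>g\<close> along the \<open>i\<close>-th axis enters, so this is the chain rule along the curve
  \<open>t \<mapsto> g (x(i := t))\<close>.
\<close>

lemma has_partial_compose:
  assumes U: "openin (Euclidean_space n) U" and V: "openin (Euclidean_space m) V"
    and f: "Ck_on n (Suc 0) U f"
    and g: "\<And>j. j < n \<Longrightarrow>
      ((\<lambda>t. g (x(i := t)) j) has_real_derivative partial i (\<lambda>y. g y j) x) (at (x i))"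
    and gV: "g ` V \<subseteq> U" and x: "x \<in> V" and i: "i < m"
  shows "((\<lambda>t. f (g (x(i := t)))) has_real_derivative
        (\<Sum>j<n. partial j f (g x) * partial i (\<lambda>y. g y j) x)) (at (x i))"
proof -
  have "((\<lambda>t. f (g (x(i := t)))) has_real_derivative
    (\<Sum>j<n. partial j f (g (x(i := x i))) * partial i (\<lambda>y. g y j) x)) (at (x i))"
  proof (rule has_derivative_along_curve [OF U f])
    show "g (x(i := x i)) \<in> U"
      using gV x by auto
    show "((\<lambda>t. g (x(i := t)) j) has_real_derivative partial i (\<lambda>y. g y j) x) (at (x i))"
      if "j < n" for j
      by (rule g [OF that])
    show "\<forall>\<^sub>F t in nhds (x i). g (x(i := t)) \<in> euclid n"
      using eventually_fun_upd_in [OF V x i]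
      by eventually_elim (use gV openin_subset [OF U] in auto)
  qed
  then show ?thesis by simp
qed

lemma Ck_on_1:
  assumes U: "openin (Euclidean_space n) U" and "Ck_on n (Suc k) U f"
  shows "Ck_on n (Suc 0) U f"
  using assms(2)
proof (induction k)
  case (Suc k)
  show ?case by (rule Suc.IH [OF Ck_on_Suc_imp [OF U Suc.prems]])
qed

text \<open>
  By the chain rule, the partial derivatives of a composition are sums of products of \<open>C\<^sup>k\<close> functions, one
  factor being again a composition; hence induction on \<open>k\<close> with \<open>f\<close> arbitrary.
\<close>

lemma Ck_on_compose:
  assumes U: "openin (Euclidean_space n) U" and V: "openin (Euclidean_space m) V"
    and f: "Ck_on n k U f" and g: "\<And>j. j < n \<Longrightarrow> Ck_on m k V (\<lambda>x. g x j)" and gV: "g ` V \<subseteq> U"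
  shows "Ck_on m k V (\<lambda>x. f (g x))"
  using f g
proof (induction k arbitrary: f)
  case 0
  have "continuous_on V g"
    by (rule Ck_on_continuous_on_components [where n = n and k = 0, OF V 0(2)])
      (use openin_subset [OF U] gV in auto)
  moreover have "continuous_on U f"
    using 0(1) by (simp add: Ck_on_0 [OF U])
  ultimately show ?case
    unfolding Ck_on_0 [OF V] using gV by (intro continuous_on_compose2 [of U f V g])
next
  case (Suc k)
  have ge: "g ` V \<subseteq> euclid n"
    using openin_subset [OF U] gV by blast
  have "continuous_on V g"
    by (rule Ck_on_continuous_on_components [where n = n and k = "Suc k", OF V Suc.prems(2) ge])
  then have cont: "continuous_on V (\<lambda>x. f (g x))"
    using Ck_on_imp_continuous_on [OF U Suc.prems(1)] gV
    by (intro continuous_on_compose2 [of U f V g])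
  show ?case
  proof (rule Ck_on_SucI [OF V cont,
        where D = "\<lambda>i x. \<Sum>j<n. partial j f (g x) * partial i (\<lambda>y. g y j) x"])
    show "((\<lambda>t. f (g (x(i := t)))) has_real_derivative
        (\<Sum>j<n. partial j f (g x) * partial i (\<lambda>y. g y j) x)) (at (x i))"
      if i: "i < m" and xV: "x \<in> V" for i x
    proof (rule has_partial_compose [OF U V Ck_on_1 [OF U Suc.prems(1)] _ gV xV i])
      show "((\<lambda>t. g (x(i := t)) j) has_real_derivative partial i (\<lambda>y. g y j) x) (at (x i))"
        if "j < n" for j
        by (rule Ck_on_has_partial [OF Suc.prems(2) [OF that] xV i])
    qed
    show "Ck_on m k V (\<lambda>x. \<Sum>j<n. partial j f (g x) * partial i (\<lambda>y. g y j) x)" if i: "i < m" for i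
    proof (intro Ck_on_sum [OF V] Ck_on_mult [OF V])
      fix j assume j: "j < n"
      show "Ck_on m k V (\<lambda>x. partial j f (g x))"
        by (rule Suc.IH [OF Ck_on_partial [OF Suc.prems(1) j]])
          (rule Ck_on_Suc_imp [OF V Suc.prems(2)])
      show "Ck_on m k V (partial i (\<lambda>y. g y j))"
        by (rule Ck_on_partial [OF Suc.prems(2) [OF j] i])
    qed
  qed
qed

section \<open>Smooth functions and total derivatives\<close>

text \<open>
  Openness of the domain is part of the notion, because partial derivatives are local only there.
\<close>

definition smooth_fn :: "nat \<Rightarrow> rvec set \<Rightarrow> (rvec \<Rightarrow> real) \<Rightarrow> bool" where
  "smooth_fn n U f \<longleftrightarrow> openin (Euclidean_space n) U \<and> (\<forall>k. Ck_on n k U f)"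

lemma smooth_fnI: "openin (Euclidean_space n) U \<Longrightarrow> (\<And>k. Ck_on n k U f) \<Longrightarrow> smooth_fn n U f"
  and smooth_fn_openin: "smooth_fn n U f \<Longrightarrow> openin (Euclidean_space n) U"
  and smooth_fn_Ck: "smooth_fn n U f \<Longrightarrow> Ck_on n k U f"
  by (simp_all add: smooth_fn_def)

lemma smooth_fn_continuous_on: "smooth_fn n U f \<Longrightarrow> continuous_on U f"
  using Ck_on_0 [of n U f] by (simp add: smooth_fn_def)

lemma smooth_fn_cong:
  "smooth_fn n U f \<Longrightarrow> (\<And>x. x \<in> U \<Longrightarrow> f x = g x) \<Longrightarrow> smooth_fn n U g"
  by (rule smooth_fnI [OF smooth_fn_openin Ck_on_cong [OF smooth_fn_openin _ smooth_fn_Ck]])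

lemma smooth_fn_subset:
  "smooth_fn n U f \<Longrightarrow> openin (Euclidean_space n) V \<Longrightarrow> V \<subseteq> U \<Longrightarrow> smooth_fn n V f"
  by (rule smooth_fnI [OF _ Ck_on_subset [OF smooth_fn_openin _ _ smooth_fn_Ck]])

lemma smooth_fn_locally:
  assumes "\<And>x. x \<in> U \<Longrightarrow> \<exists>V. x \<in> V \<and> V \<subseteq> U \<and> smooth_fn n V f"
  shows "smooth_fn n U f"
proof (rule smooth_fnI)
  show U: "openin (Euclidean_space n) U"
    using assms openin_subopen [of "Euclidean_space n" U] smooth_fn_openin by meson
  show "Ck_on n k U f" for k
  proof (rule Ck_on_locally [OF U])
    fix x assume "x \<in> U"
    then obtain V where V: "x \<in> V" "V \<subseteq> U" "smooth_fn n V f"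
      using assms by meson
    then show "\<exists>V. openin (Euclidean_space n) V \<and> x \<in> V \<and> V \<subseteq> U \<and> Ck_on n k V f"
      by (intro exI [of _ V]) (simp add: smooth_fn_def)
  qed
qed

lemma smooth_fn_const: "openin (Euclidean_space n) U \<Longrightarrow> smooth_fn n U (\<lambda>x. c)"
  and smooth_fn_coordinate: "openin (Euclidean_space n) U \<Longrightarrow> smooth_fn n U (\<lambda>x. x j)"
  by (simp_all add: smooth_fn_def Ck_on_coordinate)

lemma smooth_fn_add: "smooth_fn n U f \<Longrightarrow> smooth_fn n U g \<Longrightarrow> smooth_fn n U (\<lambda>x. f x + g x)"
  and smooth_fn_mult: "smooth_fn n U f \<Longrightarrow> smooth_fn n U g \<Longrightarrow> smooth_fn n U (\<lambda>x. f x * g x)"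
  by (simp_all add: smooth_fn_def Ck_on_add Ck_on_mult)

lemma smooth_fn_diff:
  assumes "smooth_fn n U f" "smooth_fn n U g"
  shows "smooth_fn n U (\<lambda>x. f x - g x)"
proof -
  have "smooth_fn n U (\<lambda>x. f x + (-1) * g x)"
    by (intro smooth_fn_add smooth_fn_mult smooth_fn_const assms smooth_fn_openin [OF assms(1)])
  then show ?thesis by simp
qed

lemma smooth_fn_sum:
  "openin (Euclidean_space n) U \<Longrightarrow> (\<And>j. j < m \<Longrightarrow> smooth_fn n U (f j)) \<Longrightarrow>
    smooth_fn n U (\<lambda>x. \<Sum>j<(m::nat). f j x)"
  by (simp add: smooth_fn_def Ck_on_sum)

lemma smooth_fn_partial: "smooth_fn n U f \<Longrightarrow> i < n \<Longrightarrow> smooth_fn n U (partial i f)"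
  unfolding smooth_fn_def by (auto intro: Ck_on_partial)

lemma smooth_fn_compose:
  assumes "smooth_fn n U f" "openin (Euclidean_space m) V"
    "\<And>j. j < n \<Longrightarrow> smooth_fn m V (\<lambda>x. g x j)" "g ` V \<subseteq> U"
  shows "smooth_fn m V (\<lambda>x. f (g x))"
proof (rule smooth_fnI [OF assms(2)])
  fix k
  show "Ck_on m k V (\<lambda>x. f (g x))"
    by (rule Ck_on_compose [OF smooth_fn_openin [OF assms(1)] assms(2) smooth_fn_Ck [OF assms(1)]
          smooth_fn_Ck [OF assms(3)] assms(4)])
qed

lemma smooth_between_iff:
  "smooth_between m n U f \<longleftrightarrow>
     openin (Euclidean_space m) U \<and> f ` U \<subseteq> euclid n \<and> (\<forall>j<n. smooth_fn m U (\<lambda>x. f x j))"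
  unfolding smooth_between_def smooth_fn_def by auto

lemma smooth_betweenI:
  "openin (Euclidean_space m) U \<Longrightarrow> (\<And>x. x \<in> U \<Longrightarrow> f x \<in> euclid n) \<Longrightarrow>
    (\<And>j. j < n \<Longrightarrow> smooth_fn m U (\<lambda>x. f x j)) \<Longrightarrow> smooth_between m n U f"
  by (auto simp: smooth_between_iff)

lemma smooth_between_openin: "smooth_between m n U f \<Longrightarrow> openin (Euclidean_space m) U"
  by (simp add: smooth_between_iff)

lemma smooth_between_in_euclid: "smooth_between m n U f \<Longrightarrow> x \<in> U \<Longrightarrow> f x \<in> euclid n"
  by (auto simp: smooth_between_iff)

text \<open>
  Components beyond the target dimension are constantly zero and therefore smooth as well, which avoids
  side conditions on \<open>j\<close>.
\<close>

lemma smooth_between_component: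
  assumes "smooth_between m n U f"
  shows "smooth_fn m U (\<lambda>x. f x j)"
proof (cases "j < n")
  case True
  then show ?thesis using assms by (simp add: smooth_between_iff)
next
  case False
  show ?thesis
    by (rule smooth_fn_cong [OF smooth_fn_const [OF smooth_between_openin [OF assms], of 0]])
      (use False smooth_between_in_euclid [OF assms] in \<open>auto simp: in_euclid\<close>)
qed

lemma smooth_between_continuous_on:
  "smooth_between m n U f \<Longrightarrow> continuous_on U f"
  by (intro continuous_on_coordinatewise_then_product smooth_fn_continuous_on smooth_between_component)

lemma smooth_between_subset:
  assumes "smooth_between m n U f" "openin (Euclidean_space m) V" "V \<subseteq> U"
  shows "smooth_between m n V f"
proof (rule smooth_betweenI [OF assms(2)])
  show "f x \<in> euclid n" if "x \<in> V" for x
    using assms that smooth_between_in_euclid by blast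
  show "smooth_fn m V (\<lambda>x. f x j)" if "j < n" for j
    by (rule smooth_fn_subset [OF smooth_between_component [OF assms(1)] assms(2,3)])
qed

lemma smooth_between_cong:
  assumes "smooth_between m n U f" "\<And>x. x \<in> U \<Longrightarrow> f x = g x"
  shows "smooth_between m n U g"
proof (rule smooth_betweenI [OF smooth_between_openin [OF assms(1)]])
  show "g x \<in> euclid n" if "x \<in> U" for x
    using smooth_between_in_euclid [OF assms(1) that] assms(2)[OF that] by simp
  show "smooth_fn m U (\<lambda>x. g x j)" if "j < n" for j
    by (rule smooth_fn_cong [OF smooth_between_component [OF assms(1)]]) (simp add: assms(2))
qed

lemma smooth_between_locally:
  assumes "\<And>x. x \<in> U \<Longrightarrow> \<exists>V. x \<in> V \<and> V \<subseteq> U \<and> smooth_between m n V f"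
  shows "smooth_between m n U f"
proof (rule smooth_betweenI)
  show "openin (Euclidean_space m) U"
    using assms openin_subopen [of "Euclidean_space m" U] smooth_between_openin by meson
  show "f x \<in> euclid n" if "x \<in> U" for x
    using assms [OF that] smooth_between_in_euclid by meson
  show "smooth_fn m U (\<lambda>x. f x j)" if "j < n" for j
  proof (rule smooth_fn_locally)
    fix x assume "x \<in> U"
    then obtain V where V: "x \<in> V" "V \<subseteq> U" "smooth_between m n V f"
      using assms by meson
    show "\<exists>V. x \<in> V \<and> V \<subseteq> U \<and> smooth_fn m V (\<lambda>x. f x j)"
      using V(1,2) smooth_between_component [OF V(3), of j] by (intro exI [of _ V]) simp
  qed
qed

lemma smooth_between_compose:
  assumes "smooth_between m n U f" "smooth_between n p V g" "f ` U \<subseteq> V"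
  shows "smooth_between m p U (g \<circ> f)"
proof (rule smooth_betweenI [OF smooth_between_openin [OF assms(1)]])
  show "(g \<circ> f) x \<in> euclid p" if "x \<in> U" for x
    using smooth_between_in_euclid [OF assms(2)] assms(3) that by auto
  show "smooth_fn m U (\<lambda>x. (g \<circ> f) x j)" if "j < p" for j
    using smooth_fn_compose [OF smooth_between_component [OF assms(2), of j]
      smooth_between_openin [OF assms(1)] smooth_between_component [OF assms(1)] assms(3)]
    by simp
qed

lemma openin_smooth_preimage:
  assumes "smooth_between m n U f" "openin (Euclidean_space n) V"
  shows "openin (Euclidean_space m) {x \<in> U. f x \<in> V}"
proof -
  obtain T where T: "open T" "V = T \<inter> euclid n"
    using assms(2) by (auto simp: openin_Euclidean_open)
  have "{x \<in> U. f x \<in> V} = {x \<in> U. f x \<in> T}"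
    using T(2) smooth_between_in_euclid [OF assms(1)] by auto
  then show ?thesis
    using openin_Euclidean_preimage [OF smooth_between_openin [OF assms(1)]
        smooth_between_continuous_on [OF assms(1)] T(1)] by simp
qed

lemma smooth_between_compose_preimage:
  assumes "smooth_between m n U f" "smooth_between n p V g"
  shows "smooth_between m p {x \<in> U. f x \<in> V} (g \<circ> f)"
  by (rule smooth_between_compose [OF smooth_between_subset [OF assms(1) 
        openin_smooth_preimage [OF assms(1) smooth_between_openin [OF assms(2)]]] assms(2)]) auto

lemma smooth_between_id: "openin (Euclidean_space n) U \<Longrightarrow> smooth_between n n U (\<lambda>x. x)"
  by (intro smooth_betweenI smooth_fn_coordinate) (auto intro: openin_subset_euclid)

lemma smooth_between_const:
  "openin (Euclidean_space m) U \<Longrightarrow> c \<in> euclid n \<Longrightarrow> smooth_between m n U (\<lambda>x. c)"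
  by (intro smooth_betweenI smooth_fn_const)

lemma total_deriv_cong:
  assumes "openin (Euclidean_space m) U" "x \<in> U" "\<And>y. y \<in> U \<Longrightarrow> f y j = g y j'"
  shows "total_deriv m f x v j = total_deriv m g x v j'"
  unfolding total_deriv_def
  by (intro sum.cong refl arg_cong2 [where f = "(*)"] partial_cong [OF assms(1,2)] assms(3)) auto

lemma total_deriv_in_euclid:
  assumes "openin (Euclidean_space m) U" "x \<in> U" "f ` U \<subseteq> euclid n"
  shows "total_deriv m f x v \<in> euclid n"
  unfolding in_euclid
proof (intro allI impI)
  fix j assume "n \<le> j"
  have "total_deriv m f x v j = total_deriv m (\<lambda>y i. 0) x v j"
    by (rule total_deriv_cong [OF assms(1,2)]) (use assms(3) \<open>n \<le> j\<close> in \<open>auto simp: in_euclid\<close>)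
  then show "total_deriv m f x v j = 0"
    by (simp add: total_deriv_def partial_def)
qed

text \<open>
  One component of the chain rule. The function \<open>h\<close> agrees with \<open>g \<circ> f\<close> on the part of \<open>U\<close> that \<open>f\<close> maps
  into \<open>V\<close>; this is an open neighbourhood of \<open>x\<close>, and derivatives are local.
\<close>

lemma total_deriv_component:
  assumes f: "smooth_between m n U f" and g: "smooth_fn n V g" and x: "x \<in> U" "f x \<in> V"
    and h: "\<And>y. y \<in> U \<Longrightarrow> f y \<in> V \<Longrightarrow> h y j = g (f y)"
  shows "total_deriv m h x v j = (\<Sum>l<n. partial l g (f x) * total_deriv m f x v l)"
proof -
  let ?W = "{x \<in> U. f x \<in> V}"
  have W: "openin (Euclidean_space m) ?W"
    by (rule openin_smooth_preimage [OF f smooth_fn_openin [OF g]])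
  have "partial i (\<lambda>y. h y j) x = (\<Sum>l<n. partial l g (f x) * partial i (\<lambda>y. f y l) x)"
    if i: "i < m" for i
  proof -
    have "partial i (\<lambda>y. h y j) x = partial i (\<lambda>y. g (f y)) x"
      by (rule partial_cong [OF W _ i]) (use x h in auto)
    also have "\<dots> = (\<Sum>l<n. partial l g (f x) * partial i (\<lambda>y. f y l) x)"
    proof (rule partial_eqI, rule has_partial_compose [OF smooth_fn_openin [OF g] W
          smooth_fn_Ck [OF g] _ _ _ i])
      show "((\<lambda>t. f (x(i := t)) l) has_real_derivative partial i (\<lambda>y. f y l) x) (at (x i))" for l
        by (rule Ck_on_has_partial [OF smooth_fn_Ck [OF smooth_between_component [OF f]] x(1) i])
    qed (use x in auto)
    finally show ?thesis .
  qed
  then have "total_deriv m h x v j =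
      (\<Sum>i<m. \<Sum>l<n. partial l g (f x) * partial i (\<lambda>y. f y l) x * v i)"
    by (simp add: total_deriv_def sum_distrib_right)
  also have "\<dots> = (\<Sum>l<n. \<Sum>i<m. partial l g (f x) * partial i (\<lambda>y. f y l) x * v i)"
    by (rule sum.swap)
  also have "\<dots> = (\<Sum>l<n. partial l g (f x) * total_deriv m f x v l)"
    by (simp add: total_deriv_def sum_distrib_left mult.assoc)
  finally show ?thesis .
qed

lemma total_deriv_compose:
  assumes f: "smooth_between m n U f" and g: "smooth_between n p V g" and x: "x \<in> U" "f x \<in> V"
  shows "total_deriv m (g \<circ> f) x v = total_deriv n g (f x) (total_deriv m f x v)"
proof
  fix j
  show "total_deriv m (g \<circ> f) x v j = total_deriv n g (f x) (total_deriv m f x v) j"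
    unfolding total_deriv_component [OF f smooth_between_component [OF g, of j] x,
        where h = "g \<circ> f" and j = j, OF comp_apply [THEN fun_cong]]
    by (simp add: total_deriv_def)
qed

lemma total_deriv_id: "v \<in> euclid n \<Longrightarrow> total_deriv n (\<lambda>x. x) x v = v"
proof
  fix j assume v: "v \<in> euclid n"
  have "partial i (\<lambda>y. y j) x = (if i = j then 1 else 0)" for i
    by (rule partial_eqI) auto
  then have "total_deriv n (\<lambda>x. x) x v j = (\<Sum>i<n. if i = j then v i else 0)"
    unfolding total_deriv_def by (intro sum.cong) auto
  then show "total_deriv n (\<lambda>x. x) x v j = v j"
    using v by (auto simp: in_euclid)
qed

lemma total_deriv_linear:
  "total_deriv n f x (\<lambda>i. v i + w i) = (\<lambda>j. total_deriv n f x v j + total_deriv n f x w j)"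
  "total_deriv n f x (\<lambda>i. r * v i) = (\<lambda>j. r * total_deriv n f x v j)"
  "total_deriv n f x (\<lambda>i. 0) = (\<lambda>j. 0)"
  by (auto simp: total_deriv_def algebra_simps sum.distrib sum_distrib_left)

section \<open>Local diffeomorphisms and straightening\<close>

definition diffeo_onto_image :: "nat \<Rightarrow> rvec set \<Rightarrow> (rvec \<Rightarrow> rvec) \<Rightarrow> bool" where
  "diffeo_onto_image n U \<phi> \<longleftrightarrow>
     smooth_between n n U \<phi> \<and> inj_on \<phi> U \<and> smooth_between n n (\<phi> ` U) (inv_into U \<phi>)"

lemma diffeo_onto_imageI:
  assumes "smooth_between n n U \<phi>" "smooth_between n n V \<psi>" "\<phi> ` U = V"
    "\<And>x. x \<in> U \<Longrightarrow> \<psi> (\<phi> x) = x"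
  shows "diffeo_onto_image n U \<phi>"
proof -
  have inj: "inj_on \<phi> U"
    by (rule inj_on_inverseI [where g = \<psi>]) (rule assms(4))
  moreover have "smooth_between n n (\<phi> ` U) (inv_into U \<phi>)"
  proof (rule smooth_between_cong [of n n _ \<psi>])
    show "smooth_between n n (\<phi> ` U) \<psi>"
      using assms(2,3) by simp
    show "\<psi> y = inv_into U \<phi> y" if "y \<in> \<phi> ` U" for y
      using that assms(4) inv_into_f_f [OF inj] by auto
  qed
  ultimately show ?thesis
    using assms(1) by (simp add: diffeo_onto_image_def)
qed

lemma diffeo_onto_image_id: "openin (Euclidean_space n) U \<Longrightarrow> diffeo_onto_image n U (\<lambda>x. x)"
  by (rule diffeo_onto_imageI [OF smooth_between_id smooth_between_id]) auto

lemma diffeo_onto_image_compose: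
  assumes "diffeo_onto_image n U \<phi>" "diffeo_onto_image n W \<psi>" "W \<subseteq> \<phi> ` U"
  shows "diffeo_onto_image n {x \<in> U. \<phi> x \<in> W} (\<psi> \<circ> \<phi>)"
proof (rule diffeo_onto_imageI)
  have \<phi>: "smooth_between n n U \<phi>" "inj_on \<phi> U" "smooth_between n n (\<phi> ` U) (inv_into U \<phi>)"
    and \<psi>: "smooth_between n n W \<psi>" "inj_on \<psi> W" "smooth_between n n (\<psi> ` W) (inv_into W \<psi>)"
    using assms by (auto simp: diffeo_onto_image_def)
  show "smooth_between n n {x \<in> U. \<phi> x \<in> W} (\<psi> \<circ> \<phi>)"
    by (rule smooth_between_compose_preimage [OF \<phi>(1) \<psi>(1)])
  show "smooth_between n n (\<psi> ` W) (inv_into U \<phi> \<circ> inv_into W \<psi>)"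
    by (rule smooth_between_compose [OF \<psi>(3) \<phi>(3)])
      (use \<psi>(2) assms(3) in \<open>auto simp: inv_into_f_f\<close>)
  show "(\<psi> \<circ> \<phi>) ` {x \<in> U. \<phi> x \<in> W} = \<psi> ` W"
    using assms(3) by auto
  show "(inv_into U \<phi> \<circ> inv_into W \<psi>) ((\<psi> \<circ> \<phi>) x) = x" if "x \<in> {x \<in> U. \<phi> x \<in> W}" for x
    using that \<phi>(2) \<psi>(2) by simp
qed

lemma openin_EuclideanE:
  assumes "openin (Euclidean_space n) U" "x \<in> U"
  obtains e where "e > 0" "\<And>y. y \<in> euclid n \<Longrightarrow> (\<forall>i<n. \<bar>y i - x i\<bar> < e) \<Longrightarrow> y \<in> U"
  using assms unfolding openin_Euclidean_box by meson

text \<open>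
  The inverse function theorem for maps that change a single coordinate. On a small box \<open>G\<close> is strictly
  monotone in the \<open>l\<close>-th coordinate, hence the map is injective, and the intermediate value theorem
  gives preimages that depend continuously on the image point. The increments of \<open>G\<close> along the inverse
  \<open>h\<close> then determine the partial derivatives of \<open>h\<close>: rational expressions in the partial derivatives of
  \<open>G\<close> at \<open>h z\<close>. So \<open>h\<close> is \<open>C\<^sup>k\<^sup>+\<^sup>1\<close> as soon as it is \<open>C\<^sup>k\<close>.
\<close>

lemma coordinate_replacement_straightens:
  assumes G: "smooth_fn n U G" and y0: "y0 \<in> U" and l: "l < n" and nz: "partial l G y0 \<noteq> 0"
  obtains V where "openin (Euclidean_space n) V" "y0 \<in> V" "V \<subseteq> U"
    "diffeo_onto_image n V (\<lambda>y. y(l := G y))"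
proof -
  \<comment> \<open>Multiplying \<open>G\<close> by \<open>s\<close> makes it increasing, whatever the sign of the derivative is.\<close>
  define s where "s = partial l G y0"
  define N where "N = {x \<in> U. s * partial l G x \<in> {0<..}}"
  note U = smooth_fn_openin [OF G]
  have N: "openin (Euclidean_space n) N"
    unfolding N_def
    by (intro openin_Euclidean_preimage [OF U] continuous_on_mult_left
        smooth_fn_continuous_on [OF smooth_fn_partial [OF G l]]) simp
  have "y0 \<in> N"
    using y0 nz by (simp add: N_def s_def zero_less_mult_iff) linarith
  then obtain e where e: "e > 0" "\<And>y. y \<in> euclid n \<Longrightarrow> (\<forall>i<n. \<bar>y i - y0 i\<bar> < e) \<Longrightarrow> y \<in> N"
    using openin_EuclideanE [OF N] by metis
  define V where "V = {y. \<forall>i<n. \<bar>y i - y0 i\<bar> < e} \<inter> euclid n"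
  have V: "openin (Euclidean_space n) V"
    using open_Collect_coordinates [of n y0 e] by (auto simp: V_def openin_Euclidean_open)
  have y0V: "y0 \<in> V"
    using y0 openin_subset_euclid [OF U] e(1) by (simp add: V_def)
  have VN: "V \<subseteq> N"
    using e(2) by (auto simp: V_def)
  then have VU: "V \<subseteq> U"
    by (auto simp: N_def)
  define E where "E y = y(l := G y)" for y
  have E_l: "E y l = G y" and E_i: "i \<noteq> l \<Longrightarrow> E y i = y i" for y i
    by (simp_all add: E_def)
  have VE: "E y \<in> euclid n" if "y \<in> V" for y
    unfolding E_def using that l by (intro fun_upd_in_euclid) (auto simp: V_def)
  have upd: "y(l := t) \<in> V" if "y \<in> V" "\<bar>t - y0 l\<bar> < e" for y t
    using that l by (auto simp: V_def intro: fun_upd_in_euclid)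
  have V_l: "\<bar>y l - y0 l\<bar> < e" if "y \<in> V" for y
    using that l by (auto simp: V_def)
  have mono: "s * G (y(l := a)) < s * G (y(l := b))"
    if y: "y \<in> V" and ab: "a < b" and a: "\<bar>a - y0 l\<bar> < e" and b: "\<bar>b - y0 l\<bar> < e" for y a b
  proof (rule DERIV_pos_imp_increasing [OF ab])
    fix t assume "a \<le> t" "t \<le> b"
    then have t: "y(l := t) \<in> V"
      using a b by (intro upd y) auto
    have "((\<lambda>r. G ((y(l := t))(l := r))) has_real_derivative partial l G (y(l := t)))
        (at ((y(l := t)) l))"
      by (rule Ck_on_has_partial [OF smooth_fn_Ck [OF G]]) (use t VU l in auto)
    then have "((\<lambda>r. G (y(l := r))) has_real_derivative partial l G (y(l := t))) (at t)"
      by simp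
    then have "((\<lambda>r. s * G (y(l := r))) has_real_derivative s * partial l G (y(l := t))) (at t)"
      by (rule DERIV_cmult)
    moreover have "s * partial l G (y(l := t)) > 0"
      using t VN by (auto simp: N_def)
    ultimately show "\<exists>d. ((\<lambda>r. s * G (y(l := r))) has_real_derivative d) (at t) \<and> 0 < d"
      by blast
  qed
  have inj: "inj_on E V"
  proof (rule inj_onI)
    fix y z assume yz: "y \<in> V" "z \<in> V" "E y = E z"
    have i: "y i = z i" if "i \<noteq> l" for i
      using fun_cong [OF yz(3), of i] E_i [OF that] by metis
    have z: "z = y(l := z l)" and y: "y = y(l := y l)"
      using i by auto
    have G: "G y = G z"
      using fun_cong [OF yz(3), of l] by (simp add: E_l)
    have "\<not> y l < z l" "\<not> z l < y l"
      using mono [OF yz(1) _ V_l [OF yz(1)] V_l [OF yz(2)]]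
        mono [OF yz(1) _ V_l [OF yz(2)] V_l [OF yz(1)]] G y z by fastforce+
    then show "y = z"
      using i by (intro ext) (metis linorder_neqE_linordered_idom)
  qed
  \<comment> \<open>The intermediate value theorem along the \<open>l\<close>-th axis solves \<open>E w = z\<close> with \<open>w\<close> close to \<open>y\<close>.\<close>
  have solve: "\<exists>\<eta>>0. \<forall>z\<in>euclid n. (\<forall>i<n. \<bar>z i - E y i\<bar> < \<eta>) \<longrightarrow>
      (\<exists>w\<in>V. E w = z \<and> (\<forall>i<n. \<bar>w i - y i\<bar> < \<epsilon>))"
    if y: "y \<in> V" and \<epsilon>: "\<epsilon> > 0" for y \<epsilon>
  proof -
    define \<delta> where "\<delta> = min \<epsilon> (e - \<bar>y l - y0 l\<bar>) / 2"
    have \<delta>: "\<delta> > 0" "\<delta> < \<epsilon>" "\<bar>y l - y0 l\<bar> + \<delta> < e"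
      using \<epsilon> V_l [OF y] by (auto simp: \<delta>_def min_def field_simps)
    define p q where "p = y(l := y l + \<delta>)" and "q = y(l := y l - \<delta>)"
    have pq: "p \<in> V" "q \<in> V"
      unfolding p_def q_def using \<delta> by (auto intro!: upd y)
    have qy: "s * G q < s * G y" and yp: "s * G y < s * G p"
      using mono [OF y, of "y l - \<delta>" "y l"] mono [OF y, of "y l" "y l + \<delta>"] \<delta>
      by (auto simp: p_def q_def)
    \<comment> \<open>Half of the gap between \<open>G y\<close> and the values at the ends of the segment; if \<open>z\<close> is so close to
      \<open>E y\<close> that neither side moves by more than that, the value \<open>z l\<close> is still attained.\<close>
    define c where "c = min (s * G p - s * G y) (s * G y - s * G q) / 2"
    have c: "c > 0" "s * G y + c < s * G p" "s * G q < s * G y - c"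
      using qy yp by (auto simp: c_def min_def field_simps)
    have sG: "continuous_on V (\<lambda>x. s * G x)"
      by (intro continuous_intros continuous_on_subset [OF smooth_fn_continuous_on [OF G] VU])
    define P Q where "P = {x \<in> V. s * G x \<in> {s * G y + c<..}}" and "Q = {x \<in> V. s * G x \<in> {..<s * G y - c}}"
    have PQ: "openin (Euclidean_space n) P" "openin (Euclidean_space n) Q"
      unfolding P_def Q_def by (intro openin_Euclidean_preimage [OF V sG]; simp)+
    have pqPQ: "p \<in> P" "q \<in> Q"
      using pq c by (auto simp: P_def Q_def)
    obtain \<mu>1 where \<mu>1: "\<mu>1 > 0" "\<And>z. z \<in> euclid n \<Longrightarrow> (\<forall>i<n. \<bar>z i - p i\<bar> < \<mu>1) \<Longrightarrow> z \<in> P"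
      by (rule openin_EuclideanE [OF PQ(1) pqPQ(1)], rule that)
    obtain \<mu>2 where \<mu>2: "\<mu>2 > 0" "\<And>z. z \<in> euclid n \<Longrightarrow> (\<forall>i<n. \<bar>z i - q i\<bar> < \<mu>2) \<Longrightarrow> z \<in> Q"
      by (rule openin_EuclideanE [OF PQ(2) pqPQ(2)], rule that)
    \<comment> \<open>The last bound makes \<open>s * z l\<close> differ from \<open>s * G y\<close> by at most \<open>c\<close>.\<close>
    define \<eta> where "\<eta> = min (min \<mu>1 \<mu>2) (min \<epsilon> (c / (\<bar>s\<bar> + 1)))"
    have \<eta>: "\<eta> > 0" "\<eta> \<le> \<mu>1" "\<eta> \<le> \<mu>2" "\<eta> \<le> \<epsilon>" "\<eta> \<le> c / (\<bar>s\<bar> + 1)"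
      using \<mu>1(1) \<mu>2(1) \<epsilon> c(1) by (auto simp: \<eta>_def)
    have "\<exists>w\<in>V. E w = z \<and> (\<forall>i<n. \<bar>w i - y i\<bar> < \<epsilon>)"
      if z: "z \<in> euclid n" "\<forall>i<n. \<bar>z i - E y i\<bar> < \<eta>" for z
    proof -
      have zi: "\<bar>z i - y i\<bar> < \<eta>" if "i < n" "i \<noteq> l" for i
        using z(2) that E_i by metis
      have "\<bar>z l - G y\<bar> < c / (\<bar>s\<bar> + 1)"
        using z(2) l \<eta>(5) E_l by (metis less_le_trans)
      then have "\<bar>s\<bar> * \<bar>z l - G y\<bar> \<le> \<bar>s\<bar> * (c / (\<bar>s\<bar> + 1))"
        by (intro mult_left_mono) auto
      also have "\<dots> \<le> c"
        using c(1) by (simp add: field_simps)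
      finally have "\<bar>s * z l - s * G y\<bar> \<le> c"
        by (simp add: abs_mult [symmetric] right_diff_distrib)
      moreover have "z(l := y l + \<delta>) \<in> P"
      proof (intro \<mu>1(2) fun_upd_in_euclid z(1) l allI impI)
        show "\<bar>(z(l := y l + \<delta>)) i - p i\<bar> < \<mu>1" if "i < n" for i
          using zi [OF that] \<eta>(2) \<mu>1(1) by (cases "i = l") (auto simp: p_def)
      qed
      moreover have "z(l := y l - \<delta>) \<in> Q"
      proof (intro \<mu>2(2) fun_upd_in_euclid z(1) l allI impI)
        show "\<bar>(z(l := y l - \<delta>)) i - q i\<bar> < \<mu>2" if "i < n" for i
          using zi [OF that] \<eta>(3) \<mu>2(1) by (cases "i = l") (auto simp: q_def)
      qed
      ultimately have zV: "z(l := y l + \<delta>) \<in> V"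
        and le: "s * G (z(l := y l - \<delta>)) \<le> s * z l" "s * z l \<le> s * G (z(l := y l + \<delta>))"
        by (auto simp: P_def Q_def)
      have ztV: "z(l := t) \<in> V" if "y l - \<delta> \<le> t" "t \<le> y l + \<delta>" for t
        using upd [OF zV, of t] that \<delta>(3) by auto
      have "continuous_on {y l - \<delta>..y l + \<delta>} (\<lambda>t. s * G (z(l := t)))"
      proof (rule continuous_on_compose2 [OF sG])
        show "continuous_on {y l - \<delta>..y l + \<delta>} (\<lambda>t. z(l := t))"
        proof (rule continuous_on_coordinatewise_then_product)
          show "continuous_on {y l - \<delta>..y l + \<delta>} (\<lambda>t. (z(l := t)) i)" for i
            by (cases "i = l") (auto intro: continuous_intros)
        qed
      qed (use ztV in auto)
      then obtain t where t: "y l - \<delta> \<le> t" "t \<le> y l + \<delta>" "s * G (z(l := t)) = s * z l"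
        using IVT' [of "\<lambda>t. s * G (z(l := t))" "y l - \<delta>" "s * z l" "y l + \<delta>"] le \<delta>(1) by auto
      have "E (z(l := t)) = z"
        using t(3) nz by (auto simp: E_def s_def)
      moreover have "\<bar>(z(l := t)) i - y i\<bar> < \<epsilon>" if "i < n" for i
        using zi [OF that] \<eta>(4) t(1,2) \<delta>(2) by (cases "i = l") auto
      ultimately show ?thesis
        using ztV [OF t(1,2)] by blast
    qed
    then show ?thesis
      using \<eta>(1) by blast
  qed
  define W where "W = E ` V"
  define h where "h = inv_into V E"
  have hE: "h (E y) = y" if "y \<in> V" for y
    using that inj by (simp add: h_def)
  have hW: "h z \<in> V" "E (h z) = z" if "z \<in> W" for z
    using that by (auto simp: W_def hE)
  have W: "openin (Euclidean_space n) W"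
    unfolding openin_Euclidean_box
  proof (intro conjI ballI)
    show "W \<subseteq> euclid n"
      using VE by (auto simp: W_def)
    fix z assume "z \<in> W"
    then obtain \<eta> where \<eta>: "\<eta> > 0" "\<And>z'. z' \<in> euclid n \<Longrightarrow> (\<forall>i<n. \<bar>z' i - E (h z) i\<bar> < \<eta>) \<Longrightarrow>
        \<exists>w\<in>V. E w = z' \<and> (\<forall>i<n. \<bar>w i - h z i\<bar> < 1)"
      using solve [OF hW(1), of z 1] by auto
    show "\<exists>\<eta>>0. \<forall>z'\<in>euclid n. (\<forall>i<n. \<bar>z' i - z i\<bar> < \<eta>) \<longrightarrow> z' \<in> W"
    proof (intro exI [of _ \<eta>] conjI ballI impI \<eta>(1))
      fix z' assume "z' \<in> euclid n" "\<forall>i<n. \<bar>z' i - z i\<bar> < \<eta>"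
      then show "z' \<in> W"
        using \<eta>(2) [of z'] hW(2) [OF \<open>z \<in> W\<close>] by (auto simp: W_def)
    qed
  qed
  have h_i: "h z i = z i" if "z \<in> W" "i \<noteq> l" for z i
    using E_i [OF that(2), of "h z"] hW(2) [OF that(1)] by simp
  have h_cont: "continuous_on W h"
    unfolding continuous_on_def
  proof
    fix z assume z: "z \<in> W"
    show "(h \<longlongrightarrow> h z) (at z within W)"
    proof (rule tendsto_coordinates, rule tendstoI)
      fix i and \<epsilon> :: real assume "\<epsilon> > 0"
      then obtain \<eta> where \<eta>: "\<eta> > 0" "\<And>z'. z' \<in> euclid n \<Longrightarrow> (\<forall>i<n. \<bar>z' i - E (h z) i\<bar> < \<eta>) \<Longrightarrow>
          \<exists>w\<in>V. E w = z' \<and> (\<forall>i<n. \<bar>w i - h z i\<bar> < \<epsilon>)"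
        using solve [OF hW(1) [OF z], of \<epsilon>] by meson
      have "dist (h z' i) (h z i) < \<epsilon>" if z': "z' \<in> W" "\<forall>i<n. \<bar>z' i - z i\<bar> < \<eta>" for z'
      proof (cases "i < n")
        case True
        then obtain w where "w \<in> V" "E w = z'" "\<bar>w i - h z i\<bar> < \<epsilon>"
          using \<eta>(2) [of z'] hW(2) [OF z] z' openin_subset_euclid [OF W z'(1)] by auto
        then show ?thesis
          using hE by (auto simp: dist_real_def)
      next
        case False
        then show ?thesis
          using hW(1) [OF z] hW(1) [OF z'(1)] \<open>\<epsilon> > 0\<close> by (auto simp: V_def in_euclid)
      qed
      then show "\<forall>\<^sub>F z' in at z within W. dist (h z' i) (h z i) < \<epsilon>"
        using open_Collect_coordinates [of n z \<eta>] \<eta>(1) unfolding eventually_at_topological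
        by (intro exI [of _ "{y. \<forall>i<n. \<bar>y i - z i\<bar> < \<eta>}"]) auto
    qed
  qed
  have nz': "partial l G (h z) \<noteq> 0" if "z \<in> W" for z
    using hW(1) [OF that] VN by (auto simp: N_def)
  define D where "D i z = (if i = l then inverse (partial l G (h z))
      else ((-1) * partial i G (h z)) * inverse (partial l G (h z)))" for i z
  have h_deriv: "((\<lambda>t. h (z(i := t)) l) has_real_derivative D i z) (at (z i))"
    if z: "z \<in> W" and i: "i < n" for z i
  proof -
    define g where "g t = h (z(i := t))" for t
    have zW: "\<forall>\<^sub>F t in at (z i). z(i := t) \<in> W"
      using eventually_fun_upd_in [OF W z i] by (auto simp: eventually_at_filter elim: eventually_mono)
    have "((\<lambda>t. z(i := t)) \<longlongrightarrow> z) (at (z i))"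
    proof (rule tendsto_coordinates)
      show "((\<lambda>t. (z(i := t)) j) \<longlongrightarrow> z j) (at (z i))" for j
        by (cases "j = i") simp_all
    qed
    moreover have "continuous (at z within W) h"
      using h_cont z by (simp add: continuous_on_eq_continuous_within)
    ultimately have g: "(g \<longlongrightarrow> h z) (at (z i))"
      unfolding g_def using zW by (intro continuous_within_tendsto_compose [of z W h])
    have ge: "\<forall>\<^sub>F t in at (z i). g t \<in> euclid n"
      using zW by eventually_elim (use hW(1) in \<open>auto simp: g_def V_def\<close>)
    have hzU: "h z \<in> U"
      using hW(1) [OF z] VU by blast
    obtain B where B: "\<And>j. j < n \<Longrightarrow> (B j \<longlongrightarrow> partial j G (h z)) (at (z i))"
      and inc: "\<forall>\<^sub>F t in at (z i). G (g t) - G (h z) = (\<Sum>j<n. B j t * (g t j - h z j))"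
      by (rule increment_along [OF U smooth_fn_Ck [OF G] hzU g ge], rule that)
    have B_nz: "\<forall>\<^sub>F t in at (z i). B l t \<noteq> 0"
      using B [OF l] nz' [OF z] tendsto_imp_eventually_ne by blast
    have ne: "\<forall>\<^sub>F t in at (z i). t \<noteq> z i"
      by (simp add: eventually_at_filter)
    \<comment> \<open>Along the curve only the coordinates \<open>l\<close> and \<open>i\<close> vary, and \<open>G (g t)\<close> is the \<open>l\<close>-th coordinate of
      \<open>z(i := t)\<close>; solving the increment formula for the \<open>l\<close>-th increment gives the quotient.\<close>
    have "\<forall>\<^sub>F t in at (z i). (if i = l then inverse (B l t) else ((-1) * B i t) * inverse (B l t)) =
        (g t l - g (z i) l) / (t - z i)"
      using zW inc B_nz ne
    proof eventually_elim
      case (elim t)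
      have gz: "g (z i) = h z"
        by (simp add: g_def)
      have "(z(i := t)) l - z l = G (g t) - G (h z)"
        using hW(2) [OF elim(1)] hW(2) [OF z] E_l g_def by metis
      also have "\<dots> = B l t * (g t l - h z l) + (\<Sum>j\<in>{..<n} - {l}. B j t * (g t j - h z j))"
        using elim(2) l by (simp add: sum.remove)
      also have "(\<Sum>j\<in>{..<n} - {l}. B j t * (g t j - h z j)) =
          (\<Sum>j\<in>{..<n} - {l}. if j = i then B i t * (t - z i) else 0)"
        using h_i [OF elim(1)] h_i [OF z] by (intro sum.cong) (auto simp: g_def)
      finally show ?case
        using i elim(3,4) by (auto simp: gz field_simps split: if_splits)
    qed
    moreover have "((\<lambda>t. if i = l then inverse (B l t) else ((-1) * B i t) * inverse (B l t)) \<longlongrightarrow> D i z)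
        (at (z i))"
      unfolding D_def using B [OF l] B [OF i] nz' [OF z]
      by (cases "i = l") (auto intro!: tendsto_intros)
    ultimately have "((\<lambda>t. (g t l - g (z i) l) / (t - z i)) \<longlongrightarrow> D i z) (at (z i))"
      by (rule Lim_transform_eventually [rotated])
    then show ?thesis
      by (simp add: has_field_derivative_iff g_def)
  qed
  have h_Ck: "Ck_on n k W (\<lambda>z. h z l)" for k
  proof (induction k)
    case 0
    show ?case
      unfolding Ck_on_0 [OF W] by (rule continuous_on_product_then_coordinatewise [OF h_cont])
  next
    case (Suc k)
    have comp: "Ck_on n k W (\<lambda>z. h z j)" for j
    proof (cases "j = l")
      case False
      show ?thesis
        by (rule Ck_on_cong [OF W _ Ck_on_coordinate [OF W, of k j]]) (simp add: h_i False)
    qed (simp add: Suc)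
    have part: "Ck_on n k W (\<lambda>z. partial i G (h z))" if "i < n" for i
      by (rule Ck_on_compose [OF U W smooth_fn_Ck [OF smooth_fn_partial [OF G that]] comp])
        (use hW(1) VU in auto)
    show ?case
    proof (rule Ck_on_SucI [OF W _ h_deriv])
      show "continuous_on W (\<lambda>z. h z l)"
        by (rule continuous_on_product_then_coordinatewise [OF h_cont])
      show "Ck_on n k W (D i)" if "i < n" for i
      proof (cases "i = l")
        case True
        show ?thesis
          unfolding D_def using True Ck_on_inverse [OF W part [OF l] nz'] by simp
      next
        case False
        have "Ck_on n k W (\<lambda>z. ((-1) * partial i G (h z)) * inverse (partial l G (h z)))"
          by (intro Ck_on_mult [OF W] Ck_on_inverse [OF W] Ck_on_const [OF W] part l that nz')
        then show ?thesis
          unfolding D_def using False by simp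
      qed
    qed
  qed
  have "smooth_between n n W h"
  proof (rule smooth_betweenI [OF W])
    show "h z \<in> euclid n" if "z \<in> W" for z
      using hW(1) [OF that] by (simp add: V_def)
    show "smooth_fn n W (\<lambda>z. h z j)" for j
    proof (cases "j = l")
      case False
      show ?thesis
        by (rule smooth_fn_cong [OF smooth_fn_coordinate [OF W, of j]]) (simp add: h_i False)
    qed (simp add: smooth_fn_def W h_Ck)
  qed
  moreover have "smooth_between n n V E"
  proof (rule smooth_betweenI [OF V VE])
    show "smooth_fn n V (\<lambda>y. E y j)" for j
      using smooth_fn_subset [OF G V VU] smooth_fn_coordinate [OF V, of j]
      by (cases "j = l") (simp_all add: E_def)
  qed
  ultimately have "diffeo_onto_image n V E"
    by (intro diffeo_onto_imageI [of n V E W h]) (auto simp: W_def hE)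
  then show thesis
    using that [OF V y0V VU] by (simp add: E_def [abs_def])
qed


lemma diffeo_onto_image_subset:
  assumes "diffeo_onto_image n U \<phi>" "openin (Euclidean_space n) W" "W \<subseteq> U"
  shows "diffeo_onto_image n W \<phi>"
proof (rule diffeo_onto_imageI)
  have \<phi>: "smooth_between n n U \<phi>" "inj_on \<phi> U" "smooth_between n n (\<phi> ` U) (inv_into U \<phi>)"
    using assms(1) by (auto simp: diffeo_onto_image_def)
  show "smooth_between n n W \<phi>"
    by (rule smooth_between_subset [OF \<phi>(1) assms(2,3)])
  have "{y \<in> \<phi> ` U. inv_into U \<phi> y \<in> W} = \<phi> ` W"
    using assms(3) \<phi>(2) by (auto simp: inv_into_f_f subset_iff)
  then have "openin (Euclidean_space n) (\<phi> ` W)"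
    using openin_smooth_preimage [OF \<phi>(3) assms(2)] by simp
  then show "smooth_between n n (\<phi> ` W) (inv_into U \<phi>)"
    by (rule smooth_between_subset [OF \<phi>(3)]) (use assms(3) in auto)
  show "inv_into U \<phi> (\<phi> x) = x" if "x \<in> W" for x
    using that assms(3) \<phi>(2) by auto
qed simp

lemma diffeo_onto_image_permute:
  assumes "bij_betw \<rho> {..<n} {..<n}"
  shows "diffeo_onto_image n (euclid n) (\<lambda>x k. if k < n then x (\<rho> k) else 0)"
proof (rule diffeo_onto_imageI)
  let ?P = "\<lambda>\<rho> (x::rvec) k. if k < n then x (\<rho> k) else 0"
  let ?\<sigma> = "inv_into {..<n} \<rho>"
  have \<sigma>: "bij_betw ?\<sigma> {..<n} {..<n}"
    by (rule bij_betw_inv_into [OF assms])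
  have P: "smooth_between n n (euclid n) (?P \<tau>)" for \<tau>
    by (intro smooth_betweenI) (simp_all add: in_euclid smooth_fn_coordinate)
  show "smooth_between n n (euclid n) (?P \<rho>)" "smooth_between n n (euclid n) (?P ?\<sigma>)"
    by (rule P)+
  have inv: "?\<sigma> (\<rho> k) = k" "\<rho> (?\<sigma> k) = k" "\<rho> k < n" "?\<sigma> k < n" if "k < n" for k
    using that assms \<sigma> bij_betw_inv_into_left [OF assms] bij_betw_inv_into_right [OF assms]
    by (auto dest: bij_betwE)
  show left: "?P ?\<sigma> (?P \<rho> x) = x" if "x \<in> euclid n" for x
    using that inv by (auto simp: in_euclid)
  have right: "?P \<rho> (?P ?\<sigma> x) = x" if "x \<in> euclid n" for x
    using that inv by (auto simp: in_euclid)
  show "?P \<rho> ` euclid n = euclid n"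
  proof (intro equalityI subsetI)
    show "x \<in> ?P \<rho> ` euclid n" if "x \<in> euclid n" for x
      using right [OF that] by (intro image_eqI [of _ _ "?P ?\<sigma> x"]) (auto simp: in_euclid)
  qed (auto simp: in_euclid)
qed

text \<open>
  An exchange argument as for bases of a vector space: the components \<open>F 0, F 1, \<dots>\<close> replace
  coordinates one after the other, \<open>\<sigma> i\<close> being the place where \<open>F i\<close> ended up.
\<close>

lemma submersive_components_complete_to_coordinates:
  assumes F: "smooth_between n q U F" and x0: "x0 \<in> U"
    and surj: "\<And>w. w \<in> euclid q \<Longrightarrow> \<exists>v. total_deriv n F x0 v = w" and "j \<le> q"
  shows "\<exists>V \<phi> \<sigma>. x0 \<in> V \<and> V \<subseteq> U \<and> diffeo_onto_image n V \<phi> \<and>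
    inj_on \<sigma> {..<j} \<and> \<sigma> ` {..<j} \<subseteq> {..<n} \<and> (\<forall>x\<in>V. \<forall>i<j. \<phi> x (\<sigma> i) = F x i)"
  using \<open>j \<le> q\<close>
proof (induction j)
  case 0
  show ?case
    using x0 diffeo_onto_image_id [OF smooth_between_openin [OF F]]
    by (intro exI [of _ U] exI [of _ "\<lambda>x. x"] exI [of _ id]) auto
next
  case (Suc j)
  then obtain V \<phi> \<sigma> where V: "x0 \<in> V" "V \<subseteq> U" "diffeo_onto_image n V \<phi>"
    and \<sigma>: "inj_on \<sigma> {..<j}" "\<sigma> ` {..<j} \<subseteq> {..<n}"
    and \<phi>F: "\<And>x i. x \<in> V \<Longrightarrow> i < j \<Longrightarrow> \<phi> x (\<sigma> i) = F x i"
    using Suc_leD by metis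
  have \<phi>: "smooth_between n n V \<phi>" "inj_on \<phi> V" "smooth_between n n (\<phi> ` V) (inv_into V \<phi>)"
    using V(3) by (auto simp: diffeo_onto_image_def)
  define G where "G y = F (inv_into V \<phi> y) j" for y
  have "smooth_between n q (\<phi> ` V) (F \<circ> inv_into V \<phi>)"
    by (rule smooth_between_compose [OF \<phi>(3) F]) (use \<phi>(2) V(2) in auto)
  then have G: "smooth_fn n (\<phi> ` V) G"
    using smooth_between_component [of n q "\<phi> ` V" "F \<circ> inv_into V \<phi>" j]
    by (simp add: G_def [abs_def])
  have FG: "F x j = G (\<phi> x)" if "x \<in> V" for x
    using that \<phi>(2) by (simp add: G_def)
  \<comment> \<open>If \<open>G\<close> depended to first order only on coordinates already used, the components
    \<open>F 0, \<dots>, F j\<close> would have linearly dependent differentials.\<close>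
  have "\<exists>l<n. l \<notin> \<sigma> ` {..<j} \<and> partial l G (\<phi> x0) \<noteq> 0"
  proof (rule ccontr)
    assume none: "\<not> ?thesis"
    define w :: rvec where "w = (\<lambda>i. if i = j then 1 else 0)"
    have "w \<in> euclid q"
      using Suc.prems by (auto simp: w_def in_euclid)
    then obtain v where v: "total_deriv n F x0 v = w"
      using surj by blast
    have "w j = (\<Sum>l<n. partial l G (\<phi> x0) * total_deriv n \<phi> x0 v l)"
      unfolding v [symmetric] using V(1)
      by (intro total_deriv_component [OF \<phi>(1) G]) (auto simp: FG)
    also have "\<dots> = 0"
    proof (rule sum.neutral, rule ballI)
      fix l assume l: "l \<in> {..<n}"
      show "partial l G (\<phi> x0) * total_deriv n \<phi> x0 v l = 0"
      proof (cases "l \<in> \<sigma> ` {..<j}")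
        case True
        then obtain i where i: "i < j" "l = \<sigma> i"
          by auto
        have "total_deriv n \<phi> x0 v l = total_deriv n F x0 v i"
          by (rule total_deriv_cong [OF smooth_between_openin [OF \<phi>(1)] V(1)]) (simp add: i \<phi>F)
        then show ?thesis
          using i(1) by (simp add: v w_def)
      next
        case False
        then show ?thesis using none l by auto
      qed
    qed
    finally show False
      by (simp add: w_def)
  qed
  then obtain l where l: "l < n" "l \<notin> \<sigma> ` {..<j}" "partial l G (\<phi> x0) \<noteq> 0"
    by blast
  have \<phi>x0: "\<phi> x0 \<in> \<phi> ` V"
    using V(1) by simp
  obtain N where N: "\<phi> x0 \<in> N" "N \<subseteq> \<phi> ` V" "diffeo_onto_image n N (\<lambda>y. y(l := G y))"
    by (rule coordinate_replacement_straightens [OF G \<phi>x0 l(1,3)], rule that)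
  show ?case
  proof (intro exI conjI ballI allI impI)
    show "diffeo_onto_image n {x \<in> V. \<phi> x \<in> N} ((\<lambda>y. y(l := G y)) \<circ> \<phi>)"
      by (rule diffeo_onto_image_compose [OF V(3) N(3,2)])
    show "x0 \<in> {x \<in> V. \<phi> x \<in> N}"
      using V(1) N(1) by simp
    show "{x \<in> V. \<phi> x \<in> N} \<subseteq> U"
      using V(2) by auto
    show "inj_on (\<sigma>(j := l)) {..<Suc j}"
      using \<sigma>(1) l(2) by (auto simp: lessThan_Suc inj_on_fun_updI)
    show "(\<sigma>(j := l)) ` {..<Suc j} \<subseteq> {..<n}"
      using \<sigma>(2) l(1) by (auto simp: lessThan_Suc)
    show "((\<lambda>y. y(l := G y)) \<circ> \<phi>) x ((\<sigma>(j := l)) i) = F x i"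
      if "x \<in> {x \<in> V. \<phi> x \<in> N}" "i < Suc j" for x i
      using that l(2) \<phi>F FG by (auto simp: less_Suc_eq)
  qed
qed

text \<open>
  The components of \<open>F\<close> are moved to the last places, so that the zero set of \<open>F\<close> becomes the slice in
  which the last \<open>q\<close> coordinates vanish.
\<close>

lemma submersion_normal_form:
  assumes F: "smooth_between n q U F" and x0: "x0 \<in> U"
    and surj: "\<And>w. w \<in> euclid q \<Longrightarrow> \<exists>v. total_deriv n F x0 v = w"
  obtains V \<phi> where "x0 \<in> V" "V \<subseteq> U" "diffeo_onto_image n V \<phi>" "q \<le> n"
    "\<And>x j. x \<in> V \<Longrightarrow> j < q \<Longrightarrow> \<phi> x (n - q + j) = F x j"
proof -
  obtain V \<phi> \<sigma> where V: "x0 \<in> V" "V \<subseteq> U" "diffeo_onto_image n V \<phi>"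
    and \<sigma>: "inj_on \<sigma> {..<q}" "\<sigma> ` {..<q} \<subseteq> {..<n}"
    and \<phi>F: "\<And>x i. x \<in> V \<Longrightarrow> i < q \<Longrightarrow> \<phi> x (\<sigma> i) = F x i"
    using submersive_components_complete_to_coordinates [OF F x0 surj order_refl] by metis
  have qn: "q \<le> n"
    using card_inj_on_le [OF \<sigma>] by simp
  \<comment> \<open>Extend \<open>\<sigma>\<close>, shifted to the last \<open>q\<close> places, to a permutation \<open>\<rho>\<close> of all coordinates.\<close>
  have "card ({..<n} - \<sigma> ` {..<q}) = card {..<n - q}"
    using \<sigma> by (simp add: card_Diff_subset card_image)
  then obtain \<beta> where \<beta>: "bij_betw \<beta> {..<n - q} ({..<n} - \<sigma> ` {..<q})"
    using finite_same_card_bij [of "{..<n - q}" "{..<n} - \<sigma> ` {..<q}"] by auto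
  define \<rho> where "\<rho> k = (if k < n - q then \<beta> k else \<sigma> (k - (n - q)))" for k
  have 1: "bij_betw \<rho> {..<n - q} ({..<n} - \<sigma> ` {..<q})"
    using \<beta> by (rule bij_betw_cong [THEN iffD1, rotated]) (simp add: \<rho>_def)
  have "bij_betw (\<sigma> \<circ> (\<lambda>k. k - (n - q))) {n - q..<n} (\<sigma> ` {..<q})"
  proof (rule bij_betw_trans)
    show "bij_betw (\<lambda>k. k - (n - q)) {n - q..<n} {..<q}"
      by (rule bij_betw_byWitness [where f' = "\<lambda>k. k + (n - q)"]) (use qn in auto)
    show "bij_betw \<sigma> {..<q} (\<sigma> ` {..<q})"
      using \<sigma>(1) by (simp add: bij_betw_def)
  qed
  then have 2: "bij_betw \<rho> {n - q..<n} (\<sigma> ` {..<q})"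
    by (rule bij_betw_cong [THEN iffD1, rotated]) (simp add: \<rho>_def)
  have "bij_betw \<rho> ({..<n - q} \<union> {n - q..<n}) (({..<n} - \<sigma> ` {..<q}) \<union> \<sigma> ` {..<q})"
    by (rule bij_betw_combine [OF 1 2]) auto
  moreover have "{..<n - q} \<union> {n - q..<n} = {..<n}" "({..<n} - \<sigma> ` {..<q}) \<union> \<sigma> ` {..<q} = {..<n}"
    using qn \<sigma>(2) by auto
  ultimately have "bij_betw \<rho> {..<n} {..<n}"
    by simp
  note \<rho> = diffeo_onto_image_permute [OF this]
  have \<phi>V: "smooth_between n n V \<phi>" "openin (Euclidean_space n) (\<phi> ` V)"
    using V(3) by (auto simp: diffeo_onto_image_def intro: smooth_between_openin)
  let ?P = "\<lambda>x k. if k < n then x (\<rho> k) else 0"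
  have P: "diffeo_onto_image n (\<phi> ` V) ?P"
    by (rule diffeo_onto_image_subset [OF \<rho> \<phi>V(2)]) (use openin_subset [OF \<phi>V(2)] in auto)
  have diffeo: "diffeo_onto_image n V (?P \<circ> \<phi>)"
  proof -
    have "{x \<in> V. \<phi> x \<in> \<phi> ` V} = V" by auto
    then show ?thesis
      using diffeo_onto_image_compose [OF V(3) P order_refl] by simp
  qed
  show thesis
  proof (rule that [OF V(1,2) diffeo qn])
    show "(?P \<circ> \<phi>) x (n - q + j) = F x j" if "x \<in> V" "j < q" for x j
    proof -
      have "\<rho> (n - q + j) = \<sigma> j"
        by (simp add: \<rho>_def)
      moreover have "n - q + j < n"
        using that(2) qn by linarith
      ultimately show ?thesis
        using \<phi>F [OF that] by simp
    qed
  qed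
qed

section \<open>Charts and pointwise smoothness\<close>

lemma chart_inv_right: "y \<in> snd c ` fst c \<Longrightarrow> snd c (chart_inv c y) = y"
  by (simp add: chart_inv_def f_inv_into_f)

lemma chart_inv_left: "inj_on (snd c) (fst c) \<Longrightarrow> x \<in> fst c \<Longrightarrow> chart_inv c (snd c x) = x"
  by (simp add: chart_inv_def)

lemma chart_inv_restrict:
  "inj_on (snd c) (fst c) \<Longrightarrow> W \<subseteq> fst c \<Longrightarrow> y \<in> snd c ` W \<Longrightarrow> chart_inv (W, snd c) y = chart_inv c y"
  by (auto simp: chart_inv_def inv_into_f_f inj_on_subset subset_iff)

text \<open>
  The homeomorphism condition in terms of images and preimages of open sets, both in the ambient
  spaces. All charts below are recognised by it.
\<close>

lemma coord_chart_iff: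
  "coord_chart T n c \<longleftrightarrow>
     openin T (fst c) \<and> inj_on (snd c) (fst c) \<and> snd c ` fst c \<subseteq> euclid n \<and>
     (\<forall>U. openin (Euclidean_space n) U \<longrightarrow> openin T {x \<in> fst c. snd c x \<in> U}) \<and>
     (\<forall>W. openin T W \<and> W \<subseteq> fst c \<longrightarrow> openin (Euclidean_space n) (snd c ` W))"
    (is "?L \<longleftrightarrow> ?R")
proof
  assume ?L
  then have c: "openin T (fst c)" and im: "openin (Euclidean_space n) (snd c ` fst c)"
    and h: "homeomorphic_map (subtopology T (fst c)) (subtopology (Euclidean_space n) (snd c ` fst c)) (snd c)"
    by (auto simp: coord_chart_def)
  have top: "topspace (subtopology T (fst c)) = fst c"
    using openin_subset [OF c] by auto
  have "inj_on (snd c) (fst c)"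
    using homeomorphic_imp_injective_map [OF h] top by simp
  moreover have "openin T {x \<in> fst c. snd c x \<in> U}" if U: "openin (Euclidean_space n) U" for U
  proof -
    have "openin (subtopology (Euclidean_space n) (snd c ` fst c)) (U \<inter> snd c ` fst c)"
      using U by (simp add: openin_subtopology_Int)
    then have "openin (subtopology T (fst c)) {x \<in> topspace (subtopology T (fst c)). snd c x \<in> U \<inter> snd c ` fst c}"
      by (rule openin_continuous_map_preimage [OF homeomorphic_imp_continuous_map [OF h]])
    moreover have "{x \<in> topspace (subtopology T (fst c)). snd c x \<in> U \<inter> snd c ` fst c} = {x \<in> fst c. snd c x \<in> U}"
      using top by auto
    ultimately show ?thesis
      using openin_trans_full c by metis
  qed
  moreover have "openin (Euclidean_space n) (snd c ` W)" if W: "openin T W" "W \<subseteq> fst c" for W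
  proof -
    have "openin (subtopology T (fst c)) W"
      using W c by (simp add: openin_open_subtopology)
    then have "openin (subtopology (Euclidean_space n) (snd c ` fst c)) (snd c ` W)"
      using homeomorphic_imp_open_map [OF h] by (simp add: open_map_def)
    then show ?thesis
      using openin_trans_full im by metis
  qed
  ultimately show ?R
    using c openin_subset [OF im] by blast
next
  assume R: ?R
  then have c: "openin T (fst c)" and im: "openin (Euclidean_space n) (snd c ` fst c)"
    by auto
  have top: "topspace (subtopology T (fst c)) = fst c"
    "topspace (subtopology (Euclidean_space n) (snd c ` fst c)) = snd c ` fst c"
    using openin_subset [OF c] openin_subset [OF im] by auto
  have "homeomorphic_map (subtopology T (fst c)) (subtopology (Euclidean_space n) (snd c ` fst c)) (snd c)"
  proof (rule bijective_open_imp_homeomorphic_map)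
    show "continuous_map (subtopology T (fst c)) (subtopology (Euclidean_space n) (snd c ` fst c)) (snd c)"
      unfolding continuous_map
    proof (intro conjI allI impI)
      fix U assume "openin (subtopology (Euclidean_space n) (snd c ` fst c)) U"
      then have "openin (Euclidean_space n) U"
        using openin_trans_full im by metis
      then have "openin T {x \<in> fst c. snd c x \<in> U}"
        using R by blast
      then show "openin (subtopology T (fst c)) {x \<in> topspace (subtopology T (fst c)). snd c x \<in> U}"
        unfolding top using c by (simp add: openin_open_subtopology)
    qed (use top in auto)
    show "open_map (subtopology T (fst c)) (subtopology (Euclidean_space n) (snd c ` fst c)) (snd c)"
      using R c im by (auto simp: open_map_def openin_open_subtopology)
  qed (use top R in auto)
  then show ?L
    using c im by (simp add: coord_chart_def)
qed

lemma coord_chart_openin: "coord_chart T n c \<Longrightarrow> openin T (fst c)"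
  and coord_chart_inj: "coord_chart T n c \<Longrightarrow> inj_on (snd c) (fst c)"
  and coord_chart_in_euclid: "coord_chart T n c \<Longrightarrow> x \<in> fst c \<Longrightarrow> snd c x \<in> euclid n"
  and coord_chart_vimage: "coord_chart T n c \<Longrightarrow> openin (Euclidean_space n) U \<Longrightarrow> openin T {x \<in> fst c. snd c x \<in> U}"
  and coord_chart_image: "coord_chart T n c \<Longrightarrow> openin T W \<Longrightarrow> W \<subseteq> fst c \<Longrightarrow> openin (Euclidean_space n) (snd c ` W)"
  by (auto simp: coord_chart_iff)

lemma coord_chart_restrict:
  assumes "coord_chart T n c" "openin T W" "W \<subseteq> fst c"
  shows "coord_chart T n (W, snd c)"
proof -
  have "openin T {x \<in> W. snd c x \<in> U}" if "openin (Euclidean_space n) U" for U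
  proof -
    have "{x \<in> W. snd c x \<in> U} = W \<inter> {x \<in> fst c. snd c x \<in> U}"
      using assms(3) by auto
    then show ?thesis
      using assms(2) coord_chart_vimage [OF assms(1) that] by (simp add: openin_Int)
  qed
  then show ?thesis
    using assms inj_on_subset [OF coord_chart_inj [OF assms(1)]] coord_chart_image [OF assms(1)]
      coord_chart_in_euclid [OF assms(1)]
    by (auto simp: coord_chart_iff)
qed

text \<open>
  Smoothness in coordinates implies continuity, since charts are homeomorphisms.
\<close>

lemma chart_rep_preimage:
  assumes c: "coord_chart S m c" and d: "coord_chart T n d"
    and W: "W \<subseteq> fst c" "f ` W \<subseteq> fst d"
    and f: "smooth_between m n (snd c ` W) (snd d \<circ> f \<circ> chart_inv c)" and V: "openin T V"
  shows "openin S {x \<in> W. f x \<in> V}"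
proof -
  have "openin T (V \<inter> fst d)"
    using V coord_chart_openin [OF d] by blast
  then have "openin (Euclidean_space n) (snd d ` (V \<inter> fst d))"
    by (rule coord_chart_image [OF d]) auto
  note coord_chart_vimage [OF c openin_smooth_preimage [OF f this]]
  moreover have "{x \<in> fst c. snd c x \<in> {y \<in> snd c ` W. (snd d \<circ> f \<circ> chart_inv c) y \<in> snd d ` (V \<inter> fst d)}} =
      {x \<in> W. f x \<in> V}" (is "?A = ?B")
  proof (intro equalityI subsetI)
    fix x assume "x \<in> ?A"
    then have x: "x \<in> fst c" "snd c x \<in> snd c ` W"
        "snd d (f (chart_inv c (snd c x))) \<in> snd d ` (V \<inter> fst d)"
      by auto
    have "x \<in> W"
      using inj_on_image_mem_iff [OF coord_chart_inj [OF c] x(1) W(1)] x(2) by simp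
    moreover from this have "f x \<in> V \<inter> fst d"
      using inj_on_image_mem_iff [OF coord_chart_inj [OF d], of "f x" "V \<inter> fst d"] x(3) W(2)
      by (auto simp: chart_inv_left [OF coord_chart_inj [OF c] x(1)])
    ultimately show "x \<in> ?B" by simp
  next
    fix x assume x: "x \<in> ?B"
    then have "chart_inv c (snd c x) = x" "x \<in> fst c" "f x \<in> fst d"
      using W chart_inv_left [OF coord_chart_inj [OF c], of x] by auto
    then show "x \<in> ?A"
      using x by simp
  qed
  ultimately show ?thesis by simp
qed

lemma chart_rep_compose:
  assumes c: "inj_on (snd c) (fst c)" and d: "inj_on (snd d) (fst d)"
    and W: "W \<subseteq> fst c" "f ` W \<subseteq> V" "V \<subseteq> fst d"
    and f: "smooth_between m n (snd c ` W) (snd d \<circ> f \<circ> chart_inv c)"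
    and g: "smooth_between n p (snd d ` V) (snd e \<circ> g \<circ> chart_inv d)"
  shows "smooth_between m p (snd c ` W) (snd e \<circ> (g \<circ> f) \<circ> chart_inv c)"
proof (rule smooth_between_cong [OF smooth_between_compose [OF f g]])
  have cl: "chart_inv c (snd c x) = x" if "x \<in> W" for x
    using that W(1) by (intro chart_inv_left [OF c]) auto
  show "(snd d \<circ> f \<circ> chart_inv c) ` snd c ` W \<subseteq> snd d ` V"
    using W(2) by (auto simp: cl image_subset_iff)
  show "(snd e \<circ> g \<circ> chart_inv d \<circ> (snd d \<circ> f \<circ> chart_inv c)) y = (snd e \<circ> (g \<circ> f) \<circ> chart_inv c) y"
    if y: "y \<in> snd c ` W" for y
  proof -
    obtain x where x: "x \<in> W" "y = snd c x"
      using y by blast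
    then have "chart_inv d (snd d (f x)) = f x"
      using W by (intro chart_inv_left [OF d]) auto
    then show ?thesis
      using x cl by simp
  qed
qed

lemma chart_rep_cong:
  assumes c: "inj_on (snd c) (fst c)" and W: "W \<subseteq> fst c"
    and f: "smooth_between m n (snd c ` W) (snd d \<circ> f \<circ> chart_inv c)"
    and eq: "\<And>x. x \<in> W \<Longrightarrow> f x = g x"
  shows "smooth_between m n (snd c ` W) (snd d \<circ> g \<circ> chart_inv c)"
  by (rule smooth_between_cong [OF f]) (use W chart_inv_left [OF c] eq in auto)

lemma matlas_coord_chart: "smooth_manifold M \<Longrightarrow> c \<in> matlas M \<Longrightarrow> coord_chart (mspace M) (mdim M) c"
  by (simp add: smooth_manifold_def)

lemma charts_coord_chart: "c \<in> charts M \<Longrightarrow> coord_chart (mspace M) (mdim M) c"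
  by (simp add: charts_def)

lemma matlas_in_charts: "smooth_manifold M \<Longrightarrow> c \<in> matlas M \<Longrightarrow> c \<in> charts M"
  by (simp add: smooth_manifold_def charts_def)

lemma chart_subset_mpoints: "c \<in> charts M \<Longrightarrow> x \<in> fst c \<Longrightarrow> x \<in> mpoints M"
  using openin_subset [OF coord_chart_openin [OF charts_coord_chart]] by blast

lemma ex_matlas_chart:
  assumes "smooth_manifold M" "x \<in> mpoints M"
  obtains c where "c \<in> matlas M" "c \<in> charts M" "x \<in> fst c"
proof -
  have "\<Union> (fst ` matlas M) = mpoints M"
    using assms(1) by (simp add: smooth_manifold_def)
  then obtain c where "c \<in> matlas M" "x \<in> fst c"
    using assms(2) by blast
  then show thesis
    using that matlas_in_charts [OF assms(1)] by blast
qed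

text \<open>
  Two charts of the maximal atlas are compared through charts of the given atlas around each point.
  The transition map is written as the coordinate expression of the identity, which makes it composable
  with coordinate expressions of other maps by \<open>chart_rep_compose\<close>.
\<close>

lemma smooth_transition:
  assumes M: "smooth_manifold M" and c: "c \<in> charts M" and d: "d \<in> charts M"
    and W: "openin (mspace M) W" "W \<subseteq> fst c" "W \<subseteq> fst d"
  shows "smooth_between (mdim M) (mdim M) (snd c ` W) (snd d \<circ> (\<lambda>x. x) \<circ> chart_inv c)"
proof (rule smooth_between_locally)
  note cc = charts_coord_chart [OF c]
  fix y assume "y \<in> snd c ` W"
  then obtain x where x: "x \<in> W" "y = snd c x"
    by auto
  have "x \<in> mpoints M"
    by (rule chart_subset_mpoints [OF c]) (use x W in auto)
  then obtain e where e: "e \<in> matlas M" "e \<in> charts M" "x \<in> fst e"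
    by (rule ex_matlas_chart [OF M])
  note ee = charts_coord_chart [OF e(2)]
  define V where "V = W \<inter> fst e"
  have V: "openin (mspace M) V" "V \<subseteq> fst c" "V \<subseteq> fst d" "V \<subseteq> fst e"
    using W coord_chart_openin [OF ee] by (auto simp: V_def)
  have comp: "compatible (mdim M) c e" "compatible (mdim M) d e"
    using c d e(1) by (auto simp: charts_def)
  have "smooth_between (mdim M) (mdim M) (snd c ` V) (snd e \<circ> (\<lambda>x. x) \<circ> chart_inv c)"
    by (rule smooth_between_subset [OF _ coord_chart_image [OF cc V(1,2)], where U = "snd c ` (fst c \<inter> fst e)"])
      (use comp(1) V in \<open>auto simp: compatible_def transition_def o_def\<close>)
  moreover have "smooth_between (mdim M) (mdim M) (snd e ` V) (snd d \<circ> (\<lambda>x. x) \<circ> chart_inv e)"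
    by (rule smooth_between_subset [OF _ coord_chart_image [OF ee V(1,4)], where U = "snd e ` (fst d \<inter> fst e)"])
      (use comp(2) V in \<open>auto simp: compatible_def transition_def o_def\<close>)
  ultimately have "smooth_between (mdim M) (mdim M) (snd c ` V) (snd d \<circ> ((\<lambda>x. x) \<circ> (\<lambda>x. x)) \<circ> chart_inv c)"
    by (intro chart_rep_compose [where d = e and V = V] coord_chart_inj [OF cc] coord_chart_inj [OF ee])
      (use V in auto)
  then have "smooth_between (mdim M) (mdim M) (snd c ` V) (snd d \<circ> (\<lambda>x. x) \<circ> chart_inv c)"
    by (simp add: o_def)
  then show "\<exists>V. y \<in> V \<and> V \<subseteq> snd c ` W \<and>
      smooth_between (mdim M) (mdim M) V (snd d \<circ> (\<lambda>x. x) \<circ> chart_inv c)"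
    using x e(3) by (intro exI [of _ "snd c ` V"]) (auto simp: V_def)
qed

lemma charts_compatible:
  assumes "smooth_manifold M" "c \<in> charts M" "d \<in> charts M"
  shows "compatible (mdim M) c d"
proof -
  have "openin (mspace M) (fst c \<inter> fst d)"
    by (intro openin_Int coord_chart_openin [OF charts_coord_chart [OF assms(2)]]
        coord_chart_openin [OF charts_coord_chart [OF assms(3)]])
  then show ?thesis
    using smooth_transition [OF assms(1,2,3), of "fst c \<inter> fst d"]
      smooth_transition [OF assms(1,3,2), of "fst c \<inter> fst d"]
    by (simp add: compatible_def transition_def o_def)
qed

lemma charts_restrict:
  assumes M: "smooth_manifold M" and c: "c \<in> charts M" and W: "openin (mspace M) W" "W \<subseteq> fst c"
  shows "(W, snd c) \<in> charts M"
proof -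
  have "compatible (mdim M) (W, snd c) d" if "d \<in> matlas M" for d
  proof -
    have d: "d \<in> charts M"
      using matlas_in_charts [OF M that] .
    have O: "openin (mspace M) (W \<inter> fst d)"
      using W coord_chart_openin [OF charts_coord_chart [OF d]] by blast
    have inj: "inj_on (snd c) (fst c)"
      by (rule coord_chart_inj [OF charts_coord_chart [OF c]])
    have sub: "W \<inter> fst d \<subseteq> fst c" "W \<inter> fst d \<subseteq> fst d"
      using W by auto
    have "smooth_between (mdim M) (mdim M) (snd c ` (W \<inter> fst d)) (transition (W, snd c) d)"
    proof (rule smooth_between_cong [OF smooth_transition [OF M c d O sub]])
      fix y assume "y \<in> snd c ` (W \<inter> fst d)"
      then have "chart_inv (W, snd c) y = chart_inv c y"
        by (intro chart_inv_restrict [OF inj W(2)]) auto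
      then show "(snd d \<circ> (\<lambda>x. x) \<circ> chart_inv c) y = transition (W, snd c) d y"
        by (simp add: transition_def)
    qed
    moreover have "smooth_between (mdim M) (mdim M) (snd d ` (W \<inter> fst d)) (transition d (W, snd c))"
      using smooth_transition [OF M d c O sub(2,1)] by (simp add: transition_def o_def)
    ultimately show ?thesis
      unfolding compatible_def fst_conv snd_conv by (rule conjI)
  qed
  then show ?thesis
    using coord_chart_restrict [OF charts_coord_chart [OF c] W] unfolding charts_def by blast
qed

text \<open>
  A pointwise notion of smoothness, witnessed by a single pair of charts. It is convenient for maps that are
  defined only near a point, such as local sections, and it reduces all smoothness proofs for
  manifolds to composition. By \<open>smooth_at_charts\<close> the choice of the charts does not matter.
\<close>

definition smooth_at :: "'a manifold \<Rightarrow> 'b manifold \<Rightarrow> ('a \<Rightarrow> 'b) \<Rightarrow> 'a \<Rightarrow> bool" where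
  "smooth_at M N f x \<longleftrightarrow> (\<exists>c\<in>charts M. \<exists>d\<in>charts N. \<exists>W. openin (mspace M) W \<and> x \<in> W \<and>
     W \<subseteq> fst c \<and> f ` W \<subseteq> fst d \<and>
     smooth_between (mdim M) (mdim N) (snd c ` W) (snd d \<circ> f \<circ> chart_inv c))"

lemma smooth_atI:
  assumes "c \<in> charts M" "d \<in> charts N" "openin (mspace M) W" "x \<in> W" "W \<subseteq> fst c" "f ` W \<subseteq> fst d"
    "smooth_between (mdim M) (mdim N) (snd c ` W) (snd d \<circ> f \<circ> chart_inv c)"
  shows "smooth_at M N f x"
  unfolding smooth_at_def using assms by (intro bexI [of _ c] bexI [of _ d] exI [of _ W]) simp_all

lemma smooth_atE:
  assumes "smooth_at M N f x"
  obtains c d W where "c \<in> charts M" "d \<in> charts N" "openin (mspace M) W" "x \<in> W" "W \<subseteq> fst c"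
    "f ` W \<subseteq> fst d" "smooth_between (mdim M) (mdim N) (snd c ` W) (snd d \<circ> f \<circ> chart_inv c)"
  using assms unfolding smooth_at_def by (elim bexE exE conjE) (rule that)

lemma smooth_at_in_mpoints:
  assumes "smooth_at M N f x"
  shows "x \<in> mpoints M" "f x \<in> mpoints N"
proof -
  obtain c d W where "c \<in> charts M" "d \<in> charts N" "x \<in> W" "W \<subseteq> fst c" "f ` W \<subseteq> fst d"
    using assms by (rule smooth_atE)
  then show "x \<in> mpoints M" "f x \<in> mpoints N"
    by (auto intro!: chart_subset_mpoints)
qed

text \<open>
  Coordinate expressions in other charts differ by transition maps. The neighbourhood can be shrunk into
  any \<open>U\<close> whose image lies in any prescribed neighbourhood \<open>V\<close>.
\<close>

lemma smooth_at_charts: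
  assumes M: "smooth_manifold M" and N: "smooth_manifold N" and f: "smooth_at M N f x"
    and c: "c \<in> charts M" "x \<in> fst c" and d: "d \<in> charts N" "f x \<in> fst d"
    and U: "openin (mspace M) U" "x \<in> U" and V: "openin (mspace N) V" "f x \<in> V"
  obtains W where "openin (mspace M) W" "x \<in> W" "W \<subseteq> fst c" "f ` W \<subseteq> fst d" "W \<subseteq> U" "f ` W \<subseteq> V"
    "smooth_between (mdim M) (mdim N) (snd c ` W) (snd d \<circ> f \<circ> chart_inv c)"
proof -
  obtain c' d' W' where c': "c' \<in> charts M" and d': "d' \<in> charts N"
    and W': "openin (mspace M) W'" "x \<in> W'" "W' \<subseteq> fst c'" "f ` W' \<subseteq> fst d'"
    and s: "smooth_between (mdim M) (mdim N) (snd c' ` W') (snd d' \<circ> f \<circ> chart_inv c')"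
    using f by (rule smooth_atE)
  note cc = charts_coord_chart [OF c(1)] and cc' = charts_coord_chart [OF c']
    and dd = charts_coord_chart [OF d(1)] and dd' = charts_coord_chart [OF d']
  have V': "openin (mspace N) (V \<inter> fst d)"
    using V coord_chart_openin [OF dd] by blast
  define W where "W = {z \<in> W'. f z \<in> V \<inter> fst d} \<inter> fst c \<inter> U"
  have W: "openin (mspace M) W" "x \<in> W" "W \<subseteq> fst c" "W \<subseteq> fst c'" "f ` W \<subseteq> fst d" "f ` W \<subseteq> fst d'"
    using chart_rep_preimage [OF cc' dd' W'(3,4) s V'] coord_chart_openin [OF cc] U W' V c d
    by (auto simp: W_def)
  have V'': "openin (mspace N) (fst d \<inter> fst d')"
    by (intro openin_Int coord_chart_openin [OF dd] coord_chart_openin [OF dd'])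
  have 1: "smooth_between (mdim M) (mdim N) (snd c' ` W) (snd d' \<circ> f \<circ> chart_inv c')"
    by (rule smooth_between_subset [OF s coord_chart_image [OF cc' W(1,4)]]) (auto simp: W_def)
  have 2: "smooth_between (mdim M) (mdim N) (snd c ` W) (snd d' \<circ> (f \<circ> (\<lambda>x. x)) \<circ> chart_inv c)"
    by (rule chart_rep_compose [OF coord_chart_inj [OF cc] coord_chart_inj [OF cc'] W(3) _ W(4)
          smooth_transition [OF M c(1) c' W(1,3,4)] 1]) auto
  have 3: "smooth_between (mdim N) (mdim N) (snd d' ` (fst d \<inter> fst d')) (snd d \<circ> (\<lambda>x. x) \<circ> chart_inv d')"
    by (rule smooth_transition [OF N d' d(1) V'']) auto
  have "smooth_between (mdim M) (mdim N) (snd c ` W)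
      (snd d \<circ> ((\<lambda>x. x) \<circ> (f \<circ> (\<lambda>x. x))) \<circ> chart_inv c)"
    by (rule chart_rep_compose [OF coord_chart_inj [OF cc] coord_chart_inj [OF dd'] W(3) _ _ 2 3])
      (use W in auto)
  then have "smooth_between (mdim M) (mdim N) (snd c ` W) (snd d \<circ> f \<circ> chart_inv c)"
    by (simp add: o_def)
  then show thesis
    using that W by (auto simp: W_def)
qed

lemma smooth_at_compose:
  assumes M: "smooth_manifold M" and N: "smooth_manifold N"
    and f: "smooth_at M N f x" and g: "smooth_at N K g (f x)"
  shows "smooth_at M K (g \<circ> f) x"
proof -
  obtain d e V where d: "d \<in> charts N" "e \<in> charts K"
    and V: "openin (mspace N) V" "f x \<in> V" "V \<subseteq> fst d" "g ` V \<subseteq> fst e"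
    and g': "smooth_between (mdim N) (mdim K) (snd d ` V) (snd e \<circ> g \<circ> chart_inv d)"
    using g by (rule smooth_atE)
  obtain c where c: "c \<in> charts M" "x \<in> fst c"
    using ex_matlas_chart [OF M smooth_at_in_mpoints(1) [OF f]] by metis
  have top: "openin (mspace M) (mpoints M)" "x \<in> mpoints M"
    using smooth_at_in_mpoints(1) [OF f] by auto
  have fd: "f x \<in> fst d"
    using V by blast
  obtain W where W: "openin (mspace M) W" "x \<in> W" "W \<subseteq> fst c" "f ` W \<subseteq> V"
    and f': "smooth_between (mdim M) (mdim N) (snd c ` W) (snd d \<circ> f \<circ> chart_inv c)"
    by (rule smooth_at_charts [OF M N f c d(1) fd top V(1,2)], rule that)
  show ?thesis
  proof (rule smooth_atI [OF c(1) d(2) W(1-3)])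
    show "smooth_between (mdim M) (mdim K) (snd c ` W) (snd e \<circ> (g \<circ> f) \<circ> chart_inv c)"
      by (rule chart_rep_compose [OF _ _ W(3,4) V(3) f' g'])
        (auto intro: coord_chart_inj charts_coord_chart c d)
    show "(g \<circ> f) ` W \<subseteq> fst e"
      using W(4) V(4) by (simp add: image_subset_iff)
  qed
qed

lemma smooth_at_cong:
  assumes f: "smooth_at M N f x" and U: "openin (mspace M) U" "x \<in> U"
    and eq: "\<And>z. z \<in> U \<Longrightarrow> f z = g z"
  shows "smooth_at M N g x"
proof -
  obtain c d W where c: "c \<in> charts M" "d \<in> charts N" and W: "openin (mspace M) W" "x \<in> W" "W \<subseteq> fst c"
    "f ` W \<subseteq> fst d" and s: "smooth_between (mdim M) (mdim N) (snd c ` W) (snd d \<circ> f \<circ> chart_inv c)"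
    using f by (rule smooth_atE)
  have O: "openin (mspace M) (W \<inter> U)" "x \<in> W \<inter> U" "W \<inter> U \<subseteq> fst c"
    using W U by auto
  note cc = charts_coord_chart [OF c(1)]
  show ?thesis
  proof (rule smooth_atI [OF c O])
    show "g ` (W \<inter> U) \<subseteq> fst d"
      using W(4) eq by force
    have "smooth_between (mdim M) (mdim N) (snd c ` (W \<inter> U)) (snd d \<circ> f \<circ> chart_inv c)"
      by (rule smooth_between_subset [OF s coord_chart_image [OF cc O(1,3)]]) auto
    then show "smooth_between (mdim M) (mdim N) (snd c ` (W \<inter> U)) (snd d \<circ> g \<circ> chart_inv c)"
      by (rule chart_rep_cong [OF coord_chart_inj [OF cc] O(3)]) (use eq in auto)
  qed
qed

lemma smooth_at_preimage:
  assumes "smooth_at M N f x" "openin (mspace N) V" "f x \<in> V"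
  obtains W where "openin (mspace M) W" "x \<in> W" "f ` W \<subseteq> V"
proof -
  obtain c d W where c: "c \<in> charts M" "d \<in> charts N" and W: "openin (mspace M) W" "x \<in> W" "W \<subseteq> fst c"
    "f ` W \<subseteq> fst d" and s: "smooth_between (mdim M) (mdim N) (snd c ` W) (snd d \<circ> f \<circ> chart_inv c)"
    using assms(1) by (rule smooth_atE)
  show thesis
    by (rule that [OF chart_rep_preimage [OF charts_coord_chart [OF c(1)] charts_coord_chart [OF c(2)]
            W(3,4) s assms(2)]]) (use W assms(3) in auto)
qed

lemma smooth_map_imp_smooth_at:
  assumes M: "smooth_manifold M" and N: "smooth_manifold N" and f: "smooth_map M N f"
    and x: "x \<in> mpoints M"
  shows "smooth_at M N f x"
proof -
  have cont: "continuous_map (mspace M) (mspace N) f"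
    using f by (simp add: smooth_map_def)
  then have "f x \<in> mpoints N"
    using x by (auto simp: continuous_map_def)
  then obtain d where d: "d \<in> matlas N" "d \<in> charts N" "f x \<in> fst d"
    by (rule ex_matlas_chart [OF N])
  obtain c where c: "c \<in> matlas M" "c \<in> charts M" "x \<in> fst c"
    by (rule ex_matlas_chart [OF M x])
  have "{z \<in> fst c. f z \<in> fst d} = fst c \<inter> {z \<in> mpoints M. f z \<in> fst d}"
    using chart_subset_mpoints [OF c(2)] by auto
  then have W: "openin (mspace M) {z \<in> fst c. f z \<in> fst d}"
    using openin_continuous_map_preimage [OF cont coord_chart_openin [OF charts_coord_chart [OF d(2)]]]
      coord_chart_openin [OF charts_coord_chart [OF c(2)]] by (simp add: openin_Int)
  show ?thesis
    by (rule smooth_atI [OF c(2) d(2) W]) (use c d f in \<open>auto simp: smooth_map_def\<close>)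
qed

lemma smooth_mapI:
  assumes M: "smooth_manifold M" and N: "smooth_manifold N"
    and f: "\<And>x. x \<in> mpoints M \<Longrightarrow> smooth_at M N f x"
  shows "smooth_map M N f"
  unfolding smooth_map_def
proof (intro conjI ballI)
  show "continuous_map (mspace M) (mspace N) f"
    unfolding continuous_map
  proof (intro conjI allI impI)
    show "f ` mpoints M \<subseteq> mpoints N"
      using smooth_at_in_mpoints(2) [OF f] by auto
    fix V assume V: "openin (mspace N) V"
    show "openin (mspace M) {x \<in> mpoints M. f x \<in> V}"
      unfolding openin_subopen [of "mspace M" "{x \<in> mpoints M. f x \<in> V}"]
    proof
      fix x assume "x \<in> {x \<in> mpoints M. f x \<in> V}"
      then obtain W where W: "openin (mspace M) W" "x \<in> W" "f ` W \<subseteq> V"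
        using smooth_at_preimage [OF f V, of x] by auto
      then show "\<exists>T. openin (mspace M) T \<and> x \<in> T \<and> T \<subseteq> {x \<in> mpoints M. f x \<in> V}"
        using openin_subset [OF W(1)] by blast
    qed
  qed
  fix c d assume "c \<in> matlas M" "d \<in> matlas N"
  then have c: "c \<in> charts M" and d: "d \<in> charts N"
    by (simp_all add: matlas_in_charts M N)
  show "smooth_between (mdim M) (mdim N) (snd c ` {x \<in> fst c. f x \<in> fst d}) (snd d \<circ> f \<circ> chart_inv c)"
  proof (rule smooth_between_locally)
    fix y assume "y \<in> snd c ` {x \<in> fst c. f x \<in> fst d}"
    then obtain x where x: "x \<in> fst c" "f x \<in> fst d" "y = snd c x"
      by auto
    note fx = f [OF chart_subset_mpoints [OF c x(1)]]
    obtain W where W: "openin (mspace M) W" "x \<in> W" "W \<subseteq> fst c" "f ` W \<subseteq> fst d"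
      and s: "smooth_between (mdim M) (mdim N) (snd c ` W) (snd d \<circ> f \<circ> chart_inv c)"
      by (rule smooth_at_charts [OF M N fx c x(1) d x(2) openin_topspace smooth_at_in_mpoints(1) [OF fx]
            openin_topspace smooth_at_in_mpoints(2) [OF fx]], rule that)
    show "\<exists>V. y \<in> V \<and> V \<subseteq> snd c ` {x \<in> fst c. f x \<in> fst d} \<and>
        smooth_between (mdim M) (mdim N) V (snd d \<circ> f \<circ> chart_inv c)"
      using W x s by (intro exI [of _ "snd c ` W"]) auto
  qed
qed

lemma smooth_at_id: 
  assumes "smooth_manifold M" "x \<in> mpoints M"
  shows "smooth_at M M (\<lambda>x. x) x"
proof -
  obtain c where c: "c \<in> charts M" "x \<in> fst c"
    using ex_matlas_chart [OF assms] by metis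
  note O = coord_chart_openin [OF charts_coord_chart [OF c(1)]]
  have s: "smooth_between (mdim M) (mdim M) (snd c ` fst c) (snd c \<circ> (\<lambda>x. x) \<circ> chart_inv c)"
    by (rule smooth_transition [OF assms(1) c(1,1) O]) auto
  show ?thesis
    by (rule smooth_atI [where W = "fst c", OF c(1,1) O c(2) _ _ s]) auto
qed

lemma smooth_at_const:
  assumes "smooth_manifold M" "smooth_manifold N" "x \<in> mpoints M" "y \<in> mpoints N"
  shows "smooth_at M N (\<lambda>_. y) x"
proof -
  obtain c where c: "c \<in> charts M" "x \<in> fst c"
    using ex_matlas_chart [OF assms(1,3)] by metis
  obtain d where d: "d \<in> charts N" "y \<in> fst d"
    using ex_matlas_chart [OF assms(2,4)] by metis
  note cc = charts_coord_chart [OF c(1)] and dd = charts_coord_chart [OF d(1)]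
  have "smooth_between (mdim M) (mdim N) (snd c ` fst c) (\<lambda>_. snd d y)"
    by (intro smooth_between_const coord_chart_image [OF cc coord_chart_openin [OF cc]]
        coord_chart_in_euclid [OF dd d(2)]) simp
  then have s: "smooth_between (mdim M) (mdim N) (snd c ` fst c) (snd d \<circ> (\<lambda>_. y) \<circ> chart_inv c)"
    by (simp add: o_def)
  show ?thesis
    by (rule smooth_atI [where W = "fst c", OF c(1) d(1) coord_chart_openin [OF cc] c(2) _ _ s])
      (use d in auto)
qed

section \<open>Products\<close>

definition take_vec :: "nat \<Rightarrow> rvec \<Rightarrow> rvec" where
  "take_vec n z = (\<lambda>i. if i < n then z i else 0)"

definition drop_vec :: "nat \<Rightarrow> rvec \<Rightarrow> rvec" where
  "drop_vec n z = (\<lambda>i. z (i + n))"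

lemma append_vec_in_euclid: "y \<in> euclid n \<Longrightarrow> append_vec m x y \<in> euclid (m + n)"
  and take_vec_in_euclid: "take_vec m z \<in> euclid m"
  and drop_vec_in_euclid: "z \<in> euclid (m + n) \<Longrightarrow> drop_vec m z \<in> euclid n"
  and append_take_drop_vec: "append_vec m (take_vec m z) (drop_vec m z) = z"
  and take_append_vec: "x \<in> euclid m \<Longrightarrow> take_vec m (append_vec m x y) = x"
  and drop_append_vec: "drop_vec m (append_vec m x y) = y"
  by (auto simp: append_vec_def take_vec_def drop_vec_def in_euclid)

lemma smooth_between_take_vec:
  "openin (Euclidean_space n) U \<Longrightarrow> smooth_between n m U (take_vec m)"
  by (intro smooth_betweenI take_vec_in_euclid) (simp_all add: take_vec_def smooth_fn_coordinate)

lemma smooth_between_drop_vec: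
  assumes "openin (Euclidean_space (m + n)) U"
  shows "smooth_between (m + n) n U (drop_vec m)"
  using openin_subset_euclid [OF assms]
  by (intro smooth_betweenI drop_vec_in_euclid assms) (simp_all add: drop_vec_def smooth_fn_coordinate assms)

lemma smooth_between_append_vec:
  assumes "smooth_between k m U f" "smooth_between k n U g"
  shows "smooth_between k (m + n) U (\<lambda>x. append_vec m (f x) (g x))"
proof (rule smooth_betweenI)
  show "openin (Euclidean_space k) U"
    by (rule smooth_between_openin [OF assms(1)])
  show "append_vec m (f x) (g x) \<in> euclid (m + n)" if "x \<in> U" for x
    by (rule append_vec_in_euclid [OF smooth_between_in_euclid [OF assms(2) that]])
  show "smooth_fn k U (\<lambda>x. append_vec m (f x) (g x) j)" for j
    using smooth_between_component [OF assms(1), of j] smooth_between_component [OF assms(2), of "j - m"]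
    by (cases "j < m") (simp_all add: append_vec_def)
qed

lemma openin_append_vec:
  assumes "openin (Euclidean_space m) U" "openin (Euclidean_space n) V"
  shows "openin (Euclidean_space (m + n)) {append_vec m x y | x y. x \<in> U \<and> y \<in> V}"
proof -
  let ?E = "euclid (m + n)"
  have E: "openin (Euclidean_space (m + n)) ?E" by simp
  note U = openin_smooth_preimage [OF smooth_between_take_vec [OF E] assms(1)]
  have "openin (Euclidean_space (m + n)) {z \<in> {z \<in> ?E. take_vec m z \<in> U}. drop_vec m z \<in> V}"
    by (rule openin_smooth_preimage [OF smooth_between_drop_vec [OF U] assms(2)])
  moreover have "{z \<in> {z \<in> ?E. take_vec m z \<in> U}. drop_vec m z \<in> V} =
      {append_vec m x y | x y. x \<in> U \<and> y \<in> V}" (is "?A = ?B")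
  proof (intro equalityI subsetI)
    fix z assume "z \<in> ?A"
    then show "z \<in> ?B"
      using append_take_drop_vec [of m z] by auto metis
  next
    fix z assume "z \<in> ?B"
    then obtain x y where "z = append_vec m x y" "x \<in> U" "y \<in> V" by blast
    then show "z \<in> ?A"
      using openin_subset_euclid [OF assms(1)] openin_subset_euclid [OF assms(2)]
      by (simp add: append_vec_in_euclid take_append_vec drop_append_vec)
  qed
  ultimately show ?thesis by simp
qed

definition prod_chart :: "nat \<Rightarrow> 'a chart \<Rightarrow> 'b chart \<Rightarrow> ('a \<times> 'b) chart" where
  "prod_chart m c d = (fst c \<times> fst d, \<lambda>(x, y). append_vec m (snd c x) (snd d y))"

lemma fst_prod_chart: "fst (prod_chart m c d) = fst c \<times> fst d"
  and snd_prod_chart: "snd (prod_chart m c d) (x, y) = append_vec m (snd c x) (snd d y)"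
  by (simp_all add: prod_chart_def)

lemma prod_chart_image_Times:
  "snd (prod_chart m c d) ` (U \<times> V) = {append_vec m x y | x y. x \<in> snd c ` U \<and> y \<in> snd d ` V}"
  by (force simp: prod_chart_def)

lemma coord_chart_prod_chart:
  assumes c: "coord_chart S m c" and d: "coord_chart T n d"
  shows "coord_chart (prod_topology S T) (m + n) (prod_chart m c d)"
  unfolding coord_chart_iff
proof (intro conjI allI impI)
  show "openin (prod_topology S T) (fst (prod_chart m c d))"
    using coord_chart_openin [OF c] coord_chart_openin [OF d]
    by (simp add: fst_prod_chart openin_prod_Times_iff)
  show "inj_on (snd (prod_chart m c d)) (fst (prod_chart m c d))"
  proof (rule inj_onI)
    fix z z' assume z: "z \<in> fst (prod_chart m c d)" and z': "z' \<in> fst (prod_chart m c d)"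
      and eq: "snd (prod_chart m c d) z = snd (prod_chart m c d) z'"
    obtain x y x' y' where xy: "z = (x, y)" "z' = (x', y')"
      by fastforce
    then have m: "x \<in> fst c" "x' \<in> fst c" "y \<in> fst d" "y' \<in> fst d"
      using z z' by (auto simp: fst_prod_chart)
    have e: "append_vec m (snd c x) (snd d y) = append_vec m (snd c x') (snd d y')"
      using eq by (simp add: xy snd_prod_chart)
    have "snd c x = snd c x'"
      using arg_cong [OF e, of "take_vec m"] take_append_vec coord_chart_in_euclid [OF c] m(1,2) by metis
    moreover have "snd d y = snd d y'"
      using arg_cong [OF e, of "drop_vec m"] drop_append_vec by metis
    ultimately show "z = z'"
      using inj_onD [OF coord_chart_inj [OF c] _ m(1,2)] inj_onD [OF coord_chart_inj [OF d] _ m(3,4)] xy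
      by simp
  qed
  show "snd (prod_chart m c d) ` fst (prod_chart m c d) \<subseteq> euclid (m + n)"
    using coord_chart_in_euclid [OF d]
    by (auto simp: prod_chart_def intro!: append_vec_in_euclid)
  show "openin (prod_topology S T) {z \<in> fst (prod_chart m c d). snd (prod_chart m c d) z \<in> U}"
    if U: "openin (Euclidean_space (m + n)) U" for U
    unfolding openin_prod_topology_alt
  proof (intro allI impI)
    fix x y assume "(x, y) \<in> {z \<in> fst (prod_chart m c d). snd (prod_chart m c d) z \<in> U}"
    then have xy: "x \<in> fst c" "y \<in> fst d" "append_vec m (snd c x) (snd d y) \<in> U"
      by (auto simp: prod_chart_def)
    obtain e where e: "e > 0" "\<And>z. z \<in> euclid (m + n) \<Longrightarrow>
        (\<forall>i<m + n. \<bar>z i - append_vec m (snd c x) (snd d y) i\<bar> < e) \<Longrightarrow> z \<in> U"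
      by (rule openin_EuclideanE [OF U xy(3)], rule that)
    define A where "A = {x' \<in> fst c. snd c x' \<in> {v. \<forall>i<m. \<bar>v i - snd c x i\<bar> < e} \<inter> euclid m}"
    define B where "B = {y' \<in> fst d. snd d y' \<in> {v. \<forall>i<n. \<bar>v i - snd d y i\<bar> < e} \<inter> euclid n}"
    have A: "openin S A"
      unfolding A_def by (rule coord_chart_vimage [OF c])
        (use open_Collect_coordinates in \<open>auto simp: openin_Euclidean_open\<close>)
    have B: "openin T B"
      unfolding B_def by (rule coord_chart_vimage [OF d])
        (use open_Collect_coordinates in \<open>auto simp: openin_Euclidean_open\<close>)
    have xyAB: "x \<in> A" "y \<in> B"
      using xy e(1) coord_chart_in_euclid [OF c] coord_chart_in_euclid [OF d] by (auto simp: A_def B_def)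
    have "append_vec m (snd c x') (snd d y') \<in> U" if "x' \<in> A" "y' \<in> B" for x' y'
      using that by (intro e(2)) (auto simp: A_def B_def append_vec_def in_euclid)
    then have "A \<times> B \<subseteq> {z \<in> fst (prod_chart m c d). snd (prod_chart m c d) z \<in> U}"
      by (auto simp: prod_chart_def A_def B_def)
    then show "\<exists>A B. openin S A \<and> openin T B \<and> x \<in> A \<and> y \<in> B \<and>
        A \<times> B \<subseteq> {z \<in> fst (prod_chart m c d). snd (prod_chart m c d) z \<in> U}"
      using A B xyAB by (intro exI [of _ A] exI [of _ B]) simp
  qed
  show "openin (Euclidean_space (m + n)) (snd (prod_chart m c d) ` W)"
    if W: "openin (prod_topology S T) W \<and> W \<subseteq> fst (prod_chart m c d)" for W
    unfolding openin_subopen [of _ "snd (prod_chart m c d) ` W"]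
  proof
    fix z assume "z \<in> snd (prod_chart m c d) ` W"
    then obtain x y where xy: "(x, y) \<in> W" "z = snd (prod_chart m c d) (x, y)"
      by auto
    then obtain U V where UV: "openin S U" "openin T V" "x \<in> U" "y \<in> V" "U \<times> V \<subseteq> W"
      using W unfolding openin_prod_topology_alt by meson
    have sub: "U \<subseteq> fst c" "V \<subseteq> fst d"
      using UV W by (auto simp: fst_prod_chart)
    have "openin (Euclidean_space (m + n)) (snd (prod_chart m c d) ` (U \<times> V))"
      unfolding prod_chart_image_Times
      by (rule openin_append_vec [OF coord_chart_image [OF c UV(1) sub(1)] coord_chart_image [OF d UV(2) sub(2)]])
    then show "\<exists>O'. openin (Euclidean_space (m + n)) O' \<and> z \<in> O' \<and> O' \<subseteq> snd (prod_chart m c d) ` W"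
      using UV xy by (intro exI [of _ "snd (prod_chart m c d) ` (U \<times> V)"]) auto
  qed
qed

lemma chart_inv_prod_chart:
  assumes c: "coord_chart S m c" and d: "coord_chart T n d" and xy: "x \<in> fst c" "y \<in> fst d"
  shows "chart_inv (prod_chart m c d) (append_vec m (snd c x) (snd d y)) = (x, y)"
  using chart_inv_left [OF coord_chart_inj [OF coord_chart_prod_chart [OF c d]], of "(x, y)"] xy
  by (simp add: prod_chart_def)

text \<open>
  In product coordinates a product map acts on the two blocks of coordinates separately.
\<close>

lemma chart_rep_map_prod:
  assumes c: "coord_chart S m c" and d: "coord_chart T n d"
    and U: "U \<subseteq> fst c" "openin S U" and V: "V \<subseteq> fst d" "openin T V"
    and f: "smooth_between m m' (snd c ` U) (snd c' \<circ> f \<circ> chart_inv c)"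
    and g: "smooth_between n n' (snd d ` V) (snd d' \<circ> g \<circ> chart_inv d)"
  shows "smooth_between (m + n) (m' + n') (snd (prod_chart m c d) ` (U \<times> V))
    (snd (prod_chart m' c' d') \<circ> map_prod f g \<circ> chart_inv (prod_chart m c d))"
proof (rule smooth_between_cong)
  let ?O = "snd (prod_chart m c d) ` (U \<times> V)"
  have O: "openin (Euclidean_space (m + n)) ?O"
    unfolding prod_chart_image_Times
    by (rule openin_append_vec [OF smooth_between_openin [OF f] smooth_between_openin [OF g]])
  have take: "take_vec m z \<in> snd c ` U" and drop: "drop_vec m z \<in> snd d ` V" if "z \<in> ?O" for z
    using that U V coord_chart_in_euclid [OF c] unfolding prod_chart_image_Times
    by (auto simp: take_append_vec drop_append_vec subset_iff)
  show "smooth_between (m + n) (m' + n') ?O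
    (\<lambda>z. append_vec m' (((snd c' \<circ> f \<circ> chart_inv c) \<circ> take_vec m) z)
      (((snd d' \<circ> g \<circ> chart_inv d) \<circ> drop_vec m) z))"
    by (intro smooth_between_append_vec smooth_between_compose [OF smooth_between_take_vec [OF O] f]
        smooth_between_compose [OF smooth_between_drop_vec [OF O] g]) (use take drop in auto)
  fix z assume "z \<in> ?O"
  then obtain x y where xy: "x \<in> U" "y \<in> V" "z = append_vec m (snd c x) (snd d y)"
    unfolding prod_chart_image_Times by blast
  then have xy': "x \<in> fst c" "y \<in> fst d"
    using U V by auto
  show "append_vec m' (((snd c' \<circ> f \<circ> chart_inv c) \<circ> take_vec m) z)
      (((snd d' \<circ> g \<circ> chart_inv d) \<circ> drop_vec m) z) =
    (snd (prod_chart m' c' d') \<circ> map_prod f g \<circ> chart_inv (prod_chart m c d)) z"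
    using chart_inv_left [OF coord_chart_inj [OF c] xy'(1)] chart_inv_left [OF coord_chart_inj [OF d] xy'(2)]
      take_append_vec [OF coord_chart_in_euclid [OF c xy'(1)]] chart_inv_prod_chart [OF c d xy']
    by (simp add: xy(3) drop_append_vec snd_prod_chart)
qed

lemma mspace_product: "mspace (product_manifold M N) = prod_topology (mspace M) (mspace N)"
  and mdim_product: "mdim (product_manifold M N) = mdim M + mdim N"
  and matlas_product: "matlas (product_manifold M N) =
    {prod_chart (mdim M) c d | c d. c \<in> matlas M \<and> d \<in> matlas N}"
  by (simp_all add: product_manifold_def prod_chart_def)

lemma prod_charts_compatible:
  assumes M: "smooth_manifold M" and N: "smooth_manifold N"
    and c: "c \<in> charts M" "c' \<in> charts M" and d: "d \<in> charts N" "d' \<in> charts N"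
  shows "compatible (mdim M + mdim N) (prod_chart (mdim M) c d) (prod_chart (mdim M) c' d')"
proof -
  have half: "smooth_between (mdim M + mdim N) (mdim M + mdim N)
      (snd (prod_chart (mdim M) c d) ` (fst (prod_chart (mdim M) c d) \<inter> fst (prod_chart (mdim M) c' d')))
      (transition (prod_chart (mdim M) c d) (prod_chart (mdim M) c' d'))"
    if c: "c \<in> charts M" "c' \<in> charts M" and d: "d \<in> charts N" "d' \<in> charts N" for c c' d d'
  proof -
    have U: "openin (mspace M) (fst c \<inter> fst c')"
      by (intro openin_Int coord_chart_openin [OF charts_coord_chart [OF c(1)]]
          coord_chart_openin [OF charts_coord_chart [OF c(2)]])
    have V: "openin (mspace N) (fst d \<inter> fst d')"
      by (intro openin_Int coord_chart_openin [OF charts_coord_chart [OF d(1)]]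
          coord_chart_openin [OF charts_coord_chart [OF d(2)]])
    show ?thesis
      using chart_rep_map_prod [OF charts_coord_chart [OF c(1)] charts_coord_chart [OF d(1)] _ U _ V
          smooth_transition [OF M c U] smooth_transition [OF N d V]]
      by (simp add: fst_prod_chart Times_Int_Times transition_def o_def map_prod_def case_prod_beta')
  qed
  show ?thesis
    unfolding compatible_def using half [OF c d] half [OF c(2,1) d(2,1)] by (simp add: Int_commute)
qed

lemma second_countable_prod_topology:
  assumes "second_countable S" "second_countable T"
  shows "second_countable (prod_topology S T)"
proof -
  obtain A where A: "countable A" "\<And>V. V \<in> A \<Longrightarrow> openin S V"
      "\<And>U x. openin S U \<Longrightarrow> x \<in> U \<Longrightarrow> \<exists>V\<in>A. x \<in> V \<and> V \<subseteq> U"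
    using assms(1) unfolding second_countable_def by metis
  obtain B where B: "countable B" "\<And>V. V \<in> B \<Longrightarrow> openin T V"
      "\<And>U x. openin T U \<Longrightarrow> x \<in> U \<Longrightarrow> \<exists>V\<in>B. x \<in> V \<and> V \<subseteq> U"
    using assms(2) unfolding second_countable_def by metis
  show ?thesis
    unfolding second_countable_def
  proof (intro exI [of _ "(\<lambda>(U, V). U \<times> V) ` (A \<times> B)"] conjI allI impI ballI)
    show "countable ((\<lambda>(U, V). U \<times> V) ` (A \<times> B))"
      using A(1) B(1) by blast
    show "openin (prod_topology S T) W" if "W \<in> (\<lambda>(U, V). U \<times> V) ` (A \<times> B)" for W
      using that A(2) B(2) by (auto simp: openin_prod_Times_iff)
    fix W z assume W: "openin (prod_topology S T) W \<and> z \<in> W"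
    obtain x y where z: "z = (x, y)" by fastforce
    obtain U V where UV: "openin S U" "openin T V" "x \<in> U" "y \<in> V" "U \<times> V \<subseteq> W"
      using W z unfolding openin_prod_topology_alt by meson
    obtain U' where "U' \<in> A" "x \<in> U'" "U' \<subseteq> U"
      using A(3) [OF UV(1,3)] by blast
    moreover obtain V' where "V' \<in> B" "y \<in> V'" "V' \<subseteq> V"
      using B(3) [OF UV(2,4)] by blast
    ultimately show "\<exists>V\<in>(\<lambda>(U, V). U \<times> V) ` (A \<times> B). z \<in> V \<and> V \<subseteq> W"
      using UV(5) z by (intro bexI [of _ "U' \<times> V'"]) auto
  qed
qed

lemma smooth_manifold_product:
  assumes M: "smooth_manifold M" and N: "smooth_manifold N"
  shows "smooth_manifold (product_manifold M N)"
  unfolding smooth_manifold_def mspace_product mdim_product matlas_product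
proof (intro conjI ballI)
  show "Hausdorff_space (prod_topology (mspace M) (mspace N))"
    using M N by (simp add: smooth_manifold_def Hausdorff_space_prod_topology)
  show "second_countable (prod_topology (mspace M) (mspace N))"
    using M N by (intro second_countable_prod_topology) (simp_all add: smooth_manifold_def)
  show "coord_chart (prod_topology (mspace M) (mspace N)) (mdim M + mdim N) c"
    if "c \<in> {prod_chart (mdim M) c d | c d. c \<in> matlas M \<and> d \<in> matlas N}" for c
    using that matlas_coord_chart [OF M] matlas_coord_chart [OF N] coord_chart_prod_chart by blast
  have "\<Union> (fst ` matlas M) = mpoints M" "\<Union> (fst ` matlas N) = mpoints N"
    using M N by (simp_all add: smooth_manifold_def)
  moreover have "\<Union> (fst ` {prod_chart (mdim M) c d | c d. c \<in> matlas M \<and> d \<in> matlas N}) =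
      \<Union> (fst ` matlas M) \<times> \<Union> (fst ` matlas N)"
    by (force simp: prod_chart_def)
  ultimately show "\<Union> (fst ` {prod_chart (mdim M) c d | c d. c \<in> matlas M \<and> d \<in> matlas N}) =
      topspace (prod_topology (mspace M) (mspace N))"
    by simp
  show "compatible (mdim M + mdim N) c d"
    if "c \<in> {prod_chart (mdim M) c d | c d. c \<in> matlas M \<and> d \<in> matlas N}"
      "d \<in> {prod_chart (mdim M) c d | c d. c \<in> matlas M \<and> d \<in> matlas N}" for c d
    using that matlas_in_charts [OF M] matlas_in_charts [OF N] prod_charts_compatible [OF M N] by blast
qed

lemma prod_chart_in_charts:
  assumes M: "smooth_manifold M" and N: "smooth_manifold N" and c: "c \<in> charts M" and d: "d \<in> charts N"
  shows "prod_chart (mdim M) c d \<in> charts (product_manifold M N)"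
  unfolding charts_def mspace_product mdim_product matlas_product
  using coord_chart_prod_chart [OF charts_coord_chart [OF c] charts_coord_chart [OF d]]
    prod_charts_compatible [OF M N c _ d] matlas_in_charts [OF M] matlas_in_charts [OF N]
  by auto

lemma smooth_at_fst_snd:
  assumes M: "smooth_manifold M" and N: "smooth_manifold N"
    and xy: "x \<in> mpoints M" "y \<in> mpoints N"
  shows "smooth_at (product_manifold M N) M fst (x, y)"
    and "smooth_at (product_manifold M N) N snd (x, y)"
proof -
  obtain c where c: "c \<in> charts M" "x \<in> fst c"
    using ex_matlas_chart [OF M xy(1)] by metis
  obtain d where d: "d \<in> charts N" "y \<in> fst d"
    using ex_matlas_chart [OF N xy(2)] by metis
  note cc = charts_coord_chart [OF c(1)] and dd = charts_coord_chart [OF d(1)]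
  let ?p = "prod_chart (mdim M) c d"
  have p: "?p \<in> charts (product_manifold M N)"
    by (rule prod_chart_in_charts [OF M N c(1) d(1)])
  note O = coord_chart_openin [OF charts_coord_chart [OF p]]
  have im: "openin (Euclidean_space (mdim M + mdim N)) (snd ?p ` fst ?p)"
    using coord_chart_image [OF charts_coord_chart [OF p] O order_refl] by (simp add: mdim_product)
  have *: "take_vec (mdim M) z = (snd c \<circ> fst \<circ> chart_inv ?p) z \<and>
      drop_vec (mdim M) z = (snd d \<circ> snd \<circ> chart_inv ?p) z" if z: "z \<in> snd ?p ` fst ?p" for z
  proof -
    obtain x y where "x \<in> fst c" "y \<in> fst d" "z = append_vec (mdim M) (snd c x) (snd d y)"
      using z unfolding fst_prod_chart prod_chart_image_Times by blast
    then show ?thesis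
      using chart_inv_prod_chart [OF cc dd] coord_chart_in_euclid [OF cc]
      by (simp add: take_append_vec drop_append_vec)
  qed
  have 1: "smooth_between (mdim M + mdim N) (mdim M) (snd ?p ` fst ?p) (snd c \<circ> fst \<circ> chart_inv ?p)"
    by (rule smooth_between_cong [OF smooth_between_take_vec [OF im]]) (use * in blast)
  have 2: "smooth_between (mdim M + mdim N) (mdim N) (snd ?p ` fst ?p) (snd d \<circ> snd \<circ> chart_inv ?p)"
    by (rule smooth_between_cong [OF smooth_between_drop_vec [OF im]]) (use * in blast)
  show "smooth_at (product_manifold M N) M fst (x, y)"
    by (rule smooth_atI [where W = "fst ?p", OF p c(1) O])
      (use c d 1 in \<open>auto simp: fst_prod_chart mdim_product\<close>)
  show "smooth_at (product_manifold M N) N snd (x, y)"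
    by (rule smooth_atI [where W = "fst ?p", OF p d(1) O])
      (use c d 2 in \<open>auto simp: fst_prod_chart mdim_product\<close>)
qed

lemma smooth_at_Pair:
  assumes K: "smooth_manifold K" and M: "smooth_manifold M" and N: "smooth_manifold N"
    and f: "smooth_at K M f x" and g: "smooth_at K N g x"
  shows "smooth_at K (product_manifold M N) (\<lambda>x. (f x, g x)) x"
proof -
  obtain c where c: "c \<in> charts K" "x \<in> fst c"
    using ex_matlas_chart [OF K smooth_at_in_mpoints(1) [OF f]] by metis
  obtain d where d: "d \<in> charts M" "f x \<in> fst d"
    using ex_matlas_chart [OF M smooth_at_in_mpoints(2) [OF f]] by metis
  obtain e where e: "e \<in> charts N" "g x \<in> fst e"
    using ex_matlas_chart [OF N smooth_at_in_mpoints(2) [OF g]] by metis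
  note cc = charts_coord_chart [OF c(1)]
  obtain U where U: "openin (mspace K) U" "x \<in> U" "U \<subseteq> fst c" "f ` U \<subseteq> fst d"
    and f': "smooth_between (mdim K) (mdim M) (snd c ` U) (snd d \<circ> f \<circ> chart_inv c)"
    by (rule smooth_at_charts [OF K M f c d openin_topspace smooth_at_in_mpoints(1) [OF f]
          openin_topspace smooth_at_in_mpoints(2) [OF f]], rule that)
  obtain W where W: "openin (mspace K) W" "x \<in> W" "W \<subseteq> fst c" "g ` W \<subseteq> fst e" "W \<subseteq> U"
    and g': "smooth_between (mdim K) (mdim N) (snd c ` W) (snd e \<circ> g \<circ> chart_inv c)"
    by (rule smooth_at_charts [OF K N g c e U(1,2)
          openin_topspace smooth_at_in_mpoints(2) [OF g]], rule that)
  have f'': "smooth_between (mdim K) (mdim M) (snd c ` W) (snd d \<circ> f \<circ> chart_inv c)"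
    by (rule smooth_between_subset [OF f' coord_chart_image [OF cc W(1,3)]]) (use W in auto)
  have s: "smooth_between (mdim K) (mdim (product_manifold M N)) (snd c ` W)
      (snd (prod_chart (mdim M) d e) \<circ> (\<lambda>x. (f x, g x)) \<circ> chart_inv c)"
    using smooth_between_append_vec [OF f'' g'] by (simp add: mdim_product o_def snd_prod_chart)
  show ?thesis
    by (rule smooth_atI [OF c(1) prod_chart_in_charts [OF M N d(1) e(1)] W(1-3) _ s])
      (use U(4) W(4,5) in \<open>auto simp: fst_prod_chart image_subset_iff subset_iff\<close>)
qed

section \<open>Embedded submanifolds\<close>

lemma euclid_mono: "x \<in> euclid k \<Longrightarrow> k \<le> n \<Longrightarrow> x \<in> euclid n"
  by (simp add: in_euclid)

text \<open>
  The \<open>k\<close>-tuples are literally among the \<open>n\<close>-tuples, so restricting a smooth map to a slice is composing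
  it with an inclusion that is the identity.
\<close>

lemma smooth_between_euclid_restrict:
  assumes "smooth_between n p U f" "k \<le> n"
  shows "smooth_between k p (U \<inter> euclid k) f"
proof -
  have "smooth_between k n (euclid k) (\<lambda>x. x)"
    by (intro smooth_betweenI smooth_fn_coordinate euclid_mono [OF _ assms(2)]) auto
  from smooth_between_compose_preimage [OF this assms(1)]
  have "smooth_between k p {x \<in> euclid k. x \<in> U} f"
    by (simp add: o_def)
  then show ?thesis
    by (simp add: Int_def conj_commute)
qed

lemma smooth_between_codomain:
  assumes "smooth_between m n U f" "f ` U \<subseteq> euclid k"
  shows "smooth_between m k U f"
  by (intro smooth_betweenI smooth_between_openin [OF assms(1)] smooth_between_component [OF assms(1)])
    (use assms(2) in auto)

lemma openin_euclid_Int: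
  assumes "openin (Euclidean_space n) U" "k \<le> n"
  shows "openin (Euclidean_space k) (U \<inter> euclid k)"
proof -
  obtain T where "open T" "U = T \<inter> euclid n"
    using assms(1) by (auto simp: openin_Euclidean_open)
  then show ?thesis
    unfolding openin_Euclidean_open using euclid_mono [OF _ assms(2)] by (intro exI [of _ T]) auto
qed

lemma openin_euclid_extend:
  assumes "openin (Euclidean_space k) U"
  obtains V where "openin (Euclidean_space n) V" "V \<inter> euclid k \<subseteq> U" "U \<inter> euclid n \<subseteq> V"
proof -
  obtain T where "open T" "U = T \<inter> euclid k"
    using assms by (auto simp: openin_Euclidean_open)
  then show thesis
    by (intro that [of "T \<inter> euclid n"]) (auto simp: openin_Euclidean_open)
qed

lemma mspace_embedded: "mspace (embedded N S k) = subtopology (mspace N) S"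
  and mdim_embedded: "mdim (embedded N S k) = k"
  and matlas_embedded: "matlas (embedded N S k) = {(fst c \<inter> S, snd c) | c. slice_chart N S k c}"
  by (simp_all add: embedded_def)

lemma slice_chart_in_euclid:
  "slice_chart N S k c \<Longrightarrow> x \<in> fst c \<Longrightarrow> x \<in> S \<Longrightarrow> snd c x \<in> euclid k"
  unfolding slice_chart_def by blast

lemma slice_chart_in_charts: "slice_chart N S k c \<Longrightarrow> c \<in> charts N"
  by (simp add: slice_chart_def)

lemma coord_chart_slice:
  assumes c: "slice_chart N S k c" and k: "k \<le> mdim N"
  shows "coord_chart (subtopology (mspace N) S) k (fst c \<inter> S, snd c)"
  unfolding coord_chart_iff fst_conv snd_conv
proof (intro conjI allI impI)
  note cc = charts_coord_chart [OF slice_chart_in_charts [OF c]]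
  show "openin (subtopology (mspace N) S) (fst c \<inter> S)"
    by (rule openin_subtopology_Int [OF coord_chart_openin [OF cc]])
  show "inj_on (snd c) (fst c \<inter> S)"
    by (rule inj_on_subset [OF coord_chart_inj [OF cc]]) auto
  show "snd c ` (fst c \<inter> S) \<subseteq> euclid k"
    using slice_chart_in_euclid [OF c] by auto
  show "openin (subtopology (mspace N) S) {x \<in> fst c \<inter> S. snd c x \<in> U}"
    if U: "openin (Euclidean_space k) U" for U
  proof -
    obtain V where V: "openin (Euclidean_space (mdim N)) V" "V \<inter> euclid k \<subseteq> U" "U \<inter> euclid (mdim N) \<subseteq> V"
      by (rule openin_euclid_extend [OF U], rule that)
    have "{x \<in> fst c \<inter> S. snd c x \<in> U} = {x \<in> fst c. snd c x \<in> V} \<inter> S"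
      using V(2,3) slice_chart_in_euclid [OF c] coord_chart_in_euclid [OF cc] by blast
    then show ?thesis
      using openin_subtopology_Int [OF coord_chart_vimage [OF cc V(1)]] by simp
  qed
  show "openin (Euclidean_space k) (snd c ` W)"
    if W: "openin (subtopology (mspace N) S) W \<and> W \<subseteq> fst c \<inter> S" for W
  proof -
    obtain T where T: "openin (mspace N) T" "W = T \<inter> S"
      using W by (auto simp: openin_subtopology)
    have O: "openin (mspace N) (T \<inter> fst c)"
      using T coord_chart_openin [OF cc] by (simp add: openin_Int)
    have slice: "snd c ` (fst c \<inter> S) = snd c ` fst c \<inter> euclid k"
      using c by (simp add: slice_chart_def)
    have "snd c ` W = snd c ` (T \<inter> fst c) \<inter> euclid k"
    proof (intro equalityI subsetI)
      show "y \<in> snd c ` (T \<inter> fst c) \<inter> euclid k" if "y \<in> snd c ` W" for y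
        using that W T slice_chart_in_euclid [OF c] by auto
      fix y assume y: "y \<in> snd c ` (T \<inter> fst c) \<inter> euclid k"
      then obtain x where x: "x \<in> T" "x \<in> fst c" "y = snd c x" by blast
      have "y \<in> snd c ` (fst c \<inter> S)"
        using y x slice by blast
      then have "x \<in> fst c \<inter> S"
        using inj_on_image_mem_iff [OF coord_chart_inj [OF cc] x(2), of "fst c \<inter> S"] x(3) by simp
      then show "y \<in> snd c ` W"
        using x T by blast
    qed
    then show ?thesis
      using openin_euclid_Int [OF coord_chart_image [OF cc O] k] by simp
  qed
qed

lemma slice_charts_transition:
  assumes N: "smooth_manifold N" and c: "slice_chart N S k c" and d: "slice_chart N S k d"
    and k: "k \<le> mdim N"
  shows "smooth_between k k (snd c ` ((fst c \<inter> S) \<inter> (fst d \<inter> S)))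
    (transition (fst c \<inter> S, snd c) (fst d \<inter> S, snd d))"
proof (rule smooth_between_cong)
  note cN = slice_chart_in_charts [OF c] and dN = slice_chart_in_charts [OF d]
  note cc = charts_coord_chart [OF cN] and dd = charts_coord_chart [OF dN]
  note inj = coord_chart_inj [OF cc]
  let ?O = "snd c ` ((fst c \<inter> S) \<inter> (fst d \<inter> S))"
  have W: "openin (mspace N) (fst c \<inter> fst d)"
    by (intro openin_Int coord_chart_openin [OF cc] coord_chart_openin [OF dd])
  have s: "smooth_between k (mdim N) (snd c ` (fst c \<inter> fst d) \<inter> euclid k) (snd d \<circ> (\<lambda>x. x) \<circ> chart_inv c)"
    by (rule smooth_between_euclid_restrict [OF smooth_transition [OF N cN dN W] k]) auto
  have openO: "openin (Euclidean_space k) ?O"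
    by (rule coord_chart_image [OF coord_chart_slice [OF c k], unfolded snd_conv fst_conv])
      (use openin_subtopology_Int [OF W, of S] in \<open>auto simp: Int_ac\<close>)
  have cl: "chart_inv c (snd c x) = x" if "x \<in> fst c" for x
    by (rule chart_inv_left [OF inj that])
  have "smooth_between k (mdim N) ?O (snd d \<circ> (\<lambda>x. x) \<circ> chart_inv c)"
    by (rule smooth_between_subset [OF s openO]) (use slice_chart_in_euclid [OF c] in auto)
  then show "smooth_between k k ?O (snd d \<circ> (\<lambda>x. x) \<circ> chart_inv c)"
    by (rule smooth_between_codomain) (use slice_chart_in_euclid [OF d] cl in auto)
  fix y assume "y \<in> ?O"
  then have "chart_inv (fst c \<inter> S, snd c) y = chart_inv c y"
    by (intro chart_inv_restrict [OF inj]) auto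
  then show "(snd d \<circ> (\<lambda>x. x) \<circ> chart_inv c) y = transition (fst c \<inter> S, snd c) (fst d \<inter> S, snd d) y"
    by (simp add: transition_def)
qed

text \<open>
  A slice chart and its restriction to \<open>S\<close> have the same coordinate functions. Transition maps between
  restricted charts are therefore restrictions of ambient transition maps, and smoothness is inherited.
\<close>

lemma smooth_manifold_embedded:
  assumes N: "smooth_manifold N" and k: "k \<le> mdim N"
    and cover: "\<And>x. x \<in> S \<Longrightarrow> \<exists>c. slice_chart N S k c \<and> x \<in> fst c"
  shows "smooth_manifold (embedded N S k)"
  unfolding smooth_manifold_def mspace_embedded mdim_embedded matlas_embedded
proof (intro conjI ballI)
  show "Hausdorff_space (subtopology (mspace N) S)"
    using N by (simp add: smooth_manifold_def Hausdorff_space_subtopology)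
  have "Abstract_Topological_Spaces.second_countable (mspace N)"
    using N by (simp add: smooth_manifold_def Abstract_Topological_Spaces.second_countable_def
        Defs.second_countable_def)
  then show "second_countable (subtopology (mspace N) S)"
    using second_countable_subtopology [of "mspace N" S]
    by (simp add: Abstract_Topological_Spaces.second_countable_def Defs.second_countable_def)
  show "coord_chart (subtopology (mspace N) S) k c"
    if "c \<in> {(fst c \<inter> S, snd c) | c. slice_chart N S k c}" for c
    using that coord_chart_slice [OF _ k] by blast
  show "\<Union> (fst ` {(fst c \<inter> S, snd c) | c. slice_chart N S k c}) = topspace (subtopology (mspace N) S)"
  proof (intro equalityI subsetI)
    fix x assume "x \<in> \<Union> (fst ` {(fst c \<inter> S, snd c) | c. slice_chart N S k c})"
    then obtain c where c: "slice_chart N S k c" "x \<in> fst c" "x \<in> S"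
      by auto
    then show "x \<in> topspace (subtopology (mspace N) S)"
      using chart_subset_mpoints [OF slice_chart_in_charts [OF c(1)] c(2)] by simp
  next
    fix x assume "x \<in> topspace (subtopology (mspace N) S)"
    then have x: "x \<in> S"
      by simp
    then obtain c where c: "slice_chart N S k c" "x \<in> fst c"
      using cover by blast
    have c': "(fst c \<inter> S, snd c) \<in> {(fst c \<inter> S, snd c) | c. slice_chart N S k c}"
      unfolding mem_Collect_eq by (rule exI [of _ c]) (simp add: c(1))
    have xc: "x \<in> fst (fst c \<inter> S, snd c)"
      using c(2) x by simp
    show "x \<in> \<Union> (fst ` {(fst c \<inter> S, snd c) | c. slice_chart N S k c})"
      by (rule UnionI [OF imageI [where f = fst, OF c'] xc])
  qed
  show "compatible k c d"
    if A: "c \<in> {(fst c \<inter> S, snd c) | c. slice_chart N S k c}"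
      "d \<in> {(fst c \<inter> S, snd c) | c. slice_chart N S k c}" for c d
  proof -
    obtain c' d' where "slice_chart N S k c'" "slice_chart N S k d'"
      and cd: "c = (fst c' \<inter> S, snd c')" "d = (fst d' \<inter> S, snd d')"
      using A by blast
    then show ?thesis
      using slice_charts_transition [OF N _ _ k, of S c' d'] slice_charts_transition [OF N _ _ k, of S d' c']
      unfolding compatible_def cd fst_conv snd_conv by (simp add: Int_commute)
  qed
qed

lemma slice_in_charts_embedded:
  assumes "smooth_manifold (embedded N S k)" "slice_chart N S k c"
  shows "(fst c \<inter> S, snd c) \<in> charts (embedded N S k)"
proof (rule matlas_in_charts [OF assms(1)])
  show "(fst c \<inter> S, snd c) \<in> matlas (embedded N S k)"
    unfolding matlas_embedded mem_Collect_eq by (rule exI [of _ c]) (simp add: assms(2))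
qed

lemma ex_slice_chart:
  assumes "smooth_manifold (embedded N S k)" "x \<in> mpoints (embedded N S k)"
  obtains c where "slice_chart N S k c" "x \<in> fst c"
proof -
  obtain c where c: "c \<in> matlas (embedded N S k)" "x \<in> fst c"
    by (rule ex_matlas_chart [OF assms], rule that)
  then obtain c' where "slice_chart N S k c'" "c = (fst c' \<inter> S, snd c')"
    unfolding matlas_embedded by blast
  then show thesis
    using that [of c'] c(2) by simp
qed

lemma smooth_at_inclusion:
  assumes N: "smooth_manifold N" and E: "smooth_manifold (embedded N S k)" and k: "k \<le> mdim N"
    and x: "x \<in> mpoints (embedded N S k)"
  shows "smooth_at (embedded N S k) N (\<lambda>x. x) x"
proof -
  obtain c where c: "slice_chart N S k c" "x \<in> fst c"
    by (rule ex_slice_chart [OF E x], rule that)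
  let ?c = "(fst c \<inter> S, snd c)"
  note cE = slice_in_charts_embedded [OF E c(1)] and cN = slice_chart_in_charts [OF c(1)]
  note cc = charts_coord_chart [OF cN] and ce = charts_coord_chart [OF cE]
  have openO: "openin (Euclidean_space k) (snd c ` (fst c \<inter> S))"
    using coord_chart_image [OF ce coord_chart_openin [OF ce] order_refl] by (simp add: mdim_embedded)
  have id: "smooth_between k k (snd c ` (fst c \<inter> S)) (\<lambda>y. y)"
    by (rule smooth_between_id [OF openO])
  have "smooth_between k (mdim N) (snd c ` (fst c \<inter> S)) (\<lambda>y. y)"
    by (rule smooth_between_codomain [OF id]) (use coord_chart_in_euclid [OF cc] in auto)
  then have s: "smooth_between (mdim (embedded N S k)) (mdim N) (snd ?c ` fst ?c) (snd c \<circ> (\<lambda>x. x) \<circ> chart_inv ?c)"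
    unfolding mdim_embedded fst_conv snd_conv
  proof (rule smooth_between_cong)
    fix y assume "y \<in> snd c ` (fst c \<inter> S)"
    then show "y = (snd c \<circ> (\<lambda>x. x) \<circ> chart_inv ?c) y"
      using chart_inv_right [of y ?c] by simp
  qed
  have xc: "x \<in> fst ?c" "(\<lambda>x. x) ` fst ?c \<subseteq> fst c"
    using c(2) x by (simp_all add: mspace_embedded)
  show ?thesis
    by (rule smooth_atI [OF cE cN coord_chart_openin [OF ce] xc(1) order_refl xc(2) s])
qed

text \<open>
  In slice charts a map into \<open>S\<close> has the same coordinate expression as the map into the ambient manifold;
  only the number of coordinates that are counted changes.
\<close>

lemma smooth_at_into_embedded:
  assumes K: "smooth_manifold K" and N: "smooth_manifold N" and E: "smooth_manifold (embedded N S k)"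
    and f: "smooth_at K N f x" and U: "openin (mspace K) U" "x \<in> U" and S: "f ` U \<subseteq> S"
  shows "smooth_at K (embedded N S k) f x"
proof -
  have fx: "f x \<in> mpoints (embedded N S k)"
    using smooth_at_in_mpoints(2) [OF f] S U by (auto simp: mspace_embedded)
  obtain d where d: "slice_chart N S k d" "f x \<in> fst d"
    by (rule ex_slice_chart [OF E fx], rule that)
  obtain c where c: "c \<in> charts K" "x \<in> fst c"
    using ex_matlas_chart [OF K smooth_at_in_mpoints(1) [OF f]] by metis
  obtain W where W: "openin (mspace K) W" "x \<in> W" "W \<subseteq> fst c" "f ` W \<subseteq> fst d" "W \<subseteq> U"
    and s: "smooth_between (mdim K) (mdim N) (snd c ` W) (snd d \<circ> f \<circ> chart_inv c)"
    by (rule smooth_at_charts [OF K N f c slice_chart_in_charts [OF d(1)] d(2) U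
          openin_topspace smooth_at_in_mpoints(2) [OF f]], rule that)
  have cl: "chart_inv c (snd c x) = x" if "x \<in> W" for x
    using that W(3) by (intro chart_inv_left [OF coord_chart_inj [OF charts_coord_chart [OF c(1)]]]) auto
  have WS: "f x \<in> fst d \<inter> S" if "x \<in> W" for x
    using that W(4,5) S by (auto simp: image_subset_iff subset_iff)
  have s': "smooth_between (mdim K) (mdim (embedded N S k)) (snd c ` W) (snd (fst d \<inter> S, snd d) \<circ> f \<circ> chart_inv c)"
    unfolding mdim_embedded snd_conv
    by (rule smooth_between_codomain [OF s]) (use WS slice_chart_in_euclid [OF d(1)] cl in auto)
  have im: "f ` W \<subseteq> fst (fst d \<inter> S, snd d)"
    using WS by (simp add: image_subset_iff)
  show ?thesis
    by (rule smooth_atI [OF c(1) slice_in_charts_embedded [OF E d(1)] W(1-3) im s'])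
qed

section \<open>Tangent vectors\<close>

lemma charts_at_iff: "c \<in> charts_at M x \<longleftrightarrow> c \<in> matlas M \<and> x \<in> fst c"
  by (simp add: charts_at_def)

lemma transition_at:
  assumes M: "smooth_manifold M" and c: "c \<in> charts M" "x \<in> fst c" and d: "d \<in> charts M" "x \<in> fst d"
  shows "transition c d (snd c x) = snd d x"
    and "snd c x \<in> snd c ` (fst c \<inter> fst d)"
    and "smooth_between (mdim M) (mdim M) (snd c ` (fst c \<inter> fst d)) (transition c d)"
  using charts_compatible [OF M c(1) d(1)] c d
    chart_inv_left [OF coord_chart_inj [OF charts_coord_chart [OF c(1)]] c(2)]
  by (auto simp: transition_def compatible_def)

text \<open>
  The chain rule for the transition maps: the defining condition of a tangent vector is consistent.
\<close>

lemma tangent_transition_cocycle: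
  assumes M: "smooth_manifold M" and c: "c \<in> charts M" "x \<in> fst c" and d: "d \<in> charts M" "x \<in> fst d"
    and e: "e \<in> charts M" "x \<in> fst e"
  shows "total_deriv (mdim M) (transition c e) (snd c x) v =
    total_deriv (mdim M) (transition d e) (snd d x) (total_deriv (mdim M) (transition c d) (snd c x) v)"
proof -
  note cd = transition_at [OF M c d] and de = transition_at [OF M d e] and ce = transition_at [OF M c e]
  note cc = charts_coord_chart [OF c(1)] and dd = charts_coord_chart [OF d(1)] and ee = charts_coord_chart [OF e(1)]
  let ?W = "fst c \<inter> fst d \<inter> fst e"
  have W: "openin (mspace M) ?W"
    by (intro openin_Int coord_chart_openin [OF cc] coord_chart_openin [OF dd] coord_chart_openin [OF ee])
  have "total_deriv (mdim M) (transition c e) (snd c x) v j =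
      total_deriv (mdim M) (transition d e \<circ> transition c d) (snd c x) v j" for j
  proof (rule total_deriv_cong)
    show "openin (Euclidean_space (mdim M)) (snd c ` ?W)"
      by (rule coord_chart_image [OF cc W]) auto
    show "snd c x \<in> snd c ` ?W"
      using c d e by auto
    fix y assume "y \<in> snd c ` ?W"
    then show "transition c e y j = (transition d e \<circ> transition c d) y j"
      using chart_inv_left [OF coord_chart_inj [OF cc]] chart_inv_left [OF coord_chart_inj [OF dd]]
      by (auto simp: transition_def)
  qed
  then have "total_deriv (mdim M) (transition c e) (snd c x) v =
      total_deriv (mdim M) (transition d e \<circ> transition c d) (snd c x) v"
    by (rule ext)
  also have "\<dots> = total_deriv (mdim M) (transition d e) (snd d x) (total_deriv (mdim M) (transition c d) (snd c x) v)"
    using total_deriv_compose [OF cd(3) de(3) cd(2)] de(2) cd(1) by simp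
  finally show ?thesis .
qed

lemma total_deriv_transition_self:
  assumes M: "smooth_manifold M" and c: "c \<in> charts M" "x \<in> fst c" and v: "v \<in> euclid (mdim M)"
  shows "total_deriv (mdim M) (transition c c) (snd c x) v = v"
proof -
  note cc = charts_coord_chart [OF c(1)]
  have "total_deriv (mdim M) (transition c c) (snd c x) v j = total_deriv (mdim M) (\<lambda>x. x) (snd c x) v j" for j
    by (rule total_deriv_cong [OF coord_chart_image [OF cc coord_chart_openin [OF cc] order_refl]])
      (use c in \<open>auto simp: transition_def chart_inv_right\<close>)
  then show ?thesis
    using total_deriv_id [OF v] by auto
qed

text \<open>
  The coordinates in the other charts are obtained from \<open>v\<close> by the derivatives of the transition maps;
  by the cocycle property they fit together.
\<close>

lemma ex_tangent_vector:
  assumes M: "smooth_manifold M" and c: "c \<in> charts_at M x" and v: "v \<in> euclid (mdim M)"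
  obtains u where "u \<in> tangent_vectors M x" "u c = v"
proof -
  have ch: "d \<in> charts M" "x \<in> fst d" if "d \<in> charts_at M x" for d
    using that matlas_in_charts [OF M] by (simp_all add: charts_at_iff)
  define u where "u = (\<lambda>d\<in>charts_at M x. total_deriv (mdim M) (transition c d) (snd c x) v)"
  have uc: "u c = v"
    using c total_deriv_transition_self [OF M ch [OF c] v] by (simp add: u_def)
  have "total_deriv (mdim M) (transition c d) (snd c x) v \<in> euclid (mdim M)" if "d \<in> charts_at M x" for d
  proof -
    note t = transition_at [OF M ch [OF c] ch [OF that]]
    show ?thesis
      by (rule total_deriv_in_euclid [OF smooth_between_openin [OF t(3)] t(2)])
        (use smooth_between_in_euclid [OF t(3)] in auto)
  qed
  then have "u \<in> charts_at M x \<rightarrow>\<^sub>E euclid (mdim M)"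
    by (simp add: u_def)
  moreover have "u e = total_deriv (mdim M) (transition d e) (snd d x) (u d)"
    if "d \<in> charts_at M x" "e \<in> charts_at M x" for d e
  proof -
    have "u d = total_deriv (mdim M) (transition c d) (snd c x) v"
      "u e = total_deriv (mdim M) (transition c e) (snd c x) v"
      using that by (simp_all add: u_def)
    then show ?thesis
      using tangent_transition_cocycle [OF M ch [OF c] ch [OF that(1)] ch [OF that(2)], of v] by metis
  qed
  ultimately have "u \<in> tangent_vectors M x"
    unfolding tangent_vectors_def mem_Collect_eq by (intro conjI ballI)
  then show thesis
    using uc by (rule that)
qed

lemma tangent_vectorsD:
  "u \<in> tangent_vectors M x \<Longrightarrow> u \<in> (charts_at M x \<rightarrow>\<^sub>E euclid (mdim M)) \<and>
    (\<forall>c\<in>charts_at M x. \<forall>d\<in>charts_at M x. u d = total_deriv (mdim M) (transition c d) (snd c x) (u c))"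
  unfolding tangent_vectors_def mem_Collect_eq .

lemma tangent_vector_coords:
  assumes "u \<in> tangent_vectors M x" "c \<in> charts_at M x"
  shows "u c \<in> euclid (mdim M)"
    and "d \<in> charts_at M x \<Longrightarrow> u d = total_deriv (mdim M) (transition c d) (snd c x) (u c)"
proof -
  note u = conjunct1 [OF tangent_vectorsD [OF assms(1)]]
    and coc = conjunct2 [OF tangent_vectorsD [OF assms(1)]]
  show "u c \<in> euclid (mdim M)"
    by (rule PiE_mem [OF u assms(2)])
  show "u d = total_deriv (mdim M) (transition c d) (snd c x) (u c)" if "d \<in> charts_at M x"
    by (rule bspec [OF bspec [OF coc assms(2)] that])
qed

lemma tangent_vectors_eqI:
  assumes u: "u \<in> tangent_vectors M x" and v: "v \<in> tangent_vectors M x"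
    and c: "c \<in> charts_at M x" and eq: "u c = v c"
  shows "u = v"
proof (rule PiE_ext)
  show "u \<in> charts_at M x \<rightarrow>\<^sub>E euclid (mdim M)" "v \<in> charts_at M x \<rightarrow>\<^sub>E euclid (mdim M)"
    by (rule conjunct1 [OF tangent_vectorsD [OF u]], rule conjunct1 [OF tangent_vectorsD [OF v]])
  show "u d = v d" if "d \<in> charts_at M x" for d
    using tangent_vector_coords(2) [OF u c that] tangent_vector_coords(2) [OF v c that] eq by metis
qed

section \<open>Submersions\<close>

text \<open>
  The chain rule for coordinate expressions of maps between manifolds, valid for any charts around the
  three points.
\<close>

lemma chart_rep_deriv_compose:
  assumes A: "smooth_manifold A" and B: "smooth_manifold B" and C: "smooth_manifold C"
    and f: "smooth_at A B f x" and g: "smooth_at B C g (f x)"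
    and c: "c \<in> charts A" "x \<in> fst c" and d: "d \<in> charts B" "f x \<in> fst d"
    and e: "e \<in> charts C" "g (f x) \<in> fst e"
  shows "total_deriv (mdim A) (snd e \<circ> (g \<circ> f) \<circ> chart_inv c) (snd c x) v =
    total_deriv (mdim B) (snd e \<circ> g \<circ> chart_inv d) (snd d (f x))
      (total_deriv (mdim A) (snd d \<circ> f \<circ> chart_inv c) (snd c x) v)"
proof -
  note cc = charts_coord_chart [OF c(1)] and dd = charts_coord_chart [OF d(1)]
  obtain V where V: "openin (mspace B) V" "f x \<in> V" "V \<subseteq> fst d" "g ` V \<subseteq> fst e"
    and g': "smooth_between (mdim B) (mdim C) (snd d ` V) (snd e \<circ> g \<circ> chart_inv d)"
    by (rule smooth_at_charts [OF B C g d e openin_topspace smooth_at_in_mpoints(1) [OF g]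
          openin_topspace smooth_at_in_mpoints(2) [OF g]], rule that)
  obtain W where W: "openin (mspace A) W" "x \<in> W" "W \<subseteq> fst c" "f ` W \<subseteq> fst d" "f ` W \<subseteq> V"
    and f': "smooth_between (mdim A) (mdim B) (snd c ` W) (snd d \<circ> f \<circ> chart_inv c)"
    by (rule smooth_at_charts [OF A B f c d openin_topspace smooth_at_in_mpoints(1) [OF f] V(1,2)], rule that)
  have cl: "chart_inv c (snd c z) = z" if "z \<in> W" for z
    using that W(3) by (intro chart_inv_left [OF coord_chart_inj [OF cc]]) auto
  have dl: "chart_inv d (snd d (f z)) = f z" if "z \<in> W" for z
    using that W(4) by (intro chart_inv_left [OF coord_chart_inj [OF dd]]) auto
  have x: "snd c x \<in> snd c ` W" "(snd d \<circ> f \<circ> chart_inv c) (snd c x) \<in> snd d ` V"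
    using W(2) V(2) cl [OF W(2)] by simp_all
  have "total_deriv (mdim A) (snd e \<circ> (g \<circ> f) \<circ> chart_inv c) (snd c x) v j =
      total_deriv (mdim A) ((snd e \<circ> g \<circ> chart_inv d) \<circ> (snd d \<circ> f \<circ> chart_inv c)) (snd c x) v j" for j
  proof (rule total_deriv_cong [OF smooth_between_openin [OF f'] x(1)])
    fix y assume "y \<in> snd c ` W"
    then obtain z where "z \<in> W" "y = snd c z" by blast
    then show "(snd e \<circ> (g \<circ> f) \<circ> chart_inv c) y j =
        ((snd e \<circ> g \<circ> chart_inv d) \<circ> (snd d \<circ> f \<circ> chart_inv c)) y j"
      by (simp add: cl dl)
  qed
  then have "total_deriv (mdim A) (snd e \<circ> (g \<circ> f) \<circ> chart_inv c) (snd c x) v =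
      total_deriv (mdim A) ((snd e \<circ> g \<circ> chart_inv d) \<circ> (snd d \<circ> f \<circ> chart_inv c)) (snd c x) v"
    by (rule ext)
  moreover have "(snd d \<circ> f \<circ> chart_inv c) (snd c x) = snd d (f x)"
    using cl [OF W(2)] by simp
  ultimately show ?thesis
    using total_deriv_compose [OF f' g' x, of v] by (simp only:)
qed

lemma chart_rep_deriv_cong:
  assumes c: "c \<in> charts M" "x \<in> fst c" and U: "openin (mspace M) U" "x \<in> U"
    and eq: "\<And>z. z \<in> U \<Longrightarrow> f z = g z"
  shows "total_deriv (mdim M) (snd d \<circ> f \<circ> chart_inv c) (snd c x) v =
    total_deriv (mdim M) (snd d \<circ> g \<circ> chart_inv c) (snd c x) v"
proof
  fix j
  note cc = charts_coord_chart [OF c(1)]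
  have O: "openin (mspace M) (U \<inter> fst c)"
    using U coord_chart_openin [OF cc] by blast
  show "total_deriv (mdim M) (snd d \<circ> f \<circ> chart_inv c) (snd c x) v j =
    total_deriv (mdim M) (snd d \<circ> g \<circ> chart_inv c) (snd c x) v j"
  proof (rule total_deriv_cong [OF coord_chart_image [OF cc O]])
    fix y assume "y \<in> snd c ` (U \<inter> fst c)"
    then obtain z where "z \<in> U" "z \<in> fst c" "y = snd c z" by blast
    then show "(snd d \<circ> f \<circ> chart_inv c) y j = (snd d \<circ> g \<circ> chart_inv c) y j"
      using eq chart_inv_left [OF coord_chart_inj [OF cc], of z] by simp
  qed (use c U in auto)
qed

lemma chart_rep_deriv_in_euclid:
  assumes M: "smooth_manifold M" and N: "smooth_manifold N" and f: "smooth_at M N f x"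
    and c: "c \<in> charts M" "x \<in> fst c" and d: "d \<in> charts N" "f x \<in> fst d"
  shows "total_deriv (mdim M) (snd d \<circ> f \<circ> chart_inv c) (snd c x) v \<in> euclid (mdim N)"
proof -
  obtain W where W: "openin (mspace M) W" "x \<in> W"
    and f': "smooth_between (mdim M) (mdim N) (snd c ` W) (snd d \<circ> f \<circ> chart_inv c)"
    by (rule smooth_at_charts [OF M N f c d openin_topspace smooth_at_in_mpoints(1) [OF f]
          openin_topspace smooth_at_in_mpoints(2) [OF f]], rule that)
  have im: "(snd d \<circ> f \<circ> chart_inv c) ` (snd c ` W) \<subseteq> euclid (mdim N)"
    using f' by (simp only: smooth_between_iff)
  show ?thesis
    by (rule total_deriv_in_euclid [OF smooth_between_openin [OF f'] imageI [OF W(2)] im])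
qed

lemma charts_at_charts:
  "smooth_manifold M \<Longrightarrow> c \<in> charts_at M x \<Longrightarrow> c \<in> charts M"
  "c \<in> charts_at M x \<Longrightarrow> x \<in> fst c"
  by (simp_all add: charts_at_iff matlas_in_charts)

lemma ex_charts_at:
  assumes "smooth_manifold M" "x \<in> mpoints M"
  shows "\<exists>c. c \<in> charts_at M x"
  by (rule ex_matlas_chart [OF assms]) (auto simp: charts_at_iff)

text \<open>
  The chart is the one in which the differential at \<open>x\<close> is computed. All coordinate vectors \<open>w\<close> are hit
  because each of them belongs to some tangent vector.
\<close>

lemma submersion_in_charts:
  assumes M: "smooth_manifold M" and N: "smooth_manifold N" and f: "submersion M N f"
    and x: "x \<in> mpoints M"
  obtains c where "c \<in> charts M" "x \<in> fst c"
    "\<And>d w. d \<in> charts_at N (f x) \<Longrightarrow> w \<in> euclid (mdim N) \<Longrightarrow>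
      \<exists>v. total_deriv (mdim M) (snd d \<circ> f \<circ> chart_inv c) (snd c x) v = w"
proof -
  define c where "c = (SOME c. c \<in> charts_at M x)"
  have c: "c \<in> charts_at M x"
    unfolding c_def by (rule someI_ex [OF ex_charts_at [OF M x]])
  have surj: "differential M N f x ` tangent_vectors M x = tangent_vectors N (f x)"
    using f x by (simp add: submersion_def)
  show thesis
  proof (rule that [OF charts_at_charts(1) [OF M c] charts_at_charts(2) [OF c]])
    fix d w assume d: "d \<in> charts_at N (f x)" and w: "w \<in> euclid (mdim N)"
    obtain w' where w': "w' \<in> tangent_vectors N (f x)" "w' d = w"
      by (rule ex_tangent_vector [OF N d w], rule that)
    obtain u where "w' = differential M N f x u"
      using w'(1) surj by (metis imageE)
    then show "\<exists>v. total_deriv (mdim M) (snd d \<circ> f \<circ> chart_inv c) (snd c x) v = w"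
      using w'(2) d by (intro exI [of _ "u c"]) (simp add: differential_def Let_def c_def [symmetric])
  qed
qed

lemma submersion_smooth_at:
  "smooth_manifold M \<Longrightarrow> smooth_manifold N \<Longrightarrow> submersion M N f \<Longrightarrow> x \<in> mpoints M \<Longrightarrow> smooth_at M N f x"
  by (rule smooth_map_imp_smooth_at) (simp_all add: submersion_def)

text \<open>
  After straightening, the map \<open>f\<close> is the projection onto the last \<open>q\<close> coordinates, and freezing the
  other coordinates gives a section.
\<close>

lemma submersion_local_section:
  assumes M: "smooth_manifold M" and N: "smooth_manifold N" and f: "submersion M N f"
    and x: "x \<in> mpoints M"
  obtains \<sigma> V where "smooth_at N M \<sigma> (f x)" "\<sigma> (f x) = x" "openin (mspace N) V" "f x \<in> V"
    "\<And>y. y \<in> V \<Longrightarrow> f (\<sigma> y) = y"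
proof -
  define n q where "n = mdim M" and "q = mdim N"
  obtain c where c: "c \<in> charts M" "x \<in> fst c"
    and surj: "\<And>d w. d \<in> charts_at N (f x) \<Longrightarrow> w \<in> euclid (mdim N) \<Longrightarrow>
      \<exists>v. total_deriv (mdim M) (snd d \<circ> f \<circ> chart_inv c) (snd c x) v = w"
    by (rule submersion_in_charts [OF M N f x], rule that)
  note fx = submersion_smooth_at [OF M N f x]
  obtain d where d: "d \<in> charts_at N (f x)"
    using ex_charts_at [OF N smooth_at_in_mpoints(2) [OF fx]] by blast
  note d' = charts_at_charts(1) [OF N d] charts_at_charts(2) [OF d]
  note cc = charts_coord_chart [OF c(1)] and dd = charts_coord_chart [OF d'(1)]
  define F where "F = snd d \<circ> f \<circ> chart_inv c"
  obtain W where W: "openin (mspace M) W" "x \<in> W" "W \<subseteq> fst c" "f ` W \<subseteq> fst d"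
    and F': "smooth_between (mdim M) (mdim N) (snd c ` W) (snd d \<circ> f \<circ> chart_inv c)"
    by (rule smooth_at_charts [OF M N fx c d' openin_topspace smooth_at_in_mpoints(1) [OF fx]
          openin_topspace smooth_at_in_mpoints(2) [OF fx]], rule that)
  have F: "smooth_between n q (snd c ` W) F"
    using F' by (simp only: F_def n_def q_def)
  have surjF: "\<exists>v. total_deriv n F (snd c x) v = w" if "w \<in> euclid q" for w
    using surj [OF d, of w] that by (simp add: F_def n_def q_def)
  obtain O1 \<phi> where O1: "snd c x \<in> O1" "O1 \<subseteq> snd c ` W" and \<phi>: "diffeo_onto_image n O1 \<phi>" and qn: "q \<le> n"
    and \<phi>F: "\<And>y j. y \<in> O1 \<Longrightarrow> j < q \<Longrightarrow> \<phi> y (n - q + j) = F y j"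
    by (rule submersion_normal_form [OF F imageI [OF W(2)] surjF], assumption, rule that)
  have \<phi>': "smooth_between n n O1 \<phi>" "inj_on \<phi> O1" "smooth_between n n (\<phi> ` O1) (inv_into O1 \<phi>)"
    using \<phi> by (simp_all add: diffeo_onto_image_def)
  \<comment> \<open>In straightened coordinates, freeze the coordinates other than those given by \<open>F\<close>.\<close>
  define z0 where "z0 = \<phi> (snd c x)"
  define A where "A y = append_vec (n - q) (take_vec (n - q) z0) y" for y
  have A: "smooth_between q n (euclid q) A"
  proof -
    have "smooth_between q ((n - q) + q) (euclid q) (\<lambda>y. append_vec (n - q) (take_vec (n - q) z0) y)"
      by (intro smooth_between_append_vec smooth_between_const smooth_between_id take_vec_in_euclid) simp_all
    then show ?thesis
      using qn by (simp add: A_def [abs_def])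
  qed
  have z0: "z0 \<in> euclid n"
    unfolding z0_def by (rule smooth_between_in_euclid [OF \<phi>'(1) O1(1)])
  have cx: "chart_inv c (snd c x) = x"
    by (rule chart_inv_left [OF coord_chart_inj [OF cc] c(2)])
  have Fcx: "F (snd c x) = snd d (f x)"
    by (simp add: F_def cx)
  have A0: "A (snd d (f x)) = z0"
  proof
    fix i
    consider "i < n - q" | j where "j < q" "i = n - q + j" | "n \<le> i"
      by (metis add_diff_inverse_nat le_add_diff_inverse2 add.commute linorder_not_less nat_add_left_cancel_less qn)
    then show "A (snd d (f x)) i = z0 i"
    proof cases
      case 2
      then show ?thesis
        using \<phi>F [OF O1(1) 2(1)] by (simp add: A_def append_vec_def z0_def Fcx)
    next
      case 3
      then have "snd d (f x) (i - (n - q)) = 0"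
        using coord_chart_in_euclid [OF dd d'(2)] qn by (simp add: in_euclid q_def)
      then show ?thesis
        using 3 z0 by (simp add: A_def append_vec_def in_euclid)
    qed (simp add: A_def append_vec_def take_vec_def)
  qed
  define O2 where "O2 = {y \<in> euclid q. A y \<in> \<phi> ` O1}"
  define s where "s = inv_into O1 \<phi> \<circ> A"
  have s: "smooth_between q n O2 s"
    unfolding O2_def s_def by (rule smooth_between_compose_preimage [OF A \<phi>'(3)])
  have sO1: "s y \<in> O1" "\<phi> (s y) = A y" if "y \<in> O2" for y
    using that by (simp_all add: O2_def s_def inv_into_into f_inv_into_f)
  have Fs: "F (s y) = y" if y: "y \<in> O2" for y
  proof
    fix j
    show "F (s y) j = y j"
    proof (cases "j < q")
      case True
      then show ?thesis
        using \<phi>F [OF sO1(1) [OF y] True] sO1(2) [OF y] by (simp add: A_def append_vec_def)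
    next
      case False
      have "F (s y) \<in> euclid q" "y \<in> euclid q"
        using smooth_between_in_euclid [OF F] sO1(1) [OF y] O1(2) y by (auto simp: O2_def)
      then show ?thesis
        using False by (simp add: in_euclid)
    qed
  qed
  define V where "V = {y \<in> fst d. snd d y \<in> O2}"
  have V: "openin (mspace N) V"
    unfolding V_def using coord_chart_vimage [OF dd] smooth_between_openin [OF s] by (simp add: q_def)
  have fxV: "f x \<in> V"
    using d'(2) A0 O1(1) coord_chart_in_euclid [OF dd d'(2)] by (simp add: V_def O2_def z0_def q_def)
  define \<sigma> where "\<sigma> y = chart_inv c (s (snd d y))" for y
  have sW: "s y \<in> snd c ` W" if "y \<in> O2" for y
    using sO1(1) [OF that] O1(2) by blast
  have csub: "snd c ` W \<subseteq> snd c ` fst c"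
    using W(3) by blast
  have \<sigma>W: "\<sigma> y \<in> W" "snd c (\<sigma> y) = s (snd d y)" if y: "y \<in> V" for y
  proof -
    obtain z where z: "z \<in> W" "s (snd d y) = snd c z"
      using sW [of "snd d y"] y by (auto simp: V_def)
    then have "chart_inv c (snd c z) = z"
      using W(3) by (intro chart_inv_left [OF coord_chart_inj [OF cc]]) auto
    then show "\<sigma> y \<in> W" "snd c (\<sigma> y) = s (snd d y)"
      using z by (simp_all add: \<sigma>_def)
  qed
  show thesis
  proof (rule that [OF _ _ V fxV])
    show "f (\<sigma> y) = y" if y: "y \<in> V" for y
    proof (rule inj_onD [OF coord_chart_inj [OF dd]])
      show "f (\<sigma> y) \<in> fst d" "y \<in> fst d"
        using \<sigma>W(1) [OF y] W(4) y by (auto simp: V_def)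
      have "snd d (f (\<sigma> y)) = F (snd c (\<sigma> y))"
        using chart_inv_left [OF coord_chart_inj [OF cc], of "\<sigma> y"] \<sigma>W(1) [OF y] W(3)
        by (auto simp: F_def)
      then show "snd d (f (\<sigma> y)) = snd d y"
        using \<sigma>W(2) [OF y] Fs y by (simp add: V_def)
    qed
    show "\<sigma> (f x) = x"
      using A0 \<phi>'(2) O1(1) cx by (simp add: \<sigma>_def s_def z0_def inv_into_f_f)
    have rep: "smooth_between (mdim N) (mdim M) (snd d ` V) (snd c \<circ> \<sigma> \<circ> chart_inv d)"
    proof (rule smooth_between_cong)
      have dV: "openin (Euclidean_space q) (snd d ` V)"
        unfolding q_def by (rule coord_chart_image [OF dd V]) (auto simp: V_def)
      have "smooth_between q n (snd d ` V) s"
        by (rule smooth_between_subset [OF s dV]) (auto simp: V_def)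
      then show "smooth_between (mdim N) (mdim M) (snd d ` V) s"
        by (simp only: q_def n_def)
      fix y assume "y \<in> snd d ` V"
      then obtain z where z: "z \<in> V" "y = snd d z" by blast
      then have "chart_inv d (snd d z) = z"
        by (intro chart_inv_left [OF coord_chart_inj [OF dd]]) (simp add: V_def)
      then show "s y = (snd c \<circ> \<sigma> \<circ> chart_inv d) y"
        using \<sigma>W(2) [OF z(1)] z(2) by simp
    qed
    have "V \<subseteq> fst d" "\<sigma> ` V \<subseteq> fst c"
      using \<sigma>W(1) W(3) by (auto simp: V_def)
    then show "smooth_at N M \<sigma> (f x)"
      by (rule smooth_atI [OF d'(1) c(1) V fxV _ _ rep])
  qed
qed

text \<open>
  Conversely, differentiating \<open>f \<circ> \<sigma> = id\<close> shows that the differential of \<open>\<sigma>\<close> provides preimages of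
  all tangent vectors.
\<close>

lemma submersionI:
  assumes M: "smooth_manifold M" and N: "smooth_manifold N"
    and f: "\<And>x. x \<in> mpoints M \<Longrightarrow> smooth_at M N f x"
    and sec: "\<And>x. x \<in> mpoints M \<Longrightarrow> \<exists>\<sigma> V. smooth_at N M \<sigma> (f x) \<and> \<sigma> (f x) = x \<and>
      openin (mspace N) V \<and> f x \<in> V \<and> (\<forall>y\<in>V. f (\<sigma> y) = y)"
  shows "submersion M N f"
  unfolding submersion_def
proof (intro conjI ballI)
  show "smooth_map M N f"
    by (rule smooth_mapI [OF M N f])
  fix x assume x: "x \<in> mpoints M"
  define c where "c = (SOME c. c \<in> charts_at M x)"
  have c: "c \<in> charts_at M x"
    unfolding c_def by (rule someI_ex [OF ex_charts_at [OF M x]])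
  note c' = charts_at_charts(1) [OF M c] charts_at_charts(2) [OF c]
  note fx = f [OF x]
  have diff: "differential M N f x u =
      (\<lambda>d\<in>charts_at N (f x). total_deriv (mdim M) (snd d \<circ> f \<circ> chart_inv c) (snd c x) (u c))" for u
    by (simp add: differential_def Let_def c_def [symmetric])
  have ch: "d \<in> charts N" "f x \<in> fst d" if "d \<in> charts_at N (f x)" for d
    by (rule charts_at_charts(1) [OF N that], rule charts_at_charts(2) [OF that])
  have idN: "smooth_at N N (\<lambda>y. y) (f x)"
    by (rule smooth_at_id [OF N smooth_at_in_mpoints(2) [OF fx]])
  show "differential M N f x ` tangent_vectors M x = tangent_vectors N (f x)"
  proof (intro equalityI subsetI)
    fix w assume "w \<in> differential M N f x ` tangent_vectors M x"
    then obtain u where w: "w = differential M N f x u" by blast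
    have wd: "w d = total_deriv (mdim M) (snd d \<circ> f \<circ> chart_inv c) (snd c x) (u c)"
      if "d \<in> charts_at N (f x)" for d
      using that by (simp add: w diff)
    have "w \<in> charts_at N (f x) \<rightarrow>\<^sub>E euclid (mdim N)"
      unfolding w diff restrict_PiE_iff
      by (intro ballI chart_rep_deriv_in_euclid [OF M N fx c'] ch)
    moreover have "w e = total_deriv (mdim N) (transition d e) (snd d (f x)) (w d)"
      if d: "d \<in> charts_at N (f x)" and e: "e \<in> charts_at N (f x)" for d e
    proof -
      have "total_deriv (mdim M) (snd e \<circ> ((\<lambda>y. y) \<circ> f) \<circ> chart_inv c) (snd c x) (u c) =
          total_deriv (mdim N) (snd e \<circ> (\<lambda>y. y) \<circ> chart_inv d) (snd d (f x))
            (total_deriv (mdim M) (snd d \<circ> f \<circ> chart_inv c) (snd c x) (u c))"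
        by (rule chart_rep_deriv_compose [OF M N N fx idN c' ch [OF d] ch [OF e]])
      moreover have "(\<lambda>y. y) \<circ> f = f" "snd e \<circ> (\<lambda>y. y) \<circ> chart_inv d = transition d e"
        by (simp_all add: o_def transition_def)
      ultimately show ?thesis
        using wd [OF d] wd [OF e] by metis
    qed
    ultimately show "w \<in> tangent_vectors N (f x)"
      unfolding tangent_vectors_def mem_Collect_eq by (intro conjI ballI)
  next
    fix w assume w: "w \<in> tangent_vectors N (f x)"
    obtain \<sigma> V where \<sigma>: "smooth_at N M \<sigma> (f x)" "\<sigma> (f x) = x"
      and V: "openin (mspace N) V" "f x \<in> V" "\<And>y. y \<in> V \<Longrightarrow> f (\<sigma> y) = y"
      using sec [OF x] by blast
    obtain e where e: "e \<in> charts_at N (f x)"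
      using ex_charts_at [OF N smooth_at_in_mpoints(2) [OF fx]] by blast
    define v where "v = total_deriv (mdim N) (snd c \<circ> \<sigma> \<circ> chart_inv e) (snd e (f x)) (w e)"
    have \<sigma>c: "\<sigma> (f x) \<in> fst c"
      using c'(2) \<sigma>(2) by simp
    have v: "v \<in> euclid (mdim M)"
      unfolding v_def by (rule chart_rep_deriv_in_euclid [OF N M \<sigma>(1) ch [OF e] c'(1) \<sigma>c])
    obtain u where u: "u \<in> tangent_vectors M x" "u c = v"
      by (rule ex_tangent_vector [OF M c v], rule that)
    have "differential M N f x u = w"
    proof (rule PiE_ext [of _ "charts_at N (f x)" "\<lambda>_. UNIV"])
      show "differential M N f x u \<in> charts_at N (f x) \<rightarrow>\<^sub>E UNIV"
        by (simp add: diff)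
      show "w \<in> charts_at N (f x) \<rightarrow>\<^sub>E UNIV"
        using conjunct1 [OF tangent_vectorsD [OF w]] by (auto simp: PiE_def)
      fix d assume d: "d \<in> charts_at N (f x)"
      have f\<sigma>: "smooth_at M N f (\<sigma> (f x))" "f (\<sigma> (f x)) \<in> fst d"
        using fx \<sigma>(2) ch(2) [OF d] by simp_all
      have "differential M N f x u d = total_deriv (mdim M) (snd d \<circ> f \<circ> chart_inv c) (snd c (\<sigma> (f x)))
          (total_deriv (mdim N) (snd c \<circ> \<sigma> \<circ> chart_inv e) (snd e (f x)) (w e))"
        using d by (simp add: diff u(2) v_def \<sigma>(2))
      also have "\<dots> = total_deriv (mdim N) (snd d \<circ> (f \<circ> \<sigma>) \<circ> chart_inv e) (snd e (f x)) (w e)"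
        by (rule chart_rep_deriv_compose [OF N M N \<sigma>(1) f\<sigma>(1) ch [OF e] c'(1) \<sigma>c ch(1) [OF d] f\<sigma>(2), symmetric])
      also have "\<dots> = total_deriv (mdim N) (snd d \<circ> (\<lambda>y. y) \<circ> chart_inv e) (snd e (f x)) (w e)"
        by (rule chart_rep_deriv_cong [OF ch [OF e] V(1,2)]) (simp add: V(3))
      also have "snd d \<circ> (\<lambda>y. y) \<circ> chart_inv e = transition e d"
        by (simp add: o_def transition_def)
      also have "total_deriv (mdim N) (transition e d) (snd e (f x)) (w e) = w d"
        by (rule tangent_vector_coords(2) [OF w e d, symmetric])
      finally show "differential M N f x u d = w d" .
    qed
    then show "w \<in> differential M N f x ` tangent_vectors M x"
      using u(1) by blast
  qed
qed


section \<open>Level sets and fibre products\<close>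

lemma openin_image_diffeo:
  assumes "diffeo_onto_image n V \<phi>" "openin (Euclidean_space n) W" "W \<subseteq> V"
  shows "openin (Euclidean_space n) (\<phi> ` W)"
proof (rule smooth_between_openin)
  show "smooth_between n n (\<phi> ` W) (inv_into W \<phi>)"
    using diffeo_onto_image_subset [OF assms] by (simp add: diffeo_onto_image_def)
qed

lemma charts_compose_diffeo:
  assumes N: "smooth_manifold N" and c: "c \<in> charts N" and \<phi>: "diffeo_onto_image (mdim N) V \<phi>"
    and V: "V \<subseteq> snd c ` fst c"
  shows "({x \<in> fst c. snd c x \<in> V}, \<phi> \<circ> snd c) \<in> charts N"
proof -
  note cc = charts_coord_chart [OF c]
  note inj = coord_chart_inj [OF cc]
  have \<phi>': "smooth_between (mdim N) (mdim N) V \<phi>" "inj_on \<phi> V"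
    "smooth_between (mdim N) (mdim N) (\<phi> ` V) (inv_into V \<phi>)"
    using \<phi> by (simp_all add: diffeo_onto_image_def)
  define D where "D = {x \<in> fst c. snd c x \<in> V}"
  define c' where "c' = (D, \<phi> \<circ> snd c)"
  have fst_c': "fst c' = D" and snd_c': "snd c' = \<phi> \<circ> snd c"
    by (simp_all add: c'_def)
  have D: "openin (mspace N) D" "D \<subseteq> fst c"
    unfolding D_def by (rule coord_chart_vimage [OF cc smooth_between_openin [OF \<phi>'(1)]]) auto
  have DV: "snd c ` W \<subseteq> V" if "W \<subseteq> D" for W
    using that by (auto simp: D_def)
  have inj': "inj_on (\<phi> \<circ> snd c) D"
    by (rule comp_inj_on [OF inj_on_subset [OF inj D(2)] inj_on_subset [OF \<phi>'(2) DV [OF order_refl]]])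
  have cc': "coord_chart (mspace N) (mdim N) c'"
    unfolding coord_chart_iff fst_c' snd_c'
  proof (intro conjI allI impI D(1) inj')
    show "(\<phi> \<circ> snd c) ` D \<subseteq> euclid (mdim N)"
      using smooth_between_in_euclid [OF \<phi>'(1)] by (auto simp: D_def)
    show "openin (mspace N) {x \<in> D. (\<phi> \<circ> snd c) x \<in> U}" if U: "openin (Euclidean_space (mdim N)) U" for U
    proof -
      have "{x \<in> D. (\<phi> \<circ> snd c) x \<in> U} = {x \<in> fst c. snd c x \<in> {y \<in> V. \<phi> y \<in> U}}"
        by (auto simp: D_def)
      then show ?thesis
        using coord_chart_vimage [OF cc openin_smooth_preimage [OF \<phi>'(1) U]] by simp
    qed
    show "openin (Euclidean_space (mdim N)) ((\<phi> \<circ> snd c) ` W)"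
      if W: "openin (mspace N) W \<and> W \<subseteq> D" for W
      unfolding image_comp [symmetric]
      by (rule openin_image_diffeo [OF \<phi> coord_chart_image [OF cc]]) (use W D DV in auto)
  qed
  have "compatible (mdim N) c' d" if dm: "d \<in> matlas N" for d
  proof -
    have d: "d \<in> charts N"
      by (rule matlas_in_charts [OF N dm])
    note dd = charts_coord_chart [OF d]
    define W where "W = D \<inter> fst d"
    have W: "openin (mspace N) W" "W \<subseteq> fst c" "W \<subseteq> fst d" "W \<subseteq> D"
      using D coord_chart_openin [OF dd] by (auto simp: W_def)
    have cW: "openin (Euclidean_space (mdim N)) (snd c ` W)"
      by (rule coord_chart_image [OF cc W(1,2)])
    have c'W: "snd c' ` W = \<phi> ` snd c ` W"
      by (simp add: snd_c' image_comp)
    have "openin (Euclidean_space (mdim N)) (snd c' ` W)"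
      unfolding c'W by (rule openin_image_diffeo [OF \<phi> cW DV [OF W(4)]])
    then have inv: "smooth_between (mdim N) (mdim N) (snd c' ` W) (inv_into V \<phi>)"
      by (rule smooth_between_subset [OF \<phi>'(3)]) (use DV [OF W(4)] c'W in auto)
    have inv_eq: "inv_into V \<phi> (snd c' z) = snd c z" "chart_inv c' (snd c' z) = z" "chart_inv c (snd c z) = z"
      "chart_inv d (snd d z) = z"
      if "z \<in> W" for z
      using that W DV [OF W(4)] chart_inv_left [OF inj, of z] chart_inv_left [OF coord_chart_inj [OF dd], of z]
        chart_inv_left [OF coord_chart_inj [OF cc'], of z] \<phi>'(2)
      by (auto simp: snd_c' fst_c' inv_into_f_f)
    have "smooth_between (mdim N) (mdim N) (snd c' ` W) ((snd d \<circ> (\<lambda>x. x) \<circ> chart_inv c) \<circ> inv_into V \<phi>)"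
      by (rule smooth_between_compose [OF inv smooth_transition [OF N c d W(1-3)]]) (use inv_eq in auto)
    then have "smooth_between (mdim N) (mdim N) (snd c' ` W) (transition c' d)"
      by (rule smooth_between_cong) (use inv_eq in \<open>auto simp: transition_def\<close>)
    moreover have "smooth_between (mdim N) (mdim N) (snd d ` W) (\<phi> \<circ> (snd c \<circ> (\<lambda>x. x) \<circ> chart_inv d))"
      by (rule smooth_between_compose [OF smooth_transition [OF N d c W(1,3,2)] \<phi>'(1)])
        (use inv_eq DV [OF W(4)] in auto)
    then have "smooth_between (mdim N) (mdim N) (snd d ` W) (transition d c')"
      by (simp add: transition_def snd_c' o_def)
    ultimately show ?thesis
      unfolding compatible_def fst_c' W_def [symmetric] by (rule conjI)
  qed
  then show ?thesis
    using cc' unfolding charts_def c'_def D_def by blast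
qed

text \<open>
  The implicit function theorem in the form needed for submanifolds: where the derivative of \<open>F\<close> is
  surjective, straightened coordinates are a slice chart of the zero set.
\<close>

lemma level_set_slice_chart:
  assumes N: "smooth_manifold N" and c: "c \<in> charts N" and z: "z \<in> fst c" "z \<in> S"
    and F: "smooth_between (mdim N) q (snd c ` fst c) F"
    and S: "\<And>x. x \<in> fst c \<Longrightarrow> x \<in> S \<longleftrightarrow> (\<forall>j<q. F (snd c x) j = 0)"
    and surj: "\<And>w. w \<in> euclid q \<Longrightarrow> \<exists>v. total_deriv (mdim N) F (snd c z) v = w"
  shows "\<exists>c'. slice_chart N S (mdim N - q) c' \<and> z \<in> fst c'"
proof -
  define n where "n = mdim N"
  note F = F [folded n_def] and surj = surj [folded n_def]
  obtain V \<phi> where V: "snd c z \<in> V" "V \<subseteq> snd c ` fst c" and \<phi>: "diffeo_onto_image n V \<phi>" and qn: "q \<le> n"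
    and \<phi>F: "\<And>x j. x \<in> V \<Longrightarrow> j < q \<Longrightarrow> \<phi> x (n - q + j) = F x j"
    by (rule submersion_normal_form [OF F imageI [OF z(1)] surj], assumption, rule that)
  define D where "D = {x \<in> fst c. snd c x \<in> V}"
  have chart: "(D, \<phi> \<circ> snd c) \<in> charts N"
    unfolding D_def by (rule charts_compose_diffeo [OF N c \<phi> [unfolded n_def] V(2)])
  have \<phi>e: "\<phi> y \<in> euclid n" if "y \<in> V" for y
    using \<phi> that smooth_between_in_euclid by (auto simp: diffeo_onto_image_def)
  have "x \<in> S \<longleftrightarrow> \<phi> (snd c x) \<in> euclid (n - q)" if x: "x \<in> D" for x
  proof -
    have xV: "snd c x \<in> V" "x \<in> fst c"
      using x by (simp_all add: D_def)
    have "\<phi> (snd c x) \<in> euclid (n - q) \<longleftrightarrow> (\<forall>j<q. \<phi> (snd c x) (n - q + j) = 0)"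
    proof
      assume zero: "\<forall>j<q. \<phi> (snd c x) (n - q + j) = 0"
      show "\<phi> (snd c x) \<in> euclid (n - q)"
        unfolding in_euclid
      proof (intro allI impI)
        fix i assume i: "n - q \<le> i"
        show "\<phi> (snd c x) i = 0"
        proof (cases "i < n")
          case True
          then have "i - (n - q) < q"
            using i qn by linarith
          then have "\<phi> (snd c x) (n - q + (i - (n - q))) = 0"
            using zero by blast
          then show ?thesis
            using i by simp
        next
          case False
          then show ?thesis
            using \<phi>e [OF xV(1)] by (simp add: in_euclid)
        qed
      qed
    qed (simp add: in_euclid)
    then show ?thesis
      using S [OF xV(2)] \<phi>F [OF xV(1)] by simp
  qed
  then have "(\<phi> \<circ> snd c) ` (D \<inter> S) = (\<phi> \<circ> snd c) ` D \<inter> euclid (n - q)"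
    by auto
  then have "slice_chart N S (mdim N - q) (D, \<phi> \<circ> snd c)"
    using chart by (simp add: slice_chart_def n_def)
  moreover have "z \<in> fst (D, \<phi> \<circ> snd c)"
    using z V(1) by (simp add: D_def)
  ultimately show ?thesis
    by (intro exI [of _ "(D, \<phi> \<circ> snd c)"] conjI)
qed

lemma total_deriv_affine:
  assumes "smooth_between m n U h" "x \<in> U"
  shows "total_deriv m (\<lambda>y j. a * h y j + k j) x v = (\<lambda>j. a * total_deriv m h x v j)"
proof
  fix j
  have "partial i (\<lambda>y. a * h y j + k j) x = a * partial i (\<lambda>y. h y j) x" if i: "i < m" for i
  proof (rule partial_eqI)
    have "((\<lambda>t. h (x(i := t)) j) has_real_derivative partial i (\<lambda>y. h y j) x) (at (x i))"
      by (rule Ck_on_has_partial [OF smooth_fn_Ck [OF smooth_between_component [OF assms(1)]] assms(2) i])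
    then have "((\<lambda>t. a * h (x(i := t)) j + k j) has_real_derivative a * partial i (\<lambda>y. h y j) x + 0) (at (x i))"
      by (intro DERIV_add DERIV_cmult DERIV_const)
    then show "((\<lambda>t. a * h (x(i := t)) j + k j) has_real_derivative a * partial i (\<lambda>y. h y j) x) (at (x i))"
      by simp
  qed
  then show "total_deriv m (\<lambda>y j. a * h y j + k j) x v j = a * total_deriv m h x v j"
    by (simp add: total_deriv_def sum_distrib_left mult.assoc)
qed

text \<open>
  This reduces surjectivity for a difference of two maps on a product to surjectivity for one of them:
  \<open>r\<close> is the inclusion of one factor at a fixed point of the other one, and \<open>a\<close> is the sign with which
  the map on that factor enters the difference.
\<close>

lemma surjective_total_deriv_along:
  assumes F: "smooth_between n q U F" and r: "smooth_between m n W r" and x: "x \<in> W" "r ` W \<subseteq> U"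
    and h: "smooth_between m q W h" and Fr: "\<And>y j. y \<in> W \<Longrightarrow> F (r y) j = a * h y j + k j" and a: "a \<noteq> 0"
    and surj: "\<And>w. w \<in> euclid q \<Longrightarrow> \<exists>v. total_deriv m h x v = w" and w: "w \<in> euclid q"
  shows "\<exists>v. total_deriv n F (r x) v = w"
proof -
  have "(\<lambda>j. w j / a) \<in> euclid q"
    using w by (simp add: in_euclid)
  then obtain v where v: "total_deriv m h x v = (\<lambda>j. w j / a)"
    using surj by blast
  have rx: "r x \<in> U"
    using x by blast
  have "total_deriv n F (r x) (total_deriv m r x v) = total_deriv m (F \<circ> r) x v"
    by (rule total_deriv_compose [OF r F x(1) rx, symmetric])
  also have "\<dots> = total_deriv m (\<lambda>y j. a * h y j + k j) x v"
  proof
    show "total_deriv m (F \<circ> r) x v j = total_deriv m (\<lambda>y j. a * h y j + k j) x v j" for j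
      by (rule total_deriv_cong [OF smooth_between_openin [OF r] x(1)]) (simp add: Fr)
  qed
  also have "\<dots> = w"
    using a by (simp add: total_deriv_affine [OF h x(1)] v)
  finally show ?thesis
    by (rule exI [of "\<lambda>v. total_deriv n F (r x) v = w"])
qed

definition fibre_set :: "'a manifold \<Rightarrow> 'b manifold \<Rightarrow> ('a \<Rightarrow> 'c) \<Rightarrow> ('b \<Rightarrow> 'c) \<Rightarrow> ('a \<times> 'b) set" where
  "fibre_set M N f g = {(x, y). x \<in> mpoints M \<and> y \<in> mpoints N \<and> f x = g y}"

lemma fibre_product_eq:
  "fibre_product M N B f g =
    embedded (product_manifold M N) (fibre_set M N f g) (mdim (product_manifold M N) - mdim B)"
  by (simp add: fibre_product_def fibre_set_def mdim_product)

lemma mpoints_fibre_product: "mpoints (fibre_product M N B f g) = fibre_set M N f g"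
  by (auto simp: fibre_product_eq mspace_embedded mspace_product fibre_set_def)

text \<open>
  In coordinates on the product and a chart \<open>e\<close> of \<open>B\<close>, the fibre product is the zero set of
  \<open>e \<circ> f - e \<circ> g\<close>. Its derivative is surjective as soon as the derivative of one of the two maps is.
\<close>

lemma smooth_manifold_fibre_product:
  assumes M: "smooth_manifold M" and N: "smooth_manifold N" and B: "smooth_manifold B"
    and f: "\<And>x. x \<in> mpoints M \<Longrightarrow> smooth_at M B f x" and g: "\<And>y. y \<in> mpoints N \<Longrightarrow> smooth_at N B g y"
    and sub: "submersion M B f \<or> submersion N B g"
  shows "smooth_manifold (fibre_product M N B f g)"
  unfolding fibre_product_eq
proof (rule smooth_manifold_embedded [OF smooth_manifold_product [OF M N] diff_le_self])
  define m n q where "m = mdim M" and "n = mdim N" and "q = mdim B"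
  fix z assume "z \<in> fibre_set M N f g"
  then obtain x y where z: "z = (x, y)" and xy: "x \<in> mpoints M" "y \<in> mpoints N" "f x = g y"
    by (auto simp: fibre_set_def)
  obtain e where e: "e \<in> charts_at B (f x)"
    using ex_charts_at [OF B smooth_at_in_mpoints(2) [OF f [OF xy(1)]]] by blast
  have e': "e \<in> charts B" "f x \<in> fst e" "g y \<in> fst e"
    using charts_at_charts(1) [OF B e] charts_at_charts(2) [OF e] xy(3) by simp_all
  note ee = charts_coord_chart [OF e'(1)]
  obtain c where c: "c \<in> charts M" "x \<in> fst c" and surj_f: "submersion M B f \<Longrightarrow> w \<in> euclid q \<Longrightarrow>
      \<exists>v. total_deriv m (snd e \<circ> f \<circ> chart_inv c) (snd c x) v = w" for w
  proof (cases "submersion M B f")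
    case True
    obtain c where "c \<in> charts M" "x \<in> fst c"
      "\<And>d w. d \<in> charts_at B (f x) \<Longrightarrow> w \<in> euclid (mdim B) \<Longrightarrow>
        \<exists>v. total_deriv (mdim M) (snd d \<circ> f \<circ> chart_inv c) (snd c x) v = w"
      by (rule submersion_in_charts [OF M B True xy(1)], rule that)
    then show thesis
      using that [of c] e by (simp add: m_def q_def)
  next
    case False
    then show thesis
      using that ex_matlas_chart [OF M xy(1)] by metis
  qed
  obtain d where d: "d \<in> charts N" "y \<in> fst d" and surj_g: "submersion N B g \<Longrightarrow> w \<in> euclid q \<Longrightarrow>
      \<exists>v. total_deriv n (snd e \<circ> g \<circ> chart_inv d) (snd d y) v = w" for w
  proof (cases "submersion N B g")
    case True
    obtain d where "d \<in> charts N" "y \<in> fst d"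
      "\<And>e w. e \<in> charts_at B (g y) \<Longrightarrow> w \<in> euclid (mdim B) \<Longrightarrow>
        \<exists>v. total_deriv (mdim N) (snd e \<circ> g \<circ> chart_inv d) (snd d y) v = w"
      by (rule submersion_in_charts [OF N B True xy(2)], rule that)
    then show thesis
      using that [of d] e xy(3) by (simp add: n_def q_def)
  next
    case False
    then show thesis
      using that ex_matlas_chart [OF N xy(2)] by metis
  qed
  note cc = charts_coord_chart [OF c(1)] and dd = charts_coord_chart [OF d(1)]
  note f' = f [OF xy(1)] and g' = g [OF xy(2)]
  obtain U where U: "openin (mspace M) U" "x \<in> U" "U \<subseteq> fst c" "f ` U \<subseteq> fst e"
    and sf: "smooth_between (mdim M) (mdim B) (snd c ` U) (snd e \<circ> f \<circ> chart_inv c)"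
    by (rule smooth_at_charts [OF M B f' c e'(1,2) openin_topspace smooth_at_in_mpoints(1) [OF f']
          openin_topspace smooth_at_in_mpoints(2) [OF f']], rule that)
  obtain V where V: "openin (mspace N) V" "y \<in> V" "V \<subseteq> fst d" "g ` V \<subseteq> fst e"
    and sg: "smooth_between (mdim N) (mdim B) (snd d ` V) (snd e \<circ> g \<circ> chart_inv d)"
    by (rule smooth_at_charts [OF N B g' d e'(1,3) openin_topspace smooth_at_in_mpoints(1) [OF g']
          openin_topspace smooth_at_in_mpoints(2) [OF g']], rule that)
  define ef eg where "ef = snd e \<circ> f \<circ> chart_inv c" and "eg = snd e \<circ> g \<circ> chart_inv d"
  note sf = sf [folded ef_def m_def q_def] and sg = sg [folded eg_def n_def q_def]
  note surj_f = surj_f [folded ef_def] and surj_g = surj_g [folded eg_def]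
  define p where "p = prod_chart m (U, snd c) (V, snd d)"
  have p: "p \<in> charts (product_manifold M N)"
    unfolding p_def m_def
    by (rule prod_chart_in_charts [OF M N charts_restrict [OF M c(1) U(1,3)] charts_restrict [OF N d(1) V(1,3)]])
  have fst_p: "fst p = U \<times> V" and snd_p: "snd p (x, y) = append_vec m (snd c x) (snd d y)" for x y
    by (simp_all add: p_def fst_prod_chart snd_prod_chart)
  have im_p: "snd p ` fst p = {append_vec m a b | a b. a \<in> snd c ` U \<and> b \<in> snd d ` V}"
    unfolding p_def fst_prod_chart prod_chart_image_Times by simp
  have O: "openin (Euclidean_space (m + n)) (snd p ` fst p)"
    unfolding im_p by (rule openin_append_vec [OF smooth_between_openin [OF sf] smooth_between_openin [OF sg]])
  have ce: "a \<in> euclid m" if "a \<in> snd c ` U" for a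
    using openin_subset_euclid [OF smooth_between_openin [OF sf] that] .
  define F where "F z = (\<lambda>j. ef (take_vec m z) j - eg (drop_vec m z) j)" for z
  have F_append: "F (append_vec m a b) j = ef a j - eg b j" if "a \<in> snd c ` U" for a b j
    by (simp add: F_def take_append_vec [OF ce [OF that]] drop_append_vec)
  have F: "smooth_between (m + n) q (snd p ` fst p) F"
  proof (rule smooth_betweenI [OF O])
    have t: "smooth_between (m + n) q (snd p ` fst p) (ef \<circ> take_vec m)"
      by (rule smooth_between_compose [OF smooth_between_take_vec [OF O] sf])
        (use ce in \<open>auto simp: im_p take_append_vec\<close>)
    have dr: "smooth_between (m + n) q (snd p ` fst p) (eg \<circ> drop_vec m)"
      by (rule smooth_between_compose [OF smooth_between_drop_vec [OF O] sg])
        (auto simp: im_p drop_append_vec)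
    show "F z \<in> euclid q" if "z \<in> snd p ` fst p" for z
      using smooth_between_in_euclid [OF t that] smooth_between_in_euclid [OF dr that]
      by (simp add: F_def in_euclid)
    show "smooth_fn (m + n) (snd p ` fst p) (\<lambda>z. F z j)" for j
      using smooth_fn_diff [OF smooth_between_component [OF t, of j] smooth_between_component [OF dr, of j]]
      by (simp add: F_def)
  qed
  have cl: "chart_inv c (snd c x) = x" if "x \<in> U" for x
    using that U(3) by (intro chart_inv_left [OF coord_chart_inj [OF cc]]) auto
  have dl: "chart_inv d (snd d y) = y" if "y \<in> V" for y
    using that V(3) by (intro chart_inv_left [OF coord_chart_inj [OF dd]]) auto
  have level: "x' \<in> fibre_set M N f g \<longleftrightarrow> (\<forall>j<q. F (snd p x') j = 0)" if x': "x' \<in> fst p" for x'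
  proof -
    obtain a b where ab: "x' = (a, b)" "a \<in> U" "b \<in> V"
      using x' fst_p by auto
    have fe: "f a \<in> fst e" "g b \<in> fst e"
      using ab U(4) V(4) by auto
    have pts: "a \<in> mpoints M" "b \<in> mpoints N"
      using ab openin_subset [OF U(1)] openin_subset [OF V(1)] by auto
    have "(\<forall>j<q. F (snd p x') j = 0) \<longleftrightarrow> (\<forall>j<q. snd e (f a) j = snd e (g b) j)"
      using ab F_append by (simp add: snd_p ef_def eg_def cl dl)
    also have "\<dots> \<longleftrightarrow> snd e (f a) = snd e (g b)"
    proof
      assume eq: "\<forall>j<q. snd e (f a) j = snd e (g b) j"
      show "snd e (f a) = snd e (g b)"
      proof
        show "snd e (f a) j = snd e (g b) j" for j
          using eq coord_chart_in_euclid [OF ee fe(1)] coord_chart_in_euclid [OF ee fe(2)]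
          by (cases "j < q") (simp_all add: in_euclid q_def)
      qed
    qed simp
    also have "\<dots> \<longleftrightarrow> f a = g b"
      by (rule inj_on_eq_iff [OF coord_chart_inj [OF ee] fe])
    finally show ?thesis
      using ab(1) pts by (simp add: fibre_set_def)
  qed
  have cx: "snd c x \<in> snd c ` U" and dy: "snd d y \<in> snd d ` V"
    using U(2) V(2) by auto
  have pz: "snd p z = append_vec m (snd c x) (snd d y)"
    by (simp add: z snd_p)
  have surj: "\<exists>v. total_deriv (m + n) F (snd p z) v = w" if w: "w \<in> euclid q" for w
    using sub
  proof
    assume s: "submersion M B f"
    show ?thesis
      unfolding pz
    proof (rule surjective_total_deriv_along [OF F _ cx _ sf _ _ surj_f [OF s] w,
          where a = 1 and k = "\<lambda>j. - eg (snd d y) j"])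
      show "smooth_between m (m + n) (snd c ` U) (\<lambda>a. append_vec m a (snd d y))"
        using coord_chart_in_euclid [OF dd d(2)] smooth_between_openin [OF sf]
        by (intro smooth_between_append_vec smooth_between_id smooth_between_const) (simp_all add: n_def)
    qed (use dy F_append im_p in auto)
  next
    assume s: "submersion N B g"
    show ?thesis
      unfolding pz
    proof (rule surjective_total_deriv_along [OF F _ dy _ sg _ _ surj_g [OF s] w,
          where a = "-1" and k = "\<lambda>j. ef (snd c x) j"])
      show "smooth_between n (m + n) (snd d ` V) (\<lambda>b. append_vec m (snd c x) b)"
        using ce [OF cx] smooth_between_openin [OF sg]
        by (intro smooth_between_append_vec smooth_between_id smooth_between_const)
    qed (use cx F_append im_p in auto)
  qed
  have zp: "z \<in> fst p" "z \<in> fibre_set M N f g"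
    using xy U(2) V(2) by (simp_all add: z fst_p fibre_set_def)
  show "\<exists>c. slice_chart (product_manifold M N) (fibre_set M N f g) (mdim (product_manifold M N) - mdim B) c \<and> z \<in> fst c"
    unfolding q_def [symmetric]
    by (rule level_set_slice_chart [OF smooth_manifold_product [OF M N] p zp])
      (use F level surj in \<open>simp_all add: mdim_product m_def n_def\<close>)
qed

section \<open>The tangent bundle\<close>

lemma fst_tangent_chart: "fst (tangent_chart M c) = (SIGMA x : fst c. tangent_vectors M x)"
  and snd_tangent_chart: "snd (tangent_chart M c) (x, u) = append_vec (mdim M) (snd c x) (u c)"
  by (simp_all add: tangent_chart_def)

lemma mspace_tangent_bundle: "mspace (tangent_bundle M) = topology_generated_by
    {{v \<in> fst (tangent_chart M c). snd (tangent_chart M c) v \<in> W} | c W.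
      c \<in> matlas M \<and> openin (Euclidean_space (mdim M + mdim M)) W}"
  and mdim_tangent_bundle: "mdim (tangent_bundle M) = mdim M + mdim M"
  and matlas_tangent_bundle: "matlas (tangent_bundle M) = tangent_chart M ` matlas M"
  by (simp_all add: tangent_bundle_def mult_2)

text \<open>
  The change of tangent coordinates induced by the change of coordinates \<open>t\<close>.
\<close>

definition tangent_transition :: "nat \<Rightarrow> (rvec \<Rightarrow> rvec) \<Rightarrow> rvec \<Rightarrow> rvec" where
  "tangent_transition m t z =
     append_vec m (t (take_vec m z)) (total_deriv m t (take_vec m z) (drop_vec m z))"

lemma smooth_tangent_transition:
  assumes t: "smooth_between m m U t"
  shows "smooth_between (m + m) (m + m) {append_vec m y v | y v. y \<in> U \<and> v \<in> euclid m} (tangent_transition m t)"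
proof -
  let ?O = "{append_vec m y v | y v. y \<in> U \<and> v \<in> euclid m}"
  have O: "openin (Euclidean_space (m + m)) ?O"
    by (rule openin_append_vec [OF smooth_between_openin [OF t]]) simp
  have take: "take_vec m z \<in> U" if z: "z \<in> ?O" for z
  proof -
    obtain y v where "z = append_vec m y v" "y \<in> U"
      using z by blast
    then show ?thesis
      using openin_subset_euclid [OF smooth_between_openin [OF t]] by (simp add: take_append_vec)
  qed
  have 1: "smooth_between (m + m) m ?O (\<lambda>z. t (take_vec m z))"
    using smooth_between_compose [OF smooth_between_take_vec [OF O] t] take by (simp add: o_def image_subset_iff)
  have 2: "smooth_between (m + m) m ?O (\<lambda>z. total_deriv m t (take_vec m z) (drop_vec m z))"
  proof (rule smooth_betweenI [OF O])
    show "total_deriv m t (take_vec m z) (drop_vec m z) \<in> euclid m" if "z \<in> ?O" for z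
      by (rule total_deriv_in_euclid [OF smooth_between_openin [OF t] take [OF that]])
        (use smooth_between_in_euclid [OF t] in auto)
    show "smooth_fn (m + m) ?O (\<lambda>z. total_deriv m t (take_vec m z) (drop_vec m z) j)" for j
      unfolding total_deriv_def
    proof (rule smooth_fn_sum [OF O], rule smooth_fn_mult)
      fix i assume i: "i < m"
      show "smooth_fn (m + m) ?O (\<lambda>z. partial i (\<lambda>y. t y j) (take_vec m z))"
        by (rule smooth_fn_compose [OF smooth_fn_partial [OF smooth_between_component [OF t] i] O])
          (use take smooth_between_component [OF smooth_between_take_vec [OF O]] in auto)
      show "smooth_fn (m + m) ?O (\<lambda>z. drop_vec m z i)"
        unfolding drop_vec_def by (rule smooth_fn_coordinate [OF O])
    qed
  qed
  show ?thesis
    using smooth_between_append_vec [OF 1 2] by (simp add: tangent_transition_def [abs_def])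
qed

lemma tangent_chart_change:
  assumes M: "smooth_manifold M" and c: "c \<in> charts_at M x" and d: "d \<in> charts_at M x"
    and u: "u \<in> tangent_vectors M x"
  shows "snd (tangent_chart M d) (x, u) =
    tangent_transition (mdim M) (transition c d) (snd (tangent_chart M c) (x, u))"
proof -
  have cx: "snd c x \<in> euclid (mdim M)"
    by (rule coord_chart_in_euclid [OF charts_coord_chart [OF charts_at_charts(1) [OF M c]] charts_at_charts(2) [OF c]])
  have "transition c d (snd c x) = snd d x"
    by (rule transition_at(1) [OF M charts_at_charts(1) [OF M c] charts_at_charts(2) [OF c]
          charts_at_charts(1) [OF M d] charts_at_charts(2) [OF d]])
  moreover have "total_deriv (mdim M) (transition c d) (snd c x) (u c) = u d"
    by (rule tangent_vector_coords(2) [OF u c d, symmetric])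
  ultimately show ?thesis
    by (simp only: tangent_transition_def snd_tangent_chart take_append_vec [OF cx] drop_append_vec)
qed

text \<open>
  Every vector occurs as the coordinate vector of a tangent vector, so images of tangent charts are full
  cylinders over chart images.
\<close>

lemma tangent_chart_image:
  assumes M: "smooth_manifold M" and c: "c \<in> matlas M" and W: "W \<subseteq> fst c"
  shows "snd (tangent_chart M c) ` (SIGMA x : W. tangent_vectors M x) =
    {append_vec (mdim M) y v | y v. y \<in> snd c ` W \<and> v \<in> euclid (mdim M)}" (is "?A = ?B")
proof (intro equalityI subsetI)
  have cat: "c \<in> charts_at M x" if "x \<in> W" for x
    using c W that by (auto simp: charts_at_iff)
  fix z assume "z \<in> ?A"
  then obtain x u where x: "x \<in> W" "u \<in> tangent_vectors M x" "z = snd (tangent_chart M c) (x, u)"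
    by blast
  have "u c \<in> euclid (mdim M)"
    by (rule tangent_vector_coords(1) [OF x(2) cat [OF x(1)]])
  then show "z \<in> ?B"
    unfolding x(3) snd_tangent_chart using x(1) by blast
next
  have cat: "c \<in> charts_at M x" if "x \<in> W" for x
    using c W that by (auto simp: charts_at_iff)
  fix z assume "z \<in> ?B"
  then obtain x v where x: "x \<in> W" "v \<in> euclid (mdim M)" "z = append_vec (mdim M) (snd c x) v"
    by blast
  obtain u where "u \<in> tangent_vectors M x" "u c = v"
    by (rule ex_tangent_vector [OF M cat [OF x(1)] x(2)], rule that)
  then show "z \<in> ?A"
    using x by (intro image_eqI [of _ _ "(x, u)"]) (simp_all add: snd_tangent_chart)
qed

lemma inj_on_tangent_chart:
  assumes M: "smooth_manifold M" and c: "c \<in> matlas M"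
  shows "inj_on (snd (tangent_chart M c)) (fst (tangent_chart M c))"
proof (rule inj_onI)
  note cc = matlas_coord_chart [OF M c]
  fix p q assume "p \<in> fst (tangent_chart M c)" "q \<in> fst (tangent_chart M c)"
    and eq: "snd (tangent_chart M c) p = snd (tangent_chart M c) q"
  then obtain x u y v where pq: "p = (x, u)" "q = (y, v)" and xy: "x \<in> fst c" "y \<in> fst c"
    and uv: "u \<in> tangent_vectors M x" "v \<in> tangent_vectors M y"
    unfolding fst_tangent_chart by blast
  have e: "append_vec (mdim M) (snd c x) (u c) = append_vec (mdim M) (snd c y) (v c)"
    using eq by (simp add: pq snd_tangent_chart)
  have "snd c x = snd c y"
    using arg_cong [OF e, of "take_vec (mdim M)"] xy coord_chart_in_euclid [OF cc] by (simp add: take_append_vec)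
  then have x: "x = y"
    by (rule inj_onD [OF coord_chart_inj [OF cc] _ xy])
  have "u c = v c"
    using arg_cong [OF e, of "drop_vec (mdim M)"] by (simp add: drop_append_vec)
  then have "u = v"
    by (rule tangent_vectors_eqI [OF uv(1) uv(2) [folded x], rotated]) (simp add: charts_at_iff c xy)
  then show "p = q"
    by (simp add: pq x)
qed

lemma openin_tangent_basis:
  assumes "c \<in> matlas M" "openin (Euclidean_space (mdim M + mdim M)) W"
  shows "openin (mspace (tangent_bundle M)) {v \<in> fst (tangent_chart M c). snd (tangent_chart M c) v \<in> W}"
  unfolding mspace_tangent_bundle
  by (rule topology_generated_by_Basis) (use assms in blast)

lemma tangent_chart_in_euclid:
  assumes "c \<in> matlas M" "p \<in> fst (tangent_chart M c)"
  shows "snd (tangent_chart M c) p \<in> euclid (mdim M + mdim M)"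
proof -
  obtain x u where p: "p = (x, u)" "x \<in> fst c" "u \<in> tangent_vectors M x"
    using assms(2) unfolding fst_tangent_chart by blast
  have "c \<in> charts_at M x"
    using assms(1) p(2) by (simp add: charts_at_iff)
  then show ?thesis
    unfolding p(1) snd_tangent_chart
    by (intro append_vec_in_euclid tangent_vector_coords(1) [OF p(3)])
qed

lemma openin_tangent_chart_domain:
  assumes "c \<in> matlas M"
  shows "openin (mspace (tangent_bundle M)) (fst (tangent_chart M c))"
proof -
  have "{v \<in> fst (tangent_chart M c). snd (tangent_chart M c) v \<in> euclid (mdim M + mdim M)} = fst (tangent_chart M c)"
    using tangent_chart_in_euclid [OF assms] by blast
  then show ?thesis
    using openin_tangent_basis [OF assms, of "euclid (mdim M + mdim M)"] by simp
qed

lemma inj_on_image_preimage: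
  assumes "inj_on f D" "A \<subseteq> D"
  shows "{v \<in> D. f v \<in> f ` A} = A"
  using assms by (auto simp: inj_on_def)

lemma openin_tangent_over:
  assumes M: "smooth_manifold M" and c: "c \<in> matlas M" and U: "openin (mspace M) U" "U \<subseteq> fst c"
  shows "openin (mspace (tangent_bundle M)) (SIGMA x : U. tangent_vectors M x)"
proof -
  let ?O = "snd (tangent_chart M c) ` (SIGMA x : U. tangent_vectors M x)"
  have sub: "(SIGMA x : U. tangent_vectors M x) \<subseteq> fst (tangent_chart M c)"
    unfolding fst_tangent_chart using U(2) by blast
  have "openin (Euclidean_space (mdim M + mdim M)) ?O"
    unfolding tangent_chart_image [OF M c U(2)]
    by (rule openin_append_vec [OF coord_chart_image [OF matlas_coord_chart [OF M c] U]]) simp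
  note openin_tangent_basis [OF c this]
  then show ?thesis
    unfolding inj_on_image_preimage [OF inj_on_tangent_chart [OF M c] sub] .
qed

lemma mpoints_tangent_bundle:
  assumes M: "smooth_manifold M"
  shows "mpoints (tangent_bundle M) = (SIGMA x : mpoints M. tangent_vectors M x)"
proof (intro equalityI subsetI)
  fix p assume "p \<in> mpoints (tangent_bundle M)"
  then obtain c where "c \<in> matlas M" "p \<in> fst (tangent_chart M c)"
    unfolding mspace_tangent_bundle topology_generated_by_topspace by blast
  then show "p \<in> (SIGMA x : mpoints M. tangent_vectors M x)"
    using chart_subset_mpoints [OF matlas_in_charts [OF M]] unfolding fst_tangent_chart by fast
next
  fix p assume "p \<in> (SIGMA x : mpoints M. tangent_vectors M x)"
  then obtain x u where p: "p = (x, u)" "x \<in> mpoints M" "u \<in> tangent_vectors M x"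
    by blast
  obtain c where c: "c \<in> matlas M" "x \<in> fst c"
    using ex_matlas_chart [OF M p(2)] by metis
  have "p \<in> fst (tangent_chart M c)"
    using p c(2) by (simp add: fst_tangent_chart)
  then show "p \<in> mpoints (tangent_bundle M)"
    using openin_subset [OF openin_tangent_chart_domain [OF c(1)]] by blast
qed

text \<open>
  The topology is generated by preimages of open sets under all tangent charts. That one
  tangent chart is an open map follows by induction over this generation; for a generator coming
  from another chart, the transition map between the two is continuous.
\<close>

lemma tangent_chart_open_image:
  assumes M: "smooth_manifold M" and c: "c \<in> matlas M" and W: "openin (mspace (tangent_bundle M)) W"
  shows "openin (Euclidean_space (mdim M + mdim M)) (snd (tangent_chart M c) ` (W \<inter> fst (tangent_chart M c)))"
proof -
  note inj = inj_on_tangent_chart [OF M c]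
  note cc = matlas_coord_chart [OF M c]
  have "generate_topology_on {{v \<in> fst (tangent_chart M c). snd (tangent_chart M c) v \<in> W} | c W.
      c \<in> matlas M \<and> openin (Euclidean_space (mdim M + mdim M)) W} W"
    using W by (simp only: mspace_tangent_bundle openin_topology_generated_by_iff)
  then show ?thesis
  proof (induction W)
    case Empty
    then show ?case by simp
  next
    case (Int a b)
    have "snd (tangent_chart M c) ` (a \<inter> b \<inter> fst (tangent_chart M c)) =
        snd (tangent_chart M c) ` ((a \<inter> fst (tangent_chart M c)) \<inter> (b \<inter> fst (tangent_chart M c)))"
      by (rule arg_cong [of _ _ "image _"]) blast
    also have "\<dots> = snd (tangent_chart M c) ` (a \<inter> fst (tangent_chart M c)) \<inter>
        snd (tangent_chart M c) ` (b \<inter> fst (tangent_chart M c))"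
      by (rule inj_on_image_Int [OF inj]) auto
    finally show ?case
      using Int.IH by (simp add: openin_Int)
  next
    case (UN K)
    have "snd (tangent_chart M c) ` (\<Union> K \<inter> fst (tangent_chart M c)) =
        (\<Union>k\<in>K. snd (tangent_chart M c) ` (k \<inter> fst (tangent_chart M c)))"
      by blast
    also have "openin (Euclidean_space (mdim M + mdim M)) \<dots>"
      by (rule openin_Union) (use UN.IH in auto)
    finally show ?case .
  next
    case (Basis s)
    then obtain d W where d: "d \<in> matlas M" and W: "openin (Euclidean_space (mdim M + mdim M)) W"
      and s: "s = {v \<in> fst (tangent_chart M d). snd (tangent_chart M d) v \<in> W}"
      by blast
    note dd = matlas_coord_chart [OF M d]
    let ?U = "fst c \<inter> fst d"
    let ?t = "tangent_transition (mdim M) (transition c d)"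
    let ?O = "{append_vec (mdim M) y v | y v. y \<in> snd c ` ?U \<and> v \<in> euclid (mdim M)}"
    have t: "smooth_between (mdim M) (mdim M) (snd c ` ?U) (transition c d)"
      using charts_compatible [OF M matlas_in_charts [OF M c] matlas_in_charts [OF M d]]
      by (simp add: compatible_def)
    have im: "?O = snd (tangent_chart M c) ` (SIGMA x : ?U. tangent_vectors M x)"
      by (rule tangent_chart_image [OF M c, symmetric]) auto
    have ch: "snd (tangent_chart M d) (x, u) = ?t (snd (tangent_chart M c) (x, u))"
      if "x \<in> ?U" "u \<in> tangent_vectors M x" for x u
      by (rule tangent_chart_change [OF M _ _ that(2)]) (use that c d in \<open>simp_all add: charts_at_iff\<close>)
    have "openin (Euclidean_space (mdim M + mdim M)) {z \<in> ?O. ?t z \<in> W}"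
      by (rule openin_smooth_preimage [OF smooth_tangent_transition [OF t] W])
    moreover have "snd (tangent_chart M c) ` (s \<inter> fst (tangent_chart M c)) = {z \<in> ?O. ?t z \<in> W}"
    proof (intro equalityI subsetI)
      fix z assume "z \<in> snd (tangent_chart M c) ` (s \<inter> fst (tangent_chart M c))"
      then obtain x u where xu: "x \<in> ?U" "u \<in> tangent_vectors M x" "snd (tangent_chart M d) (x, u) \<in> W"
          "z = snd (tangent_chart M c) (x, u)"
        unfolding s fst_tangent_chart by blast
      then show "z \<in> {z \<in> ?O. ?t z \<in> W}"
        unfolding im using ch [OF xu(1,2)] by auto
    next
      fix z assume z: "z \<in> {z \<in> ?O. ?t z \<in> W}"
      then obtain x u where xu: "x \<in> ?U" "u \<in> tangent_vectors M x" "z = snd (tangent_chart M c) (x, u)"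
        unfolding im by blast
      have "(x, u) \<in> s \<inter> fst (tangent_chart M c)"
        using xu z ch [OF xu(1,2)] unfolding s fst_tangent_chart by simp
      then show "z \<in> snd (tangent_chart M c) ` (s \<inter> fst (tangent_chart M c))"
        using xu(3) by blast
    qed
    ultimately show ?case by simp
  qed
qed

lemma coord_chart_tangent_chart:
  assumes M: "smooth_manifold M" and c: "c \<in> matlas M"
  shows "coord_chart (mspace (tangent_bundle M)) (mdim M + mdim M) (tangent_chart M c)"
  unfolding coord_chart_iff
proof (intro conjI allI impI openin_tangent_chart_domain [OF c] inj_on_tangent_chart [OF M c]
    openin_tangent_basis [OF c])
  show "snd (tangent_chart M c) ` fst (tangent_chart M c) \<subseteq> euclid (mdim M + mdim M)"
    using tangent_chart_in_euclid [OF c] by blast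
  show "openin (Euclidean_space (mdim M + mdim M)) (snd (tangent_chart M c) ` W)"
    if "openin (mspace (tangent_bundle M)) W \<and> W \<subseteq> fst (tangent_chart M c)" for W
    using tangent_chart_open_image [OF M c, of W] that by (simp add: Int_absorb2)
qed

lemma tangent_charts_compatible:
  assumes M: "smooth_manifold M" and c: "c \<in> matlas M" and d: "d \<in> matlas M"
  shows "compatible (mdim M + mdim M) (tangent_chart M c) (tangent_chart M d)"
proof -
  have half: "smooth_between (mdim M + mdim M) (mdim M + mdim M)
      (snd (tangent_chart M c) ` (fst (tangent_chart M c) \<inter> fst (tangent_chart M d)))
      (transition (tangent_chart M c) (tangent_chart M d))"
    if c: "c \<in> matlas M" and d: "d \<in> matlas M" for c d
  proof (rule smooth_between_cong)
    let ?U = "fst c \<inter> fst d"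
    have dom: "fst (tangent_chart M c) \<inter> fst (tangent_chart M d) = (SIGMA x : ?U. tangent_vectors M x)"
      unfolding fst_tangent_chart by blast
    have t: "smooth_between (mdim M) (mdim M) (snd c ` ?U) (transition c d)"
      using charts_compatible [OF M matlas_in_charts [OF M c] matlas_in_charts [OF M d]]
      by (simp add: compatible_def)
    have im: "snd (tangent_chart M c) ` (SIGMA x : ?U. tangent_vectors M x) =
        {append_vec (mdim M) y v | y v. y \<in> snd c ` ?U \<and> v \<in> euclid (mdim M)}"
      by (rule tangent_chart_image [OF M c]) auto
    show "smooth_between (mdim M + mdim M) (mdim M + mdim M)
        (snd (tangent_chart M c) ` (fst (tangent_chart M c) \<inter> fst (tangent_chart M d)))
        (tangent_transition (mdim M) (transition c d))"
      unfolding dom im by (rule smooth_tangent_transition [OF t])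
    fix z assume "z \<in> snd (tangent_chart M c) ` (fst (tangent_chart M c) \<inter> fst (tangent_chart M d))"
    then obtain x u where xu: "x \<in> ?U" "u \<in> tangent_vectors M x" "z = snd (tangent_chart M c) (x, u)"
      unfolding dom by blast
    have "chart_inv (tangent_chart M c) z = (x, u)"
      unfolding xu(3) using xu(1,2)
      by (intro chart_inv_left [OF inj_on_tangent_chart [OF M c]]) (simp add: fst_tangent_chart)
    moreover have "snd (tangent_chart M d) (x, u) = tangent_transition (mdim M) (transition c d) z"
      unfolding xu(3)
      by (rule tangent_chart_change [OF M _ _ xu(2)]) (use xu(1) c d in \<open>simp_all add: charts_at_iff\<close>)
    ultimately show "tangent_transition (mdim M) (transition c d) z =
        transition (tangent_chart M c) (tangent_chart M d) z"
      by (simp add: transition_def)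
  qed
  show ?thesis
    unfolding compatible_def using half [OF c d] half [OF d c] by (simp add: Int_commute)
qed

text \<open>
  Vectors at different points are separated over neighbourhoods of these points, vectors at the same
  point inside one tangent chart.
\<close>

lemma Hausdorff_tangent_bundle:
  assumes M: "smooth_manifold M"
  shows "Hausdorff_space (mspace (tangent_bundle M))"
  unfolding Hausdorff_space_def
proof (intro allI impI, elim conjE)
  fix p q assume "p \<in> mpoints (tangent_bundle M)" "q \<in> mpoints (tangent_bundle M)" and ne: "p \<noteq> q"
  then obtain x u y v where p: "p = (x, u)" "x \<in> mpoints M" "u \<in> tangent_vectors M x"
    and q: "q = (y, v)" "y \<in> mpoints M" "v \<in> tangent_vectors M y"
    unfolding mpoints_tangent_bundle [OF M] by blast
  obtain c where c: "c \<in> matlas M" "x \<in> fst c"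
    using ex_matlas_chart [OF M p(2)] by metis
  obtain d where d: "d \<in> matlas M" "y \<in> fst d"
    using ex_matlas_chart [OF M q(2)] by metis
  show "\<exists>U V. openin (mspace (tangent_bundle M)) U \<and> openin (mspace (tangent_bundle M)) V \<and>
      p \<in> U \<and> q \<in> V \<and> disjnt U V"
  proof (cases "x = y")
    case False
    have "Hausdorff_space (mspace M)"
      using M by (simp add: smooth_manifold_def)
    then obtain U V where UV: "openin (mspace M) U" "openin (mspace M) V" "x \<in> U" "y \<in> V" "disjnt U V"
      using p(2) q(2) False unfolding Hausdorff_space_def by meson
    have "openin (mspace (tangent_bundle M)) (SIGMA x : U \<inter> fst c. tangent_vectors M x)"
      by (rule openin_tangent_over [OF M c(1)])
        (use UV(1) coord_chart_openin [OF matlas_coord_chart [OF M c(1)]] in \<open>auto simp: openin_Int\<close>)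
    moreover have "openin (mspace (tangent_bundle M)) (SIGMA x : V \<inter> fst d. tangent_vectors M x)"
      by (rule openin_tangent_over [OF M d(1)])
        (use UV(2) coord_chart_openin [OF matlas_coord_chart [OF M d(1)]] in \<open>auto simp: openin_Int\<close>)
    moreover have "disjnt (SIGMA x : U \<inter> fst c. tangent_vectors M x) (SIGMA x : V \<inter> fst d. tangent_vectors M x)"
      using UV(5) unfolding disjnt_def by blast
    moreover have "p \<in> (SIGMA x : U \<inter> fst c. tangent_vectors M x)" "q \<in> (SIGMA x : V \<inter> fst d. tangent_vectors M x)"
      using p q UV c d by simp_all
    ultimately show ?thesis
      by (intro exI conjI)
  next
    case True
    let ?t = "tangent_chart M c"
    have pq: "p \<in> fst ?t" "q \<in> fst ?t"
      using p q c True by (simp_all add: fst_tangent_chart)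
    have "snd ?t p \<noteq> snd ?t q"
      using inj_onD [OF inj_on_tangent_chart [OF M c(1)] _ pq] ne by blast
    then obtain U V where UV: "openin (Euclidean_space (mdim M + mdim M)) U"
        "openin (Euclidean_space (mdim M + mdim M)) V" "snd ?t p \<in> U" "snd ?t q \<in> V" "disjnt U V"
      using Hausdorff_Euclidean_space [of "mdim M + mdim M"] tangent_chart_in_euclid [OF c(1) pq(1)]
        tangent_chart_in_euclid [OF c(1) pq(2)]
      unfolding Hausdorff_space_def by meson
    have "disjnt {v \<in> fst ?t. snd ?t v \<in> U} {v \<in> fst ?t. snd ?t v \<in> V}"
      using UV(5) unfolding disjnt_def by blast
    moreover have "p \<in> {v \<in> fst ?t. snd ?t v \<in> U}" "q \<in> {v \<in> fst ?t. snd ?t v \<in> V}"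
      using pq UV by simp_all
    ultimately show ?thesis
      using openin_tangent_basis [OF c(1) UV(1)] openin_tangent_basis [OF c(1) UV(2)]
      by (intro exI conjI)
  qed
qed

text \<open>
  An atlas may be uncountable; second countability of the manifold selects countably many charts
  that suffice.
\<close>

lemma countable_atlas_cover:
  assumes M: "smooth_manifold M"
  obtains C where "countable C" "C \<subseteq> matlas M" "\<And>x. x \<in> mpoints M \<Longrightarrow> \<exists>c\<in>C. x \<in> fst c"
proof -
  have "second_countable (mspace M)"
    using M by (simp add: smooth_manifold_def)
  then obtain A where A: "countable A"
      "\<And>U x. openin (mspace M) U \<Longrightarrow> x \<in> U \<Longrightarrow> \<exists>V\<in>A. x \<in> V \<and> V \<subseteq> U"
    unfolding second_countable_def by metis
  define A' where "A' = {V \<in> A. \<exists>c\<in>matlas M. V \<subseteq> fst c}"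
  define ch where "ch V = (SOME c. c \<in> matlas M \<and> V \<subseteq> fst c)" for V
  have ch: "ch V \<in> matlas M" "V \<subseteq> fst (ch V)" if "V \<in> A'" for V
  proof -
    have "\<exists>c. c \<in> matlas M \<and> V \<subseteq> fst c"
      using that by (auto simp only: A'_def mem_Collect_eq Bex_def)
    then have "ch V \<in> matlas M \<and> V \<subseteq> fst (ch V)"
      unfolding ch_def by (rule someI_ex)
    then show "ch V \<in> matlas M" "V \<subseteq> fst (ch V)"
      by simp_all
  qed
  show thesis
  proof (rule that [of "ch ` A'"])
    show "countable (ch ` A')"
      using A(1) by (simp add: A'_def)
    show "ch ` A' \<subseteq> matlas M"
      using ch(1) by blast
    fix x assume "x \<in> mpoints M"
    then obtain c where c: "c \<in> matlas M" "x \<in> fst c"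
      using ex_matlas_chart [OF M] by metis
    obtain V where V: "V \<in> A" "x \<in> V" "V \<subseteq> fst c"
      using A(2) [OF coord_chart_openin [OF matlas_coord_chart [OF M c(1)]] c(2)] by blast
    then have "V \<in> A'"
      using c(1) unfolding A'_def by blast
    then show "\<exists>c\<in>ch ` A'. x \<in> fst c"
      using ch(2) V(2) by blast
  qed
qed

lemma second_countable_tangent_bundle:
  assumes M: "smooth_manifold M"
  shows "second_countable (mspace (tangent_bundle M))"
proof -
  obtain C where C: "countable C" "C \<subseteq> matlas M" "\<And>x. x \<in> mpoints M \<Longrightarrow> \<exists>c\<in>C. x \<in> fst c"
    by (rule countable_atlas_cover [OF M], rule that)
  obtain B :: "rvec set set" where B: "countable B" "topological_basis B"
    using ex_countable_basis by blast
  define E where "E c b = {v \<in> fst (tangent_chart M c). snd (tangent_chart M c) v \<in> b \<inter> euclid (mdim M + mdim M)}" for c b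
  show ?thesis
    unfolding second_countable_def
  proof (intro exI [of _ "(\<lambda>(c, b). E c b) ` (C \<times> B)"] conjI ballI allI impI, goal_cases)
    case 1
    show ?case
      using C(1) B(1) by blast
  next
    case (2 V)
    then obtain c b where cb: "c \<in> C" "b \<in> B" "V = E c b"
      by blast
    have "openin (Euclidean_space (mdim M + mdim M)) (b \<inter> euclid (mdim M + mdim M))"
      unfolding openin_Euclidean_open using topological_basis_open [OF B(2) cb(2)] by blast
    then show ?case
      unfolding cb(3) E_def using cb(1) C(2) by (intro openin_tangent_basis) auto
  next
    case (3 W p)
    then have W: "openin (mspace (tangent_bundle M)) W" "p \<in> W"
      by simp_all
    then have "p \<in> mpoints (tangent_bundle M)"
      using openin_subset by blast
    then obtain x u where p: "p = (x, u)" "x \<in> mpoints M" "u \<in> tangent_vectors M x"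
      unfolding mpoints_tangent_bundle [OF M] by blast
    obtain c where c: "c \<in> C" "x \<in> fst c"
      using C(3) [OF p(2)] by blast
    have cM: "c \<in> matlas M"
      using c(1) C(2) by blast
    let ?t = "tangent_chart M c"
    have pt: "p \<in> fst ?t"
      using p c(2) by (simp add: fst_tangent_chart)
    obtain T where T: "open T" "snd ?t ` (W \<inter> fst ?t) = T \<inter> euclid (mdim M + mdim M)"
      using tangent_chart_open_image [OF M cM W(1)] by (auto simp only: openin_Euclidean_open)
    have "snd ?t p \<in> snd ?t ` (W \<inter> fst ?t)"
      using W(2) pt by blast
    then have "snd ?t p \<in> T"
      using T(2) by blast
    then obtain b where b: "b \<in> B" "snd ?t p \<in> b" "b \<subseteq> T"
      by (rule topological_basisE [OF B(2) T(1)])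
    have "E c b \<subseteq> W"
    proof
      fix v assume v: "v \<in> E c b"
      then have "snd ?t v \<in> snd ?t ` (W \<inter> fst ?t)"
        unfolding T(2) using b(3) by (auto simp only: E_def mem_Collect_eq)
      moreover have "v \<in> fst ?t"
        using v by (simp add: E_def)
      ultimately show "v \<in> W"
        using inj_on_image_mem_iff [OF inj_on_tangent_chart [OF M cM], of v "W \<inter> fst ?t"] by simp
    qed
    moreover have "p \<in> E c b"
      using pt b(2) tangent_chart_in_euclid [OF cM pt] by (simp add: E_def)
    moreover have "E c b \<in> (\<lambda>(c, b). E c b) ` (C \<times> B)"
      using c(1) b(1) by (intro image_eqI [of _ _ "(c, b)"]) simp_all
    ultimately show ?case
      by (intro bexI [of _ "E c b"] conjI)
  qed
qed

lemma smooth_manifold_tangent_bundle: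
  assumes M: "smooth_manifold M"
  shows "smooth_manifold (tangent_bundle M)"
  unfolding smooth_manifold_def mdim_tangent_bundle matlas_tangent_bundle
proof (intro conjI ballI Hausdorff_tangent_bundle [OF M] second_countable_tangent_bundle [OF M])
  fix c assume "c \<in> tangent_chart M ` matlas M"
  then obtain c' where c': "c' \<in> matlas M" "c = tangent_chart M c'" by blast
  show "coord_chart (mspace (tangent_bundle M)) (mdim M + mdim M) c"
    unfolding c'(2) by (rule coord_chart_tangent_chart [OF M c'(1)])
  fix d assume "d \<in> tangent_chart M ` matlas M"
  then obtain d' where d': "d' \<in> matlas M" "d = tangent_chart M d'" by blast
  show "compatible (mdim M + mdim M) c d"
    unfolding c'(2) d'(2) by (rule tangent_charts_compatible [OF M c'(1) d'(1)])
next
  have "\<Union> (fst ` matlas M) = mpoints M"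
    using M by (simp add: smooth_manifold_def)
  then show "\<Union> (fst ` tangent_chart M ` matlas M) = mpoints (tangent_bundle M)"
    unfolding mpoints_tangent_bundle [OF M] image_image fst_tangent_chart by blast
qed

lemma smooth_at_tangent_projection:
  assumes M: "smooth_manifold M" and p: "p \<in> mpoints (tangent_bundle M)"
  shows "smooth_at (tangent_bundle M) M fst p"
proof -
  obtain x u where xu: "p = (x, u)" "x \<in> mpoints M" "u \<in> tangent_vectors M x"
    using p unfolding mpoints_tangent_bundle [OF M] by blast
  obtain c where c: "c \<in> matlas M" "c \<in> charts M" "x \<in> fst c"
    by (rule ex_matlas_chart [OF M xu(2)], rule that)
  let ?t = "tangent_chart M c"
  have t: "?t \<in> charts (tangent_bundle M)"
    by (rule matlas_in_charts [OF smooth_manifold_tangent_bundle [OF M]])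
      (simp add: matlas_tangent_bundle c(1))
  note tt = coord_chart_tangent_chart [OF M c(1)]
  have O: "openin (Euclidean_space (mdim M + mdim M)) (snd ?t ` fst ?t)"
    by (rule coord_chart_image [OF tt coord_chart_openin [OF tt] order_refl])
  have rep: "smooth_between (mdim (tangent_bundle M)) (mdim M) (snd ?t ` fst ?t) (snd c \<circ> fst \<circ> chart_inv ?t)"
    unfolding mdim_tangent_bundle
  proof (rule smooth_between_cong [OF smooth_between_take_vec [OF O]])
    fix z assume "z \<in> snd ?t ` fst ?t"
    then obtain y v where yv: "y \<in> fst c" "v \<in> tangent_vectors M y" "z = snd ?t (y, v)"
      unfolding fst_tangent_chart by blast
    have "chart_inv ?t z = (y, v)"
      unfolding yv(3) using yv(1,2)
      by (intro chart_inv_left [OF coord_chart_inj [OF tt]]) (simp add: fst_tangent_chart)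
    then show "take_vec (mdim M) z = (snd c \<circ> fst \<circ> chart_inv ?t) z"
      using coord_chart_in_euclid [OF charts_coord_chart [OF c(2)] yv(1)]
      by (simp add: yv(3) snd_tangent_chart take_append_vec)
  qed
  have "p \<in> fst ?t" "fst ` fst ?t \<subseteq> fst c"
    using xu c(3) by (auto simp: fst_tangent_chart)
  then show ?thesis
    by (rule smooth_atI [OF t c(2) openin_tangent_chart_domain [OF c(1)] _ order_refl _ rep])
qed

section \<open>Mapping properties of fibre products\<close>

lemma fibre_set_iff: "(x, y) \<in> fibre_set M N f g \<longleftrightarrow> x \<in> mpoints M \<and> y \<in> mpoints N \<and> f x = g y"
  by (simp add: fibre_set_def)

lemma smooth_at_fibre_product_projections:
  assumes M: "smooth_manifold M" and N: "smooth_manifold N"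
    and FP: "smooth_manifold (fibre_product M N B f g)" and z: "z \<in> mpoints (fibre_product M N B f g)"
  shows "smooth_at (fibre_product M N B f g) M fst z"
    and "smooth_at (fibre_product M N B f g) N snd z"
proof -
  obtain x y where xy: "z = (x, y)" "x \<in> mpoints M" "y \<in> mpoints N"
    using z unfolding mpoints_fibre_product fibre_set_def by blast
  note MN = smooth_manifold_product [OF M N]
  have incl: "smooth_at (fibre_product M N B f g) (product_manifold M N) (\<lambda>z. z) z"
    using smooth_at_inclusion [OF MN _ diff_le_self] FP z unfolding fibre_product_eq by blast
  have "smooth_at (fibre_product M N B f g) M (fst \<circ> (\<lambda>z. z)) z"
    by (rule smooth_at_compose [OF FP MN incl]) (simp add: xy smooth_at_fst_snd [OF M N])
  then show "smooth_at (fibre_product M N B f g) M fst z"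
    by (simp add: o_def)
  have "smooth_at (fibre_product M N B f g) N (snd \<circ> (\<lambda>z. z)) z"
    by (rule smooth_at_compose [OF FP MN incl]) (simp add: xy smooth_at_fst_snd [OF M N])
  then show "smooth_at (fibre_product M N B f g) N snd z"
    by (simp add: o_def)
qed

text \<open>
  The universal property of fibre products, in pointwise form.
\<close>

lemma smooth_at_into_fibre_product:
  assumes K: "smooth_manifold K" and M: "smooth_manifold M" and N: "smooth_manifold N"
    and FP: "smooth_manifold (fibre_product M N B f g)"
    and u: "smooth_at K M u x" and v: "smooth_at K N v x"
    and U: "openin (mspace K) U" "x \<in> U" and eq: "\<And>y. y \<in> U \<Longrightarrow> f (u y) = g (v y)"
  shows "smooth_at K (fibre_product M N B f g) (\<lambda>y. (u y, v y)) x"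
proof -
  obtain U1 where U1: "openin (mspace K) U1" "x \<in> U1" "u ` U1 \<subseteq> mpoints M"
    by (rule smooth_at_preimage [OF u openin_topspace smooth_at_in_mpoints(2) [OF u]], rule that)
  obtain U2 where U2: "openin (mspace K) U2" "x \<in> U2" "v ` U2 \<subseteq> mpoints N"
    by (rule smooth_at_preimage [OF v openin_topspace smooth_at_in_mpoints(2) [OF v]], rule that)
  have W: "openin (mspace K) (U \<inter> U1 \<inter> U2)" "x \<in> U \<inter> U1 \<inter> U2"
    using U U1 U2 by (auto intro!: openin_Int)
  have im: "(\<lambda>y. (u y, v y)) ` (U \<inter> U1 \<inter> U2) \<subseteq> fibre_set M N f g"
    using U1(3) U2(3) eq by (auto simp: fibre_set_def)
  show ?thesis
    unfolding fibre_product_eq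
    by (rule smooth_at_into_embedded [OF K smooth_manifold_product [OF M N] FP [unfolded fibre_product_eq]
          smooth_at_Pair [OF K M N u v] W im])
qed

text \<open>
  A local section \<open>\<tau>\<close> of \<open>g\<close> pulls back to the local section \<open>x \<mapsto> (x, \<tau> (f x))\<close> of the projection.
\<close>

lemma submersion_base_change:
  assumes M: "smooth_manifold M" and N: "smooth_manifold N" and B: "smooth_manifold B"
    and f: "\<And>x. x \<in> mpoints M \<Longrightarrow> smooth_at M B f x" and g: "submersion N B g"
  shows "submersion (fibre_product M N B f g) M fst"
proof -
  have FP: "smooth_manifold (fibre_product M N B f g)"
    by (rule smooth_manifold_fibre_product [OF M N B f submersion_smooth_at [OF N B g] disjI2 [OF g]])
  show ?thesis
  proof (rule submersionI [OF FP M])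
    fix z assume z: "z \<in> mpoints (fibre_product M N B f g)"
    show "smooth_at (fibre_product M N B f g) M fst z"
      by (rule smooth_at_fibre_product_projections(1) [OF M N FP z])
    obtain x y where xy: "z = (x, y)" "x \<in> mpoints M" "y \<in> mpoints N" "f x = g y"
      using z unfolding mpoints_fibre_product fibre_set_def by blast
    obtain \<tau> V where \<tau>: "smooth_at B N \<tau> (g y)" "\<tau> (g y) = y" and V: "openin (mspace B) V" "g y \<in> V"
      "\<And>b. b \<in> V \<Longrightarrow> g (\<tau> b) = b"
      by (rule submersion_local_section [OF N B g xy(3)], rule that)
    note fx = f [OF xy(2)]
    obtain U where U: "openin (mspace M) U" "x \<in> U" "f ` U \<subseteq> V"
      by (rule smooth_at_preimage [OF fx V(1) V(2) [folded xy(4)]], rule that)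
    have 1: "smooth_at M M (\<lambda>x. x) x"
      by (rule smooth_at_id [OF M xy(2)])
    have 2: "smooth_at M N (\<tau> \<circ> f) x"
      by (rule smooth_at_compose [OF M B fx]) (simp add: xy(4) \<tau>(1))
    have "smooth_at M (fibre_product M N B f g) (\<lambda>x'. (x', (\<tau> \<circ> f) x')) x"
      by (rule smooth_at_into_fibre_product [OF M M N FP 1 2 U(1,2)]) (use V(3) U(3) in auto)
    then show "\<exists>\<sigma> V. smooth_at M (fibre_product M N B f g) \<sigma> (fst z) \<and> \<sigma> (fst z) = z \<and>
        openin (mspace M) V \<and> fst z \<in> V \<and> (\<forall>y\<in>V. fst (\<sigma> y) = y)"
      using U(1,2) by (intro exI [of _ "\<lambda>x'. (x', (\<tau> \<circ> f) x')"] exI [of _ U]) (simp add: xy \<tau>(2))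
  qed
qed

section \<open>Diffeologies of manifolds\<close>

lemma mspace_open_euclid: "mspace (open_euclid_manifold n U) = subtopology (Euclidean_space n) U"
  and mdim_open_euclid: "mdim (open_euclid_manifold n U) = n"
  and matlas_open_euclid: "matlas (open_euclid_manifold n U) = {(U, id)}"
  by (simp_all add: open_euclid_manifold_def)

lemma openin_open_euclid:
  "openin (Euclidean_space n) U \<Longrightarrow>
    openin (mspace (open_euclid_manifold n U)) W \<longleftrightarrow> openin (Euclidean_space n) W \<and> W \<subseteq> U"
  by (simp add: mspace_open_euclid openin_open_subtopology)

lemma mpoints_open_euclid: "openin (Euclidean_space n) U \<Longrightarrow> mpoints (open_euclid_manifold n U) = U"
  using openin_subset by (fastforce simp: mspace_open_euclid)

lemma second_countable_Euclidean_space: "second_countable (Euclidean_space n)"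
proof -
  obtain B :: "rvec set set" where B: "countable B" "topological_basis B"
    using ex_countable_basis by blast
  show ?thesis
    unfolding second_countable_def
  proof (intro exI [of _ "(\<lambda>b. b \<inter> euclid n) ` B"] conjI ballI allI impI, goal_cases)
    case 1
    show ?case using B(1) by simp
  next
    case (2 V)
    then show ?case
      unfolding openin_Euclidean_open using topological_basis_open [OF B(2)] by blast
  next
    case (3 W x)
    then obtain T where T: "open T" "W = T \<inter> euclid n" and x: "x \<in> W"
      by (auto simp: openin_Euclidean_open)
    then have "x \<in> T" by blast
    then obtain b where "b \<in> B" "x \<in> b" "b \<subseteq> T"
      by (rule topological_basisE [OF B(2) T(1)])
    then show ?case
      using T(2) x by (intro bexI [of _ "b \<inter> euclid n"]) auto
  qed
qed

text \<open>
  Treating the domain of a plot as a manifold turns plots into smooth maps, so that statements about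
  diffeologies become instances of \<open>smooth_at_compose\<close>.
\<close>

lemma smooth_manifold_open_euclid:
  assumes U: "openin (Euclidean_space n) U"
  shows "smooth_manifold (open_euclid_manifold n U)"
  unfolding smooth_manifold_def mspace_open_euclid mdim_open_euclid matlas_open_euclid
proof (intro conjI ballI)
  show "Hausdorff_space (subtopology (Euclidean_space n) U)"
    by (rule Hausdorff_space_subtopology [OF Hausdorff_Euclidean_space])
  have "Abstract_Topological_Spaces.second_countable (Euclidean_space n)"
    using second_countable_Euclidean_space
    by (simp add: Abstract_Topological_Spaces.second_countable_def Defs.second_countable_def)
  then show "second_countable (subtopology (Euclidean_space n) U)"
    using second_countable_subtopology [of "Euclidean_space n" U]
    by (simp add: Abstract_Topological_Spaces.second_countable_def Defs.second_countable_def)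
  show "coord_chart (subtopology (Euclidean_space n) U) n c" if "c \<in> {(U, id)}" for c
  proof -
    have "{x \<in> U. x \<in> W} = U \<inter> W" for W by blast
    moreover have c: "c = (U, id)"
      using that by simp
    ultimately show ?thesis
      unfolding coord_chart_iff c fst_conv snd_conv using U openin_subset [OF U]
      by (simp add: openin_open_subtopology openin_Int)
  qed
  show "\<Union> (fst ` {(U, id)}) = topspace (subtopology (Euclidean_space n) U)"
    using openin_subset [OF U] by auto
  show "compatible n c d" if "c \<in> {(U, id)}" "d \<in> {(U, id)}" for c d
  proof -
    have "smooth_between n n U (transition (U, id) (U, id))"
      by (rule smooth_between_cong [OF smooth_between_id [OF U]])
        (simp add: transition_def chart_inv_right [of _ "(U, id)", simplified])
    then show ?thesis
      using that by (simp add: compatible_def)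
  qed
qed

lemma open_euclid_chart:
  "openin (Euclidean_space n) U \<Longrightarrow> (U, id) \<in> charts (open_euclid_manifold n U)"
  by (rule matlas_in_charts [OF smooth_manifold_open_euclid]) (simp_all add: matlas_open_euclid)

lemma smooth_at_open_euclid:
  assumes U: "openin (Euclidean_space m) U" and V: "openin (Euclidean_space n) V"
    and h: "smooth_between m n W h" and x: "x \<in> W" "W \<subseteq> U" "h ` W \<subseteq> V"
  shows "smooth_at (open_euclid_manifold m U) (open_euclid_manifold n V) h x"
proof (rule smooth_atI [OF open_euclid_chart [OF U] open_euclid_chart [OF V] _ x(1)])
  show "openin (mspace (open_euclid_manifold m U)) W"
    using smooth_between_openin [OF h] x(2) by (simp add: openin_open_euclid [OF U])
  have "chart_inv (U, id) y = y" if "y \<in> W" for y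
    using chart_inv_right [of y "(U, id)"] that x(2) by auto
  then show "smooth_between (mdim (open_euclid_manifold m U)) (mdim (open_euclid_manifold n V))
      (snd (U, id) ` W) (snd (V, id) \<circ> h \<circ> chart_inv (U, id))"
    unfolding mdim_open_euclid by (simp, intro smooth_between_cong [OF h]) simp
qed (use x in simp_all)

lemma manifold_plots_iff:
  assumes M: "smooth_manifold M"
  shows "manifold_plots M n U p \<longleftrightarrow> openin (Euclidean_space n) U \<and>
    (\<forall>x\<in>U. smooth_at (open_euclid_manifold n U) M p x)"
  unfolding manifold_plots_def
proof (rule conj_cong [OF refl])
  assume U: "openin (Euclidean_space n) U"
  note E = smooth_manifold_open_euclid [OF U]
  show "smooth_map (open_euclid_manifold n U) M p \<longleftrightarrow>
      (\<forall>x\<in>U. smooth_at (open_euclid_manifold n U) M p x)"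
    using smooth_map_imp_smooth_at [OF E M, of p] smooth_mapI [OF E M, of p]
    by (auto simp: mpoints_open_euclid [OF U])
qed

lemma diffeology_manifold_plots:
  assumes M: "smooth_manifold M"
  shows "diffeology (mpoints M) (manifold_plots M)"
  unfolding diffeology_def manifold_plots_iff [OF M]
proof (intro conjI allI impI, goal_cases)
  case (1 n U p)
  then show ?case by simp
next
  case (2 n U p)
  show ?case
  proof (rule image_subsetI)
    fix x assume "x \<in> U"
    then have "smooth_at (open_euclid_manifold n U) M p x"
      using 2 by blast
    then show "p x \<in> mpoints M"
      by (rule smooth_at_in_mpoints(2))
  qed
next
  case (3 n U x)
  then show ?case by simp
next
  case (4 n U x)
  then have U: "openin (Euclidean_space n) U" and x: "x \<in> mpoints M"
    by simp_all
  show ?case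
    by (intro ballI smooth_at_const [OF smooth_manifold_open_euclid [OF U] M _ x])
      (simp add: mpoints_open_euclid [OF U])
next
  case (5 m n U V p q h)
  then show ?case by (elim conjE) (rule smooth_between_openin)
next
  case (6 m n U V p q h)
  then have U: "openin (Euclidean_space n) U" and p: "\<And>x. x \<in> U \<Longrightarrow> smooth_at (open_euclid_manifold n U) M p x"
    and h: "smooth_between m n V h" "h ` V \<subseteq> U" and q: "\<And>x. x \<in> V \<Longrightarrow> q x = p (h x)"
    by blast+
  note V = smooth_between_openin [OF h(1)]
  show ?case
  proof
    fix x assume x: "x \<in> V"
    have "smooth_at (open_euclid_manifold m V) M (p \<circ> h) x"
      by (rule smooth_at_compose [OF smooth_manifold_open_euclid [OF V] smooth_manifold_open_euclid [OF U]
            smooth_at_open_euclid [OF V U h(1) x order_refl h(2)] p]) (use h(2) x in blast)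
    then show "smooth_at (open_euclid_manifold m V) M q x"
      by (rule smooth_at_cong [where U = V]) (use x V q in \<open>simp_all add: openin_open_euclid\<close>)
  qed
next
  case (7 n U p)
  then show ?case by simp
next
  case (8 n U p)
  then have U: "openin (Euclidean_space n) U" by simp
  show ?case
  proof
    fix x assume "x \<in> U"
    then obtain V where V: "x \<in> V" "V \<subseteq> U" "openin (Euclidean_space n) V"
        "\<And>x. x \<in> V \<Longrightarrow> smooth_at (open_euclid_manifold n V) M p x"
      using 8 by meson
    have "smooth_at (open_euclid_manifold n U) (open_euclid_manifold n V) (\<lambda>x. x) x"
      by (rule smooth_at_open_euclid [OF U V(3) smooth_between_id [OF V(3)] V(1,2)]) simp
    then have "smooth_at (open_euclid_manifold n U) M (p \<circ> (\<lambda>x. x)) x"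
      by (rule smooth_at_compose [OF smooth_manifold_open_euclid [OF U] smooth_manifold_open_euclid [OF V(3)]])
        (rule V(4) [OF V(1)])
    then show "smooth_at (open_euclid_manifold n U) M p x"
      by (simp add: o_def)
  qed
qed

lemma diffeo_smooth_manifold_plots:
  assumes M: "smooth_manifold M" and N: "smooth_manifold N" and f: "\<And>x. x \<in> mpoints M \<Longrightarrow> smooth_at M N f x"
  shows "diffeo_smooth (manifold_plots M) (manifold_plots N) f"
  unfolding diffeo_smooth_def manifold_plots_iff [OF M] manifold_plots_iff [OF N]
proof (intro allI impI conjI ballI, goal_cases)
  case (1 n U p)
  then show ?case by simp
next
  case (2 n U p x)
  then have U: "openin (Euclidean_space n) U" and p: "smooth_at (open_euclid_manifold n U) M p x"
    by blast+
  show ?case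
    by (rule smooth_at_compose [where f = p and x = x, OF smooth_manifold_open_euclid [OF U] M p f [OF smooth_at_in_mpoints(2) [OF p]]])
qed

text \<open>
  Smooth maps send plots to plots. For the composition, a plot of composable pairs is a smooth map into
  the fibre product, since both of its components are smooth.
\<close>

lemma lie_groupoid_imp_diffeological:
  assumes G: "lie_groupoid G X0 X1"
  shows "diffeological_groupoid G (manifold_plots X0) (manifold_plots X1)"
proof -
  have g: "is_groupoid G" "Obj G = mpoints X0" "Arr G = mpoints X1" and X0: "smooth_manifold X0"
    and X1: "smooth_manifold X1" and s: "submersion X1 X0 (src G)" and t: "submersion X1 X0 (tgt G)"
    and c: "smooth_map (fibre_product X1 X1 X0 (src G) (tgt G)) X1 (\<lambda>(g, h). gcomp G g h)"
    and u: "smooth_map X0 X1 (unit_arr G)" and i: "smooth_map X1 X1 (inv_arr G)"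
    using G by (simp_all add: lie_groupoid_def)
  note s' = submersion_smooth_at [OF X1 X0 s] and t' = submersion_smooth_at [OF X1 X0 t]
  have FP: "smooth_manifold (fibre_product X1 X1 X0 (src G) (tgt G))"
    by (rule smooth_manifold_fibre_product [OF X1 X1 X0 s' t' disjI1 [OF s]])
  have comp: "diffeo_smooth (subset_plots (product_plots (manifold_plots X1) (manifold_plots X1))
      {(g, h). g \<in> Arr G \<and> h \<in> Arr G \<and> src G g = tgt G h}) (manifold_plots X1) (\<lambda>(g, h). gcomp G g h)"
    unfolding diffeo_smooth_def subset_plots_def product_plots_def manifold_plots_iff [OF X1]
  proof (intro allI impI conjI ballI, goal_cases)
    case (1 n U p)
    then show ?case by simp
  next
    case (2 n U p x)
    then have U: "openin (Euclidean_space n) U" and x: "x \<in> U"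
      and p1: "smooth_at (open_euclid_manifold n U) X1 (fst \<circ> p) x"
      and p2: "smooth_at (open_euclid_manifold n U) X1 (snd \<circ> p) x"
      and im: "p ` U \<subseteq> {(g, h). g \<in> Arr G \<and> h \<in> Arr G \<and> src G g = tgt G h}"
      by blast+
    note E = smooth_manifold_open_euclid [OF U]
    have "smooth_at (open_euclid_manifold n U) (fibre_product X1 X1 X0 (src G) (tgt G))
        (\<lambda>y. ((fst \<circ> p) y, (snd \<circ> p) y)) x"
      by (rule smooth_at_into_fibre_product [OF E X1 X1 FP p1 p2, where U = U])
        (use U x im in \<open>auto simp: openin_open_euclid image_subset_iff split_beta\<close>)
    then have p: "smooth_at (open_euclid_manifold n U) (fibre_product X1 X1 X0 (src G) (tgt G)) p x"
      by simp
    show ?case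
      by (rule smooth_at_compose [where f = p and x = x, OF E FP p smooth_map_imp_smooth_at [OF FP X1 c smooth_at_in_mpoints(2) [OF p]]])
  qed
  show ?thesis
    unfolding diffeological_groupoid_def g(2,3)
    using g(1) comp [unfolded g(2,3)] diffeology_manifold_plots [OF X0] diffeology_manifold_plots [OF X1]
      diffeo_smooth_manifold_plots [OF X1 X0 s'] diffeo_smooth_manifold_plots [OF X1 X0 t']
      diffeo_smooth_manifold_plots [OF X0 X1 smooth_map_imp_smooth_at [OF X0 X1 u]]
      diffeo_smooth_manifold_plots [OF X1 X1 smooth_map_imp_smooth_at [OF X1 X1 i]]
    by (intro conjI)
qed

section \<open>Tangent spaces as vector spaces\<close>

lemma cring_real_field: "cring real_field"
proof (rule cringI)
  show "abelian_group real_field"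
  proof (rule abelian_groupI)
    show "\<exists>y\<in>carrier real_field. y \<oplus>\<^bsub>real_field\<^esub> x = \<zero>\<^bsub>real_field\<^esub>" for x
      by (intro bexI [of _ "- x"]) (simp_all add: real_field_def)
  qed (simp_all add: real_field_def)
  show "comm_monoid real_field"
    by (rule comm_monoidI) (simp_all add: real_field_def)
qed (simp add: real_field_def algebra_simps)

lemma tangent_vectorsI:
  assumes "\<And>c. c \<in> charts_at M x \<Longrightarrow> w c \<in> euclid (mdim M)"
    and "\<And>c d. c \<in> charts_at M x \<Longrightarrow> d \<in> charts_at M x \<Longrightarrow>
      w d = total_deriv (mdim M) (transition c d) (snd c x) (w c)"
  shows "(\<lambda>c\<in>charts_at M x. w c) \<in> tangent_vectors M x"
proof -
  have "(\<lambda>c\<in>charts_at M x. w c) \<in> charts_at M x \<rightarrow>\<^sub>E euclid (mdim M)"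
    unfolding restrict_PiE_iff using assms(1) by blast
  moreover have "(\<lambda>c\<in>charts_at M x. w c) d =
      total_deriv (mdim M) (transition c d) (snd c x) ((\<lambda>c\<in>charts_at M x. w c) c)"
    if "c \<in> charts_at M x" "d \<in> charts_at M x" for c d
    using assms(2) [OF that] that by simp
  ultimately show ?thesis
    unfolding tangent_vectors_def mem_Collect_eq by (intro conjI ballI)
qed

text \<open>
  The transition derivatives are linear, so the condition relating coordinates in different charts is
  preserved by sums and multiples.
\<close>

lemma tangent_vectors_closed:
  assumes u: "u \<in> tangent_vectors M x"
  shows "v \<in> tangent_vectors M x \<Longrightarrow> (\<lambda>c\<in>charts_at M x. \<lambda>i. u c i + v c i) \<in> tangent_vectors M x"
    and "(\<lambda>c\<in>charts_at M x. \<lambda>i. r * u c i) \<in> tangent_vectors M x"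
proof -
  show "(\<lambda>c\<in>charts_at M x. \<lambda>i. r * u c i) \<in> tangent_vectors M x"
  proof (rule tangent_vectorsI)
    fix c assume c: "c \<in> charts_at M x"
    show "(\<lambda>i. r * u c i) \<in> euclid (mdim M)"
      using tangent_vector_coords(1) [OF u c] by (simp add: in_euclid)
    fix d assume d: "d \<in> charts_at M x"
    show "(\<lambda>i. r * u d i) = total_deriv (mdim M) (transition c d) (snd c x) (\<lambda>i. r * u c i)"
      unfolding total_deriv_linear(2) tangent_vector_coords(2) [OF u c d, symmetric] ..
  qed
  show "(\<lambda>c\<in>charts_at M x. \<lambda>i. u c i + v c i) \<in> tangent_vectors M x" if v: "v \<in> tangent_vectors M x"
  proof (rule tangent_vectorsI)
    fix c assume c: "c \<in> charts_at M x"
    show "(\<lambda>i. u c i + v c i) \<in> euclid (mdim M)"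
      using tangent_vector_coords(1) [OF u c] tangent_vector_coords(1) [OF v c] by (simp add: in_euclid)
    fix d assume d: "d \<in> charts_at M x"
    show "(\<lambda>i. u d i + v d i) = total_deriv (mdim M) (transition c d) (snd c x) (\<lambda>i. u c i + v c i)"
      unfolding total_deriv_linear(1) tangent_vector_coords(2) [OF u c d, symmetric]
        tangent_vector_coords(2) [OF v c d, symmetric] ..
  qed
qed

lemma zero_tangent_vector: "(\<lambda>c\<in>charts_at M x. \<lambda>i. 0) \<in> tangent_vectors M x"
  by (rule tangent_vectorsI) (simp_all add: in_euclid total_deriv_linear(3))

lemma tangent_vector_restrict: "u \<in> tangent_vectors M x \<Longrightarrow> (\<lambda>c\<in>charts_at M x. \<lambda>i. u c i) = u"
  by (rule PiE_restrict [OF conjunct1 [OF tangent_vectorsD]])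

lemma tangent_space_simps:
  "carrier (tangent_space M x) = tangent_vectors M x"
  "u \<oplus>\<^bsub>tangent_space M x\<^esub> v = (\<lambda>c\<in>charts_at M x. \<lambda>i. u c i + v c i)"
  "r \<odot>\<^bsub>tangent_space M x\<^esub> u = (\<lambda>c\<in>charts_at M x. \<lambda>i. r * u c i)"
  "\<zero>\<^bsub>tangent_space M x\<^esub> = (\<lambda>c\<in>charts_at M x. \<lambda>i. 0)"
  by (simp_all add: tangent_space_def)

lemma real_vector_space_tangent_space: "real_vector_space (tangent_space M x)"
proof (rule moduleI [OF cring_real_field])
  show "abelian_group (tangent_space M x)"
  proof (rule abelian_groupI, unfold tangent_space_simps)
    fix u assume u: "u \<in> tangent_vectors M x"
    show "(\<lambda>c\<in>charts_at M x. \<lambda>i. (\<lambda>c\<in>charts_at M x. \<lambda>i. 0) c i + u c i) = u"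
      using tangent_vector_restrict [OF u] by (simp cong: restrict_cong)
    show "\<exists>v\<in>tangent_vectors M x. (\<lambda>c\<in>charts_at M x. \<lambda>i. v c i + u c i) = (\<lambda>c\<in>charts_at M x. \<lambda>i. 0)"
      by (rule bexI [OF _ tangent_vectors_closed(2) [OF u, of "-1"]]) (simp cong: restrict_cong)
  qed (use tangent_vectors_closed zero_tangent_vector in \<open>simp_all add: add_ac cong: restrict_cong\<close>)
qed (use tangent_vectors_closed tangent_vector_restrict in
    \<open>simp_all add: tangent_space_simps real_field_def algebra_simps cong: restrict_cong\<close>)

text \<open>
  Transport of structure. The inverse of \<open>f\<close> is returned as the linear isomorphism because it is the
  map that sends a connected component to its tangent vector.
\<close>

lemma vector_space_on_bijective_image:
  fixes V :: "(real, 'v) module" and f :: "'v \<Rightarrow> 'w"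
  assumes V: "real_vector_space V" and f: "bij_betw f (carrier V) C"
  obtains W :: "(real, 'w) module" where "carrier W = C" "real_vector_space W"
    "linear_iso W V (inv_into (carrier V) f)"
proof -
  interpret V: Module.module real_field V by (rule V)
  define g where "g = inv_into (carrier V) f"
  have g: "bij_betw g C (carrier V)"
    unfolding g_def by (rule bij_betw_inv_into [OF f])
  have gC: "g x \<in> carrier V" "f (g x) = x" if "x \<in> C" for x
    using bij_betwE [OF g] bij_betw_inv_into_right [OF f] that by (auto simp: g_def)
  have fV: "f x \<in> C" "g (f x) = x" if "x \<in> carrier V" for x
    using bij_betwE [OF f] bij_betw_inv_into_left [OF f] that by (auto simp: g_def)
  define W :: "(real, 'w) module" where "W = \<lparr> carrier = C, mult = undefined, one = undefined, zero = f \<zero>\<^bsub>V\<^esub>,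
      add = (\<lambda>x y. f (g x \<oplus>\<^bsub>V\<^esub> g y)), smult = (\<lambda>r x. f (r \<odot>\<^bsub>V\<^esub> g x)) \<rparr>"
  have W: "carrier W = C" "\<zero>\<^bsub>W\<^esub> = f \<zero>\<^bsub>V\<^esub>" "x \<oplus>\<^bsub>W\<^esub> y = f (g x \<oplus>\<^bsub>V\<^esub> g y)" "r \<odot>\<^bsub>W\<^esub> x = f (r \<odot>\<^bsub>V\<^esub> g x)" for r x y
    by (simp_all add: W_def)
  have [simp]: "r \<in> carrier real_field" for r
    by (simp add: real_field_def)
  have "real_vector_space W"
  proof (rule moduleI [OF cring_real_field])
    show "abelian_group W"
    proof (rule abelian_groupI, unfold W)
      fix x assume x: "x \<in> C"
      show "\<exists>y\<in>C. f (g y \<oplus>\<^bsub>V\<^esub> g x) = f \<zero>\<^bsub>V\<^esub>"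
        using x by (intro bexI [of _ "f (\<ominus>\<^bsub>V\<^esub> g x)"]) (simp_all add: gC fV V.l_neg)
    qed (simp_all add: gC fV V.a_ac)
  qed (simp_all add: W gC fV V.smult_l_distr V.smult_r_distr V.smult_assoc1)
  moreover have "linear_iso W V g"
    using g by (simp add: linear_iso_def W gC fV)
  ultimately show thesis
    using that W(1) by (simp add: g_def)
qed

section \<open>The action groupoid\<close>

lemma is_groupoidD:
  assumes "is_groupoid G"
  shows "g \<in> Arr G \<Longrightarrow> src G g \<in> Obj G" "g \<in> Arr G \<Longrightarrow> tgt G g \<in> Obj G"
    "g \<in> Arr G \<Longrightarrow> h \<in> Arr G \<Longrightarrow> src G g = tgt G h \<Longrightarrow> gcomp G g h \<in> Arr G"
    "g \<in> Arr G \<Longrightarrow> h \<in> Arr G \<Longrightarrow> src G g = tgt G h \<Longrightarrow> src G (gcomp G g h) = src G h"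
    "g \<in> Arr G \<Longrightarrow> h \<in> Arr G \<Longrightarrow> src G g = tgt G h \<Longrightarrow> tgt G (gcomp G g h) = tgt G g"
    "g \<in> Arr G \<Longrightarrow> h \<in> Arr G \<Longrightarrow> k \<in> Arr G \<Longrightarrow> src G g = tgt G h \<Longrightarrow> src G h = tgt G k \<Longrightarrow>
      gcomp G (gcomp G g h) k = gcomp G g (gcomp G h k)"
    "x \<in> Obj G \<Longrightarrow> unit_arr G x \<in> Arr G" "x \<in> Obj G \<Longrightarrow> src G (unit_arr G x) = x"
    "x \<in> Obj G \<Longrightarrow> tgt G (unit_arr G x) = x"
    "g \<in> Arr G \<Longrightarrow> gcomp G g (unit_arr G (src G g)) = g"
    "g \<in> Arr G \<Longrightarrow> gcomp G (unit_arr G (tgt G g)) g = g"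
    "g \<in> Arr G \<Longrightarrow> inv_arr G g \<in> Arr G" "g \<in> Arr G \<Longrightarrow> src G (inv_arr G g) = tgt G g"
    "g \<in> Arr G \<Longrightarrow> tgt G (inv_arr G g) = src G g"
    "g \<in> Arr G \<Longrightarrow> gcomp G g (inv_arr G g) = unit_arr G (tgt G g)"
    "g \<in> Arr G \<Longrightarrow> gcomp G (inv_arr G g) g = unit_arr G (src G g)"
  using assms unfolding is_groupoid_def by simp_all

lemma groupoid_inv_inv:
  assumes G: "is_groupoid G" and g: "g \<in> Arr G"
  shows "inv_arr G (inv_arr G g) = g"
proof -
  note D = is_groupoidD [OF G]
  let ?k = "inv_arr G g"
  have k: "?k \<in> Arr G" "inv_arr G ?k \<in> Arr G"
    using D(12) g by blast+
  have "inv_arr G ?k = gcomp G (inv_arr G ?k) (unit_arr G (src G (inv_arr G ?k)))"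
    using D(10) [OF k(2)] by simp
  also have "unit_arr G (src G (inv_arr G ?k)) = gcomp G ?k g"
    using D(13) [OF k(1)] D(14,16) [OF g] by simp
  also have "gcomp G (inv_arr G ?k) (gcomp G ?k g) = gcomp G (gcomp G (inv_arr G ?k) ?k) g"
    using D(6) [OF k(2,1) g] D(13) [OF k(1)] D(13) [OF g] by simp
  also have "gcomp G (inv_arr G ?k) ?k = unit_arr G (tgt G g)"
    using D(16) [OF k(1)] D(13) [OF g] by simp
  also have "gcomp G (unit_arr G (tgt G g)) g = g"
    by (rule D(11) [OF g])
  finally show ?thesis .
qed

locale lie_principal_bundle =
  fixes X :: "('o, 'm) groupoid" and X0 :: "'o manifold" and X1 :: "'m manifold"
    and P :: "'p manifold" and M :: "'b manifold"
    and \<pi> :: "'p \<Rightarrow> 'b" and a :: "'p \<Rightarrow> 'o" and act :: "'p \<Rightarrow> 'm \<Rightarrow> 'p"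
  assumes lie: "lie_groupoid X X0 X1" and principal: "principal_bundle X X0 X1 P M \<pi> a act"
begin

abbreviation "A \<equiv> act_groupoid X X0 X1 P M \<pi> a act"
abbreviation "A0 \<equiv> pullback_tangent P M \<pi>"
abbreviation "A1 \<equiv> act_arrows X X0 X1 P M \<pi> a"
abbreviation "TM \<equiv> tangent_bundle M"

lemma X_groupoid: "is_groupoid X" and Obj_X: "Obj X = mpoints X0" and Arr_X: "Arr X = mpoints X1"
  and X0: "smooth_manifold X0" and X1: "smooth_manifold X1"
  and src_X: "submersion X1 X0 (src X)" and tgt_X: "submersion X1 X0 (tgt X)"
  and gcomp_X: "smooth_map (fibre_product X1 X1 X0 (src X) (tgt X)) X1 (\<lambda>(g, h). gcomp X g h)"
  and unit_X: "smooth_map X0 X1 (unit_arr X)" and inv_X: "smooth_map X1 X1 (inv_arr X)"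
  using lie by (simp_all add: lie_groupoid_def)

lemma P: "smooth_manifold P" and M: "smooth_manifold M" and \<pi>: "submersion P M \<pi>"
  and \<pi>_surj: "\<pi> ` mpoints P = mpoints M"
  and \<pi>_act: "p \<in> mpoints P \<Longrightarrow> g \<in> mpoints X1 \<Longrightarrow> a p = tgt X g \<Longrightarrow> \<pi> (act p g) = \<pi> p"
  and a: "smooth_map P X0 a"
  and act: "smooth_map (fibre_product P X1 X0 a (tgt X)) P (\<lambda>(p, g). act p g)"
  and act_in: "p \<in> mpoints P \<Longrightarrow> g \<in> mpoints X1 \<Longrightarrow> a p = tgt X g \<Longrightarrow> act p g \<in> mpoints P"
  and a_act: "p \<in> mpoints P \<Longrightarrow> g \<in> mpoints X1 \<Longrightarrow> a p = tgt X g \<Longrightarrow> a (act p g) = src X g"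
  and act_act: "p \<in> mpoints P \<Longrightarrow> g \<in> mpoints X1 \<Longrightarrow> h \<in> mpoints X1 \<Longrightarrow> a p = tgt X g \<Longrightarrow>
    src X g = tgt X h \<Longrightarrow> act (act p g) h = act p (gcomp X g h)"
  and act_unit: "p \<in> mpoints P \<Longrightarrow> act p (unit_arr X (a p)) = p"
  and action_diffeo: "diffeomorphism (fibre_product P X1 X0 a (tgt X)) (fibre_product P P M \<pi> \<pi>)
    (\<lambda>(p, g). (p, act p g))"
  using principal by (simp_all add: principal_bundle_def right_action_def Arr_X)

lemmas X_rules = is_groupoidD [OF X_groupoid, unfolded Obj_X Arr_X]

lemma smooth_at_a: "p \<in> mpoints P \<Longrightarrow> smooth_at P X0 a p"
  by (rule smooth_map_imp_smooth_at [OF P X0 a])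

lemma a_in: "p \<in> mpoints P \<Longrightarrow> a p \<in> mpoints X0"
  by (rule smooth_at_in_mpoints(2) [OF smooth_at_a])

lemma TM: "smooth_manifold TM"
  by (rule smooth_manifold_tangent_bundle [OF M])

lemma A0: "smooth_manifold A0"
  unfolding pullback_tangent_def
  by (rule smooth_manifold_fibre_product [OF P TM M submersion_smooth_at [OF P M \<pi>]
        smooth_at_tangent_projection [OF M] disjI1 [OF \<pi>]])

lemma mpoints_A0: "(p, m, u) \<in> mpoints A0 \<longleftrightarrow> p \<in> mpoints P \<and> m = \<pi> p \<and> u \<in> tangent_vectors M m"
proof -
  have "\<pi> p \<in> mpoints M" if "p \<in> mpoints P"
    using \<pi>_surj that by blast
  then show ?thesis
    unfolding pullback_tangent_def mpoints_fibre_product fibre_set_iff mpoints_tangent_bundle [OF M] by auto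
qed

text \<open>
  The anchor of \<open>P\<close> pulled back to the objects of the action groupoid, in the form in which it occurs
  in the definition of the arrows.
\<close>

definition anchor :: "'p \<times> 'b \<times> 'b tvec \<Rightarrow> 'o" where
  "anchor = (\<lambda>(p, m, u). a p)"

lemma anchor_eq: "anchor = a \<circ> fst"
  by (simp add: anchor_def fun_eq_iff)

lemma smooth_at_A0_fst: "z \<in> mpoints A0 \<Longrightarrow> smooth_at A0 P fst z"
  and smooth_at_A0_snd: "z \<in> mpoints A0 \<Longrightarrow> smooth_at A0 TM snd z"
  using smooth_at_fibre_product_projections [OF P TM A0 [unfolded pullback_tangent_def]]
  by (simp_all add: pullback_tangent_def)

lemma fst_A0: "z \<in> mpoints A0 \<Longrightarrow> fst z \<in> mpoints P"
  by (rule smooth_at_in_mpoints(2) [OF smooth_at_A0_fst])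

lemma smooth_at_anchor: "z \<in> mpoints A0 \<Longrightarrow> smooth_at A0 X0 anchor z"
  unfolding anchor_eq
  by (rule smooth_at_compose [OF A0 P smooth_at_A0_fst smooth_at_a [OF fst_A0]])

lemma A1_eq: "A1 = fibre_product A0 X1 X0 anchor (tgt X)"
  by (simp add: act_arrows_def anchor_def)

lemma A1: "smooth_manifold A1"
  unfolding A1_eq
  by (rule smooth_manifold_fibre_product [OF A0 X1 X0 smooth_at_anchor submersion_smooth_at [OF X1 X0 tgt_X]
        disjI2 [OF tgt_X]])

lemma mpoints_A1: "((p, m, u), g) \<in> mpoints A1 \<longleftrightarrow>
    p \<in> mpoints P \<and> m = \<pi> p \<and> u \<in> tangent_vectors M m \<and> g \<in> mpoints X1 \<and> a p = tgt X g"
  unfolding A1_eq mpoints_fibre_product fibre_set_iff mpoints_A0 by (auto simp: anchor_def)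

lemma A_simps:
  "Obj A = mpoints A0" "Arr A = mpoints A1" "src A = fst"
  "tgt A ((p, m, u), g) = (act p g, \<pi> (act p g), u)"
  "gcomp A (q, h) ((p, m, u), g) = ((p, m, u), gcomp X g h)"
  "unit_arr A (p, m, u) = ((p, m, u), unit_arr X (a p))"
  "inv_arr A ((p, m, u), g) = ((act p g, \<pi> (act p g), u), inv_arr X g)"
  by (simp_all add: act_groupoid_def fun_eq_iff split_beta)

lemma A_arrow_cases:
  assumes "z \<in> mpoints A1"
  obtains p u g where "z = ((p, \<pi> p, u), g)" "p \<in> mpoints P" "u \<in> tangent_vectors M (\<pi> p)"
    "g \<in> mpoints X1" "a p = tgt X g"
proof -
  obtain p m u g where z: "z = ((p, m, u), g)"
    by (cases z) auto
  have "p \<in> mpoints P \<and> m = \<pi> p \<and> u \<in> tangent_vectors M m \<and> g \<in> mpoints X1 \<and> a p = tgt X g"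
    using assms unfolding z mpoints_A1 .
  then show thesis
    using z by (intro that [of p u g]) auto
qed

lemma A_groupoid: "is_groupoid A"
  unfolding is_groupoid_def A_simps(1-3)
proof (intro conjI ballI impI)
  fix z assume "z \<in> mpoints A1"
  then obtain p u g where z: "z = ((p, \<pi> p, u), g)" "p \<in> mpoints P" "u \<in> tangent_vectors M (\<pi> p)"
    "g \<in> mpoints X1" "a p = tgt X g"
    by (rule A_arrow_cases)
  note g = \<pi>_act [OF z(2,4,5)] act_in [OF z(2,4,5)] a_act [OF z(2,4,5)]
  show "fst z \<in> mpoints A0" "tgt A z \<in> mpoints A0"
    using z g by (simp_all add: A_simps mpoints_A0)
  show "gcomp A z (unit_arr A (fst z)) = z" "gcomp A (unit_arr A (tgt A z)) z = z"
    using z g X_rules(10,11) [OF z(4)] by (simp_all add: A_simps)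
  have gg: "act (act p g) (inv_arr X g) = p"
    using act_act [OF z(2,4) X_rules(12) [OF z(4)] z(5)] X_rules(14,15) [OF z(4)] act_unit [OF z(2)] z(5) by simp
  show "inv_arr A z \<in> mpoints A1" "fst (inv_arr A z) = tgt A z" "tgt A (inv_arr A z) = fst z"
    "gcomp A z (inv_arr A z) = unit_arr A (tgt A z)" "gcomp A (inv_arr A z) z = unit_arr A (fst z)"
    using z g gg X_rules(12-16) [OF z(4)] by (simp_all add: A_simps mpoints_A1)
  fix w assume w: "w \<in> mpoints A1" and zw: "fst z = tgt A w"
  obtain q v h where w: "w = ((q, \<pi> q, v), h)" "q \<in> mpoints P" "v \<in> tangent_vectors M (\<pi> q)"
    "h \<in> mpoints X1" "a q = tgt X h"
    using w by (rule A_arrow_cases)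
  have p: "p = act q h" "u = v" "\<pi> p = \<pi> q"
    using zw z(1) w(1) \<pi>_act [OF w(2,4,5)] by (simp_all add: A_simps)
  have hg: "src X h = tgt X g"
    using a_act [OF w(2,4,5)] z(5) p(1) by simp
  note hg' = X_rules(3-5) [OF w(4) z(4) hg] act_act [OF w(2,4) z(4) w(5) hg]
  show "gcomp A z w \<in> mpoints A1" "fst (gcomp A z w) = fst w" "tgt A (gcomp A z w) = tgt A z"
    using z w hg' p by (simp_all add: A_simps mpoints_A1)
next
  fix z w y assume z: "z \<in> mpoints A1" and w: "w \<in> mpoints A1" and y: "y \<in> mpoints A1"
    and eq: "fst z = tgt A w \<and> fst w = tgt A y"
  obtain p u g where z: "z = ((p, \<pi> p, u), g)" "p \<in> mpoints P" "g \<in> mpoints X1" "a p = tgt X g"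
    using z by (rule A_arrow_cases)
  obtain q v h where w: "w = ((q, \<pi> q, v), h)" "q \<in> mpoints P" "h \<in> mpoints X1" "a q = tgt X h"
    using w by (rule A_arrow_cases)
  obtain r t k where y: "y = ((r, \<pi> r, t), k)" "r \<in> mpoints P" "k \<in> mpoints X1" "a r = tgt X k"
    using y by (rule A_arrow_cases)
  have "p = act q h" "q = act r k"
    using eq z(1) w(1) y(1) by (simp_all add: A_simps)
  then have "src X h = tgt X g" "src X k = tgt X h"
    using a_act [OF w(2,3,4)] a_act [OF y(2,3,4)] z(4) w(4) by simp_all
  then show "gcomp A (gcomp A z w) y = gcomp A z (gcomp A w y)"
    using X_rules(6) [OF y(3) w(3) z(3)] by (simp add: z(1) w(1) y(1) A_simps)
next
  fix z assume "z \<in> mpoints A0"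
  then obtain p u where z: "z = (p, \<pi> p, u)" "p \<in> mpoints P" "u \<in> tangent_vectors M (\<pi> p)"
    by (cases z) (simp add: mpoints_A0)
  note ap = a_in [OF z(2)]
  show "unit_arr A z \<in> mpoints A1" "fst (unit_arr A z) = z" "tgt A (unit_arr A z) = z"
    using z X_rules(7,9) [OF ap] act_unit [OF z(2)] by (simp_all add: A_simps mpoints_A1)
qed

lemma smooth_at_A1_fst: "z \<in> mpoints A1 \<Longrightarrow> smooth_at A1 A0 fst z"
  and smooth_at_A1_snd: "z \<in> mpoints A1 \<Longrightarrow> smooth_at A1 X1 snd z"
  using smooth_at_fibre_product_projections [OF A0 X1 A1 [unfolded A1_eq]]
  by (simp_all add: A1_eq)

lemma smooth_at_into_A1:
  assumes "smooth_manifold K" "smooth_at K A0 u x" "smooth_at K X1 v x" "openin (mspace K) U" "x \<in> U"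
    "\<And>y. y \<in> U \<Longrightarrow> a (fst (u y)) = tgt X (v y)"
  shows "smooth_at K A1 (\<lambda>y. (u y, v y)) x"
  unfolding A1_eq
  by (rule smooth_at_into_fibre_product [OF assms(1) A0 X1 A1 [unfolded A1_eq] assms(2-5)])
    (simp add: anchor_eq assms(6))

lemma submersion_src_A: "submersion A1 A0 (src A)"
  unfolding A_simps(3) A1_eq by (rule submersion_base_change [OF A0 X1 X0 smooth_at_anchor tgt_X])

text \<open>
  Since \<open>\<pi> (act p g) = \<pi> p\<close>, the component of the target in the tangent bundle is the one of the source;
  only the component in \<open>P\<close> is moved, by the action.
\<close>

lemma smooth_at_tgt_A:
  assumes z: "z \<in> mpoints A1"
  shows "smooth_at A1 A0 (tgt A) z"
proof -
  have FP: "smooth_manifold (fibre_product P X1 X0 a (tgt X))"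
    by (rule smooth_manifold_fibre_product [OF P X1 X0 smooth_at_a submersion_smooth_at [OF X1 X0 tgt_X]
          disjI2 [OF tgt_X]])
  have A1_top: "openin (mspace A1) (mpoints A1)"
    by (rule openin_topspace)
  have f0: "fst z \<in> mpoints A0"
    by (rule smooth_at_in_mpoints(2) [OF smooth_at_A1_fst [OF z]])
  have 1: "smooth_at A1 P (fst \<circ> fst) z"
    by (rule smooth_at_compose [OF A1 A0 smooth_at_A1_fst [OF z] smooth_at_A0_fst [OF f0]])
  have 2: "smooth_at A1 TM (snd \<circ> fst) z"
    by (rule smooth_at_compose [OF A1 A0 smooth_at_A1_fst [OF z] smooth_at_A0_snd [OF f0]])
  have pg: "smooth_at A1 (fibre_product P X1 X0 a (tgt X)) (\<lambda>w. ((fst \<circ> fst) w, snd w)) z"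
  proof (rule smooth_at_into_fibre_product [OF A1 P X1 FP 1 smooth_at_A1_snd [OF z] A1_top z])
    show "a ((fst \<circ> fst) w) = tgt X (snd w)" if "w \<in> mpoints A1" for w
      using that by (rule A_arrow_cases) simp
  qed
  have pg_act: "smooth_at A1 P ((\<lambda>(p, g). act p g) \<circ> (\<lambda>w. ((fst \<circ> fst) w, snd w))) z"
    by (rule smooth_at_compose [OF A1 FP pg smooth_map_imp_smooth_at [OF FP P act smooth_at_in_mpoints(2) [OF pg]]])
  have "smooth_at A1 A0
      (\<lambda>w. (((\<lambda>(p, g). act p g) \<circ> (\<lambda>w. ((fst \<circ> fst) w, snd w))) w, (snd \<circ> fst) w)) z"
    unfolding pullback_tangent_def
  proof (rule smooth_at_into_fibre_product [OF A1 [unfolded pullback_tangent_def] P TM A0 [unfolded pullback_tangent_def] pg_act 2 A1_top z])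
    show "\<pi> (((\<lambda>(p, g). act p g) \<circ> (\<lambda>w. ((fst \<circ> fst) w, snd w))) w) = fst ((snd \<circ> fst) w)"
      if "w \<in> mpoints A1" for w
      using that by (rule A_arrow_cases) (simp add: \<pi>_act)
  qed
  then show ?thesis
  proof (rule smooth_at_cong [OF _ A1_top z])
    show "(((\<lambda>(p, g). act p g) \<circ> (\<lambda>w. ((fst \<circ> fst) w, snd w))) w, (snd \<circ> fst) w) = tgt A w"
      if "w \<in> mpoints A1" for w
      using that by (rule A_arrow_cases) (simp add: \<pi>_act A_simps)
  qed
qed

lemma smooth_at_inv_A:
  assumes z: "z \<in> mpoints A1"
  shows "smooth_at A1 A1 (inv_arr A) z"
proof -
  have A1_top: "openin (mspace A1) (mpoints A1)"
    by (rule openin_topspace)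
  have g: "snd z \<in> mpoints X1"
    by (rule smooth_at_in_mpoints(2) [OF smooth_at_A1_snd [OF z]])
  have 1: "smooth_at A1 X1 (inv_arr X \<circ> snd) z"
    by (rule smooth_at_compose [OF A1 X1 smooth_at_A1_snd [OF z] smooth_map_imp_smooth_at [OF X1 X1 inv_X g]])
  have "smooth_at A1 A1 (\<lambda>w. (tgt A w, (inv_arr X \<circ> snd) w)) z"
  proof (rule smooth_at_into_A1 [OF A1 smooth_at_tgt_A [OF z] 1 A1_top z])
    show "a (fst (tgt A w)) = tgt X ((inv_arr X \<circ> snd) w)" if "w \<in> mpoints A1" for w
      using that by (rule A_arrow_cases) (simp add: A_simps a_act X_rules(14))
  qed
  then show ?thesis
  proof (rule smooth_at_cong [OF _ A1_top z])
    show "(tgt A w, (inv_arr X \<circ> snd) w) = inv_arr A w" if "w \<in> mpoints A1" for w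
      using that by (rule A_arrow_cases) (simp add: A_simps)
  qed
qed

text \<open>Inversion exchanges source and target, so it carries local sections of the source to local
  sections of the target.\<close>

lemma submersion_tgt_A: "submersion A1 A0 (tgt A)"
proof (rule submersionI [OF A1 A0 smooth_at_tgt_A])
  note D = is_groupoidD [OF A_groupoid, unfolded A_simps(1,2)]
  fix z assume z: "z \<in> mpoints A1"
  let ?z = "inv_arr A z"
  have z': "?z \<in> mpoints A1" "src A ?z = tgt A z"
    using D(12,13) z by blast+
  obtain \<sigma> V where \<sigma>: "smooth_at A0 A1 \<sigma> (src A ?z)" "\<sigma> (src A ?z) = ?z"
    and V: "openin (mspace A0) V" "src A ?z \<in> V" "\<And>y. y \<in> V \<Longrightarrow> src A (\<sigma> y) = y"
    by (rule submersion_local_section [OF A1 A0 submersion_src_A z'(1)], rule that)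
  obtain W where W: "openin (mspace A0) W" "src A ?z \<in> W" "\<sigma> ` W \<subseteq> mpoints A1"
    by (rule smooth_at_preimage [OF \<sigma>(1) openin_topspace smooth_at_in_mpoints(2) [OF \<sigma>(1)]], rule that)
  have "smooth_at A0 A1 (inv_arr A \<circ> \<sigma>) (tgt A z)"
    unfolding z'(2) [symmetric]
    by (rule smooth_at_compose [OF A0 A1 \<sigma>(1)]) (simp only: \<sigma>(2) smooth_at_inv_A [OF z'(1)])
  moreover have "(inv_arr A \<circ> \<sigma>) (tgt A z) = z"
    using \<sigma>(2) groupoid_inv_inv [OF A_groupoid, unfolded A_simps(2), OF z] by (simp add: z'(2))
  moreover have "openin (mspace A0) (V \<inter> W)" "tgt A z \<in> V \<inter> W"
    using V(1,2) W(1,2) z'(2) by (auto intro: openin_Int)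
  moreover have "tgt A ((inv_arr A \<circ> \<sigma>) y) = y" if y: "y \<in> V \<inter> W" for y
  proof -
    have "\<sigma> y \<in> mpoints A1"
      using y W(3) by blast
    then show ?thesis
      using D(14) V(3) y by simp
  qed
  ultimately show "\<exists>\<sigma> V. smooth_at A0 A1 \<sigma> (tgt A z) \<and> \<sigma> (tgt A z) = z \<and>
      openin (mspace A0) V \<and> tgt A z \<in> V \<and> (\<forall>y\<in>V. tgt A (\<sigma> y) = y)"
    by (intro exI [of _ "inv_arr A \<circ> \<sigma>"] exI [of _ "V \<inter> W"] conjI ballI)
qed

lemma smooth_at_unit_A:
  assumes z: "z \<in> mpoints A0"
  shows "smooth_at A0 A1 (unit_arr A) z"
proof -
  have A0_top: "openin (mspace A0) (mpoints A0)"
    by (rule openin_topspace)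
  have 1: "smooth_at A0 X1 (unit_arr X \<circ> anchor) z"
    by (rule smooth_at_compose [OF A0 X0 smooth_at_anchor [OF z] smooth_map_imp_smooth_at [OF X0 X1 unit_X
            smooth_at_in_mpoints(2) [OF smooth_at_anchor [OF z]]]])
  have "smooth_at A0 A1 (\<lambda>w. (w, (unit_arr X \<circ> anchor) w)) z"
    by (rule smooth_at_into_A1 [OF A0 smooth_at_id [OF A0 z] 1 A0_top z])
      (simp add: anchor_eq X_rules(9) a_in fst_A0)
  then show ?thesis
    by (rule smooth_at_cong [OF _ A0_top z]) (auto simp: A_simps anchor_def)
qed

text \<open>
  In a composable pair \<open>z\<close> the second arrow is applied first. If it acts by \<open>x\<close> and the other arrow by \<open>y\<close>,
  then the composite acts by \<open>xy\<close>, since the action is on the right. So the order of the pair has to be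
  reversed before the multiplication of \<open>X\<close> is applied to the components in \<open>X1\<close>.
\<close>

lemma smooth_at_gcomp_A:
  assumes z: "z \<in> mpoints (fibre_product A1 A1 A0 (src A) (tgt A))"
  shows "smooth_at (fibre_product A1 A1 A0 (src A) (tgt A)) A1 (\<lambda>(g, h). gcomp A g h) z"
proof -
  let ?F = "fibre_product A1 A1 A0 (src A) (tgt A)" and ?G = "fibre_product X1 X1 X0 (src X) (tgt X)"
  have F: "smooth_manifold ?F"
    by (rule smooth_manifold_fibre_product [OF A1 A1 A0 submersion_smooth_at [OF A1 A0 submersion_src_A]
          smooth_at_tgt_A disjI1 [OF submersion_src_A]])
  have G: "smooth_manifold ?G"
    by (rule smooth_manifold_fibre_product [OF X1 X1 X0 submersion_smooth_at [OF X1 X0 src_X]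
          submersion_smooth_at [OF X1 X0 tgt_X] disjI1 [OF src_X]])
  have F_top: "openin (mspace ?F) (mpoints ?F)"
    by (rule openin_topspace)
  note pr = smooth_at_fibre_product_projections [OF A1 A1 F z]
  note z1 = smooth_at_in_mpoints(2) [OF pr(1)] and z2 = smooth_at_in_mpoints(2) [OF pr(2)]
  have q: "smooth_at ?F A0 (fst \<circ> snd) z"
    by (rule smooth_at_compose [OF F A1 pr(2) smooth_at_A1_fst [OF z2]])
  have g: "smooth_at ?F X1 (snd \<circ> snd) z"
    by (rule smooth_at_compose [OF F A1 pr(2) smooth_at_A1_snd [OF z2]])
  have h: "smooth_at ?F X1 (snd \<circ> fst) z"
    by (rule smooth_at_compose [OF F A1 pr(1) smooth_at_A1_snd [OF z1]])
  have composable: "src X (snd (snd w)) = tgt X (snd (fst w)) \<and> a (fst (fst (snd w))) = tgt X (snd (snd w)) \<and>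
      snd (snd w) \<in> mpoints X1 \<and> snd (fst w) \<in> mpoints X1"
    if w: "w \<in> mpoints ?F" for w
  proof -
    have w': "fst w \<in> mpoints A1" "snd w \<in> mpoints A1" "fst (fst w) = tgt A (snd w)"
      using w unfolding mpoints_fibre_product by (cases w; simp add: fibre_set_iff A_simps(3))+
    obtain p u h where 1: "fst w = ((p, \<pi> p, u), h)" "h \<in> mpoints X1" "a p = tgt X h"
      using w'(1) by (rule A_arrow_cases)
    obtain q v g where 2: "snd w = ((q, \<pi> q, v), g)" "q \<in> mpoints P" "g \<in> mpoints X1" "a q = tgt X g"
      using w'(2) by (rule A_arrow_cases)
    have "p = act q g"
      using w'(3) 1(1) 2(1) by (simp add: A_simps)
    then show ?thesis
      using 1 2 a_act [OF 2(2,3,4)] by simp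
  qed
  have gh: "smooth_at ?F ?G (\<lambda>w. ((snd \<circ> snd) w, (snd \<circ> fst) w)) z"
    by (rule smooth_at_into_fibre_product [OF F X1 X1 G g h F_top z]) (simp add: composable)
  have comp: "smooth_at ?F X1 ((\<lambda>(g, h). gcomp X g h) \<circ> (\<lambda>w. ((snd \<circ> snd) w, (snd \<circ> fst) w))) z"
    by (rule smooth_at_compose [OF F G gh smooth_map_imp_smooth_at [OF G X1 gcomp_X smooth_at_in_mpoints(2) [OF gh]]])
  have "smooth_at ?F A1 (\<lambda>w. ((fst \<circ> snd) w,
      ((\<lambda>(g, h). gcomp X g h) \<circ> (\<lambda>w. ((snd \<circ> snd) w, (snd \<circ> fst) w))) w)) z"
    by (rule smooth_at_into_A1 [OF F q comp F_top z]) (simp add: composable X_rules(5))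
  then show ?thesis
    by (rule smooth_at_cong [OF _ F_top z]) (auto simp: A_simps split_beta act_groupoid_def)
qed

lemma lie_groupoid_A: "lie_groupoid A A0 A1"
proof -
  have F: "smooth_manifold (fibre_product A1 A1 A0 (src A) (tgt A))"
    by (rule smooth_manifold_fibre_product [OF A1 A1 A0 submersion_smooth_at [OF A1 A0 submersion_src_A]
          smooth_at_tgt_A disjI1 [OF submersion_src_A]])
  show ?thesis
    unfolding lie_groupoid_def
    by (intro conjI A_groupoid A_simps(1,2) A0 A1 submersion_src_A submersion_tgt_A
        smooth_mapI [OF F A1 smooth_at_gcomp_A] smooth_mapI [OF A0 A1 smooth_at_unit_A]
        smooth_mapI [OF A1 A1 smooth_at_inv_A])
qed

section \<open>The projection to the base\<close>

abbreviation "disc \<equiv> discrete_groupoid (mpoints M)"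
abbreviation "F0 \<equiv> act_proj_obj \<pi> :: 'p \<times> 'b \<times> 'b tvec \<Rightarrow> 'b"
abbreviation "F1 \<equiv> act_proj_arr \<pi> :: ('p \<times> 'b \<times> 'b tvec) \<times> 'm \<Rightarrow> 'b"

lemma proj_simps: "F0 (p, m, u) = \<pi> p" "F1 (z, g) = F0 z" "F0 = \<pi> \<circ> fst" "F1 = F0 \<circ> fst"
  by (simp_all add: act_proj_obj_def act_proj_arr_def fun_eq_iff split_beta)

lemma disc_simps: "Obj disc = mpoints M" "Arr disc = mpoints M" "src disc x = x" "tgt disc x = x"
  "gcomp disc x y = x" "unit_arr disc x = x"
  by (simp_all add: discrete_groupoid_def)

lemma smooth_at_F0: "z \<in> mpoints A0 \<Longrightarrow> smooth_at A0 M F0 z"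
  unfolding proj_simps(3)
  by (rule smooth_at_compose [OF A0 P smooth_at_A0_fst submersion_smooth_at [OF P M \<pi> fst_A0]])

lemma smooth_at_F1: "z \<in> mpoints A1 \<Longrightarrow> smooth_at A1 M F1 z"
  unfolding proj_simps(4)
  by (rule smooth_at_compose [OF A1 A0 smooth_at_A1_fst smooth_at_F0 [OF smooth_at_in_mpoints(2) [OF smooth_at_A1_fst]]])

lemma functor_A: "groupoid_functor A disc F0 F1"
  unfolding groupoid_functor_def disc_simps A_simps(1-3)
proof (intro conjI ballI impI)
  show "F0 ` mpoints A0 \<subseteq> mpoints M"
    using smooth_at_in_mpoints(2) [OF smooth_at_F0] by (rule image_subsetI)
  show "F1 ` mpoints A1 \<subseteq> mpoints M"
    using smooth_at_in_mpoints(2) [OF smooth_at_F1] by (rule image_subsetI)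
  show "F1 z = F0 (fst z)" for z
    by (simp add: proj_simps(4))
  show F1_tgt: "F1 z = F0 (tgt A z)" if "z \<in> mpoints A1" for z
    using that by (rule A_arrow_cases) (simp add: A_simps proj_simps(1,2) \<pi>_act)
  show "F1 (gcomp A z w) = F1 z" if "z \<in> mpoints A1" "w \<in> mpoints A1" "fst z = tgt A w" for z w
  proof -
    have "fst (gcomp A z w) = fst w"
      using is_groupoidD(4) [OF A_groupoid, unfolded A_simps(1-3)] that by blast
    then show ?thesis
      using F1_tgt [OF that(2)] that(3) by (simp add: proj_simps(4))
  qed
  show "F1 (unit_arr A z) = F0 z" for z
    by (cases z) (simp add: A_simps proj_simps(2))
qed

lemma surjective_F0: "F0 ` mpoints A0 = mpoints M"
proof
  show "F0 ` mpoints A0 \<subseteq> mpoints M"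
    using smooth_at_in_mpoints(2) [OF smooth_at_F0] by (rule image_subsetI)
  show "mpoints M \<subseteq> F0 ` mpoints A0"
  proof
    fix m assume "m \<in> mpoints M"
    then obtain p where p: "p \<in> mpoints P" "m = \<pi> p"
      using \<pi>_surj by blast
    have "(p, \<pi> p, \<lambda>c\<in>charts_at M (\<pi> p). \<lambda>i. 0) \<in> mpoints A0"
      using p(1) zero_tangent_vector by (simp add: mpoints_A0)
    from imageI [where f = F0, OF this] show "m \<in> F0 ` mpoints A0"
      by (simp add: p(2) proj_simps(1))
  qed
qed

lemma surjective_F1: "F1 ` mpoints A1 = mpoints M"
proof
  show "F1 ` mpoints A1 \<subseteq> mpoints M"
    using smooth_at_in_mpoints(2) [OF smooth_at_F1] by (rule image_subsetI)
  show "mpoints M \<subseteq> F1 ` mpoints A1"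
  proof
    fix m assume "m \<in> mpoints M"
    then obtain z where z: "z \<in> mpoints A0" "m = F0 z"
      using surjective_F0 by (metis imageE)
    have "unit_arr A z \<in> mpoints A1"
      using is_groupoidD(7) [OF A_groupoid, unfolded A_simps(1,2), OF z(1)] .
    moreover have "F1 (unit_arr A z) = F0 z"
      by (cases z) (simp add: A_simps proj_simps(2))
    ultimately show "m \<in> F1 ` mpoints A1"
      unfolding z(2) by (metis imageI)
  qed
qed

text \<open>
  This is where principality enters: the map \<open>(p, g) \<mapsto> (p, pg)\<close> is onto \<open>P \<times>\<^sub>M P\<close>.
\<close>

lemma action_transitive:
  assumes "p \<in> mpoints P" "q \<in> mpoints P" "\<pi> p = \<pi> q"
  obtains g where "g \<in> mpoints X1" "a p = tgt X g" "act p g = q"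
proof -
  have "(\<lambda>(p, g). (p, act p g)) ` mpoints (fibre_product P X1 X0 a (tgt X)) = mpoints (fibre_product P P M \<pi> \<pi>)"
    using action_diffeo unfolding diffeomorphism_def by (intro bij_betw_imp_surj_on) (rule conjunct1)
  moreover have "(p, q) \<in> mpoints (fibre_product P P M \<pi> \<pi>)"
    using assms by (simp add: mpoints_fibre_product fibre_set_iff)
  ultimately have "(p, q) \<in> (\<lambda>(p, g). (p, act p g)) ` fibre_set P X1 a (tgt X)"
    unfolding mpoints_fibre_product by (simp only:)
  then obtain w where w: "w \<in> fibre_set P X1 a (tgt X)" "(p, q) = (\<lambda>(p, g). (p, act p g)) w"
    by (rule imageE)
  obtain p' g where "w = (p', g)"
    by (cases w)
  then have "(p', g) \<in> fibre_set P X1 a (tgt X)" "(p, q) = (p', act p' g)"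
    using w by simp_all
  then show thesis
    by (intro that [of g]) (simp_all add: fibre_set_iff)
qed

lemma ex_over:
  assumes "m \<in> mpoints M"
  obtains p where "p \<in> mpoints P" "\<pi> p = m"
proof -
  have "m \<in> \<pi> ` mpoints P"
    using assms by (simp only: \<pi>_surj)
  then show thesis
    using that by auto
qed

definition component :: "'b \<Rightarrow> 'b tvec \<Rightarrow> ('p \<times> 'b \<times> 'b tvec) set" where
  "component m u = {(p, m, u) | p. p \<in> mpoints P \<and> \<pi> p = m}"

abbreviation "fibre m \<equiv> fibre_groupoid A disc F0 F1 m"

lemma Obj_fibre: "(p, m', u) \<in> Obj (fibre m) \<longleftrightarrow>
    p \<in> mpoints P \<and> \<pi> p = m \<and> m' = m \<and> u \<in> tangent_vectors M m"
  by (auto simp: fibre_groupoid_def A_simps mpoints_A0 proj_simps)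

text \<open>
  Arrows do not change \<open>u\<close>, and they connect any two points of \<open>P\<close> over \<open>m\<close>.
\<close>

lemma iso_rel_fibre:
  assumes "(p, m, u) \<in> Obj (fibre m)"
  shows "iso_rel (fibre m) `` {(p, m, u)} = component m u"
proof (intro equalityI subsetI)
  have p: "p \<in> mpoints P" "\<pi> p = m" "u \<in> tangent_vectors M m"
    using assms by (simp_all add: Obj_fibre)
  fix z assume "z \<in> iso_rel (fibre m) `` {(p, m, u)}"
  then obtain w where w: "w \<in> mpoints A1" "fst w = (p, m, u)" "tgt A w = z"
    by (auto simp: iso_rel_def fibre_groupoid_def A_simps(2,3))
  obtain q v g where q: "w = ((q, \<pi> q, v), g)" "q \<in> mpoints P" "g \<in> mpoints X1" "a q = tgt X g"
    using w(1) by (rule A_arrow_cases)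
  have "q = p" "v = u"
    using w(2) q(1) by simp_all
  then show "z \<in> component m u"
    using w(3) q \<pi>_act [OF q(2-4)] act_in [OF q(2-4)] p by (auto simp: A_simps component_def)
next
  have p: "p \<in> mpoints P" "\<pi> p = m" "u \<in> tangent_vectors M m"
    using assms by (simp_all add: Obj_fibre)
  fix z assume "z \<in> component m u"
  then obtain q where q: "z = (q, m, u)" "q \<in> mpoints P" "\<pi> q = m"
    by (auto simp: component_def)
  obtain g where g: "g \<in> mpoints X1" "a p = tgt X g" "act p g = q"
    using action_transitive [OF p(1) q(2)] p(2) q(3) by metis
  have "((p, m, u), g) \<in> Arr (fibre m)" "src (fibre m) ((p, m, u), g) = (p, m, u)"
    "tgt (fibre m) ((p, m, u), g) = z"
    using p q g by (simp_all add: fibre_groupoid_def A_simps mpoints_A1 proj_simps(1,2) disc_simps)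
  moreover have "z \<in> Obj (fibre m)"
    using p q by (simp add: Obj_fibre)
  ultimately show "z \<in> iso_rel (fibre m) `` {(p, m, u)}"
    using assms unfolding iso_rel_def by blast
qed

lemma connected_comps_fibre:
  assumes "m \<in> mpoints M"
  shows "connected_comps (fibre m) = component m ` tangent_vectors M m"
proof (intro equalityI subsetI)
  fix C assume "C \<in> connected_comps (fibre m)"
  then obtain z where z: "z \<in> Obj (fibre m)" "C = iso_rel (fibre m) `` {z}"
    unfolding connected_comps_def by (rule quotientE)
  obtain p m' u where "z = (p, m', u)"
    by (cases z) auto
  then show "C \<in> component m ` tangent_vectors M m"
    using z iso_rel_fibre [of p m u] by (auto simp: Obj_fibre)
next
  fix C assume "C \<in> component m ` tangent_vectors M m"
  then obtain u where u: "u \<in> tangent_vectors M m" "C = component m u" by blast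
  obtain p where "p \<in> mpoints P" "\<pi> p = m"
    using assms by (rule ex_over)
  then have "(p, m, u) \<in> Obj (fibre m)"
    using u by (simp add: Obj_fibre)
  then show "C \<in> connected_comps (fibre m)"
    unfolding connected_comps_def u(2) iso_rel_fibre [symmetric, OF \<open>(p, m, u) \<in> Obj (fibre m)\<close>]
    by (rule quotientI)
qed

text \<open>
  Surjectivity of \<open>\<pi>\<close> makes every component nonempty, so it determines its tangent vector.
\<close>

lemma inj_on_component:
  assumes "m \<in> mpoints M"
  shows "inj_on (component m) U"
proof (rule inj_onI)
  fix u v assume eq: "component m u = component m v"
  obtain p where "p \<in> mpoints P" "\<pi> p = m"
    using assms by (rule ex_over)
  then have "(p, m, u) \<in> component m v"
    unfolding eq [symmetric] by (simp add: component_def)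
  then show "u = v"
    by (simp add: component_def)
qed

lemma fibre_components_vector_space:
  assumes m: "m \<in> mpoints M"
  shows "\<exists>V \<kappa>. carrier V = connected_comps (fibre m) \<and>
    real_vector_space V \<and> linear_iso V (tangent_space M m) \<kappa> \<and>
    (\<forall>p u. (p, m, u) \<in> Obj (fibre m) \<longrightarrow> \<kappa> (iso_rel (fibre m) `` {(p, m, u)}) = u)"
proof -
  have bij: "bij_betw (component m) (carrier (tangent_space M m)) (connected_comps (fibre m))"
    using inj_on_component [OF m] by (simp add: bij_betw_def connected_comps_fibre [OF m] tangent_space_simps)
  obtain V where V: "carrier V = connected_comps (fibre m)" "real_vector_space V"
      "linear_iso V (tangent_space M m) (inv_into (carrier (tangent_space M m)) (component m))"
    by (rule vector_space_on_bijective_image [OF real_vector_space_tangent_space bij], rule that)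
  have "inv_into (carrier (tangent_space M m)) (component m) (iso_rel (fibre m) `` {(p, m, u)}) = u"
    if pu: "(p, m, u) \<in> Obj (fibre m)" for p u
  proof -
    have "u \<in> carrier (tangent_space M m)"
      using pu by (simp add: Obj_fibre tangent_space_simps)
    then show ?thesis
      unfolding iso_rel_fibre [OF pu] by (rule bij_betw_inv_into_left [OF bij])
  qed
  then show ?thesis
    using V by (intro exI conjI allI impI)
qed

end

theorem proposition11:
  fixes X :: "('o, 'm) groupoid" and X0 :: "'o manifold" and X1 :: "'m manifold"
    and P :: "'p manifold" and M :: "'b manifold"
    and \<pi> :: "'p \<Rightarrow> 'b" and a :: "'p \<Rightarrow> 'o" and act :: "'p \<Rightarrow> 'm \<Rightarrow> 'p"
  assumes "lie_groupoid X X0 X1"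
    and "principal_bundle X X0 X1 P M \<pi> a act"
  defines "A \<equiv> act_groupoid X X0 X1 P M \<pi> a act"
    and "A0 \<equiv> pullback_tangent P M \<pi>"
    and "A1 \<equiv> act_arrows X X0 X1 P M \<pi> a"
    and "disc \<equiv> discrete_groupoid (mpoints M)"
    and "F0 \<equiv> act_proj_obj \<pi>"
    and "F1 \<equiv> act_proj_arr \<pi>"
  shows "lie_groupoid A A0 A1 \<and>
    diffeological_groupoid A (manifold_plots A0) (manifold_plots A1) \<and>
    groupoid_functor A disc F0 F1 \<and>
    smooth_map A0 M F0 \<and> smooth_map A1 M F1 \<and>
    F0 ` Obj A = Obj disc \<and> F1 ` Arr A = Arr disc \<and>
    (\<forall>m\<in>mpoints M.
       \<exists>V \<kappa>. carrier V = connected_comps (fibre_groupoid A disc F0 F1 m) \<and>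
             real_vector_space V \<and> linear_iso V (tangent_space M m) \<kappa> \<and>
             (\<forall>p u. (p, m, u) \<in> Obj (fibre_groupoid A disc F0 F1 m) \<longrightarrow>
                \<kappa> (iso_rel (fibre_groupoid A disc F0 F1 m) `` {(p, m, u)}) = u))"
proof -
  interpret lie_principal_bundle X X0 X1 P M \<pi> a act
    by (rule lie_principal_bundle.intro [OF assms(1,2)])
  show ?thesis
    unfolding A_def A0_def A1_def disc_def F0_def F1_def A_simps(1,2) disc_simps(1,2)
    by (intro conjI ballI lie_groupoid_A lie_groupoid_imp_diffeological [OF lie_groupoid_A] functor_A
        smooth_mapI [OF A0 M smooth_at_F0] smooth_mapI [OF A1 M smooth_at_F1]
        surjective_F0 surjective_F1 fibre_components_vector_space)
qed

end
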